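(* Let $X_0$ be a compact metrizable space, $\mathfrak A=C(X_0)$, and let $G$ be a unimodular, amenable, second-countable locally compact group acting on $\mathfrak A$ by $\theta:G\to\mathrm{Aut}(\mathfrak A)$ so that $(\mathfrak A,G,\theta)$ is a uniquely ergodic $C^*$-dynamical system. Let $\alpha\in\mathrm{Aut}(\mathfrak A)$ commute with every $\theta_g$, let $u=(u_g)_{g\in G}$ be a continuous $1$-cocycle, and let $(\mathfrak A\rtimes_\alpha\mathbb Z,G,\Phi^u)$ be the associated skew product. Then $(\mathfrak A\rtimes_\alpha\mathbb Z,G,\Phi^u)$ is uniquely ergodic with respect to the fixed-point subalgebra if and only if for every $n\in\mathbb Z$ the $1$-cocycle $(u_g^{(n)})_{g\in G}$ is not a measurable non-continuous coboundary (that is, whenever $(u_g^{(n)})_{g\in G}$ is a measurable coboundary, it is a continuous coboundary).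
   Context: A $C^*$-dynamical system $(\mathfrak B,G,\beta)$ is a unital $C^*$-algebra $\mathfrak B$ with a group homomorphism $\beta:G\to\mathrm{Aut}(\mathfrak B)$ such that $g\mapsto\beta_g(b)$ is norm continuous for every $b\in\mathfrak B$. It is uniquely ergodic if there is exactly one $G$-invariant state (state $\varphi$ with $\varphi\circ\beta_g=\varphi$ for all $g$). Its fixed-point subalgebra is $\mathfrak B^G=\{b:\beta_g(b)=b\ \forall g\in G\}$. It is uniquely ergodic with respect to the fixed-point subalgebra if every state on $\mathfrak B^G$ has exactly one $G$-invariant state extension to $\mathfrak B$. $\omega_0$ is the unique $\theta$-invariant state of $\mathfrak A$ and $\mu_0$ the Borel probability measure on $X_0$ with $\omega_0(f)=\int f\,d\mu_0$. $\theta_g$ also denotes the homeomorphism of $X_0$ with $(\theta_g(a))(x)=a(\theta_g(x))$, and the induced automorphism of $L^\infty(X_0,\mu_0)$. A continuous $1$-cocycle is a continuous function $u:G\times X_0\to\mathbb T$ which, writing $u_g:=u(g,\cdot)\in C(X_0)$, satisfies $u_{gh}=\theta_g(u_h)u_g$ for all $g,h\in G$. It is a continuous (resp. measurable) coboundary if there is a continuous (resp. $L^\infty(X_0,\mu_0)$) $\mathbb T$-valued function $w$ with $u_g=\theta_g(w^* )w$ for all $g\in G$ (resp. the equality holding in $L^\infty(X_0,\mu_0)$). $\mathfrak A\rtimes_\alpha\mathbb Z$ is the universal crossed product, generated by $\mathfrak A$ and a unitary $V$ with $VaV^*=\alpha(a)$ for $a\in\mathfrak A$. For $g\in G$, $\Phi^u_g$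 is the automorphism of $\mathfrak A\rtimes_\alpha\mathbb Z$ with $\Phi^u_g(a)=\theta_g(a)$ for $a\in\mathfrak A$ and $\Phi^u_g(V)=u_gV$. For $n\in\mathbb Z$ the $1$-cocycle $(u_g^{(n)})_{g\in G}$ is $u_g^{(0)}=1$, $u_g^{(n)}=u_g\alpha(u_g)\cdots\alpha^{n-1}(u_g)$ for $n>0$, and $u_g^{(n)}=\alpha^{n}(u_g^* )\alpha^{n+1}(u_g^* )\cdots\alpha^{-1}(u_g^* )$ for $n<0$; thus $\Phi^u_g(V^n)=u_g^{(n)}V^n$. *)

theory Defs
  imports "HOL-Probability.Probability"
begin

section \<open>Unital C*-algebras\<close>

class cstar_algebra = real_normed_algebra_1 + banach +
  fixes scaleC :: "complex \<Rightarrow> 'a \<Rightarrow> 'a"  (infixr \<open>*\<^sub>C\<close> 75)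
    and star :: "'a \<Rightarrow> 'a"
  assumes scaleC_add_right: "c *\<^sub>C (x + y) = c *\<^sub>C x + c *\<^sub>C y"
    and scaleC_add_left: "(c + d) *\<^sub>C x = c *\<^sub>C x + d *\<^sub>C x"
    and scaleC_scaleC: "c *\<^sub>C d *\<^sub>C x = (c * d) *\<^sub>C x"
    and scaleR_scaleC: "r *\<^sub>R x = complex_of_real r *\<^sub>C x"
    and mult_scaleC_left: "(c *\<^sub>C x) * y = c *\<^sub>C (x * y)"
    and mult_scaleC_right: "x * (c *\<^sub>C y) = c *\<^sub>C (x * y)"
    and norm_scaleC: "norm (c *\<^sub>C x) = cmod c * norm x"
    and star_add: "star (x + y) = star x + star y"
    and star_scaleC: "star (c *\<^sub>C x) = cnj c *\<^sub>C star x"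
    and star_mult: "star (x * y) = star y * star x"
    and star_star: "star (star x) = x"
    and cstar_identity: "norm (star x * x) = (norm x)\<^sup>2"

instantiation complex :: cstar_algebra
begin
definition scaleC_complex :: "complex \<Rightarrow> complex \<Rightarrow> complex" where "scaleC_complex c x = c * x"
definition star_complex :: "complex \<Rightarrow> complex" where "star_complex = cnj"
instance
  by standard
    (simp_all add: scaleC_complex_def star_complex_def ring_distribs mult.assoc mult.left_commute
      scaleR_conv_of_real norm_mult power2_eq_square)
end

lemma norm_star: "norm (star x) = norm (x :: 'a::cstar_algebra)"
proof -
  have *: "norm y \<le> norm (star y)" for y :: 'a
  proof (cases "y = 0")
    case False
    have "norm y * norm y \<le> norm (star y) * norm y"
      using norm_mult_ineq[of "star y" y] by (simp add: cstar_identity power2_eq_square)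
    then show ?thesis using False by simp
  qed auto
  show ?thesis using *[of x] *[of "star x"] by (simp add: star_star)
qed

lemma star_diff: "star (x - y) = star x - star (y :: 'a::cstar_algebra)"
  using star_add[of "x - y" y] by (simp add: algebra_simps)

text \<open>Bounded continuous functions with pointwise operations.  When the domain is compact,
  \<^typ>\<open>'x \<Rightarrow>\<^sub>C complex\<close> is all of \<open>C(X)\<close>; only the topology given by the metric matters.\<close>

lemma norm_bcontfun_le:
  fixes f :: "'x::topological_space \<Rightarrow>\<^sub>C 'b::real_normed_vector"
  shows "norm (f x) \<le> norm f"
  using dist_bounded[of f x 0] by simp

lemma norm_bcontfun_leI:
  fixes f :: "'x::topological_space \<Rightarrow>\<^sub>C 'b::real_normed_vector"
  shows "(\<And>x. norm (f x) \<le> c) \<Longrightarrow> norm f \<le> c"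
  using dist_bound[of f 0 c] by simp

lemma bcontfunI_norm:
  assumes "continuous_on UNIV f" "\<And>x. norm (f x) \<le> c"
  shows "f \<in> bcontfun"
  using assms by (auto simp: bcontfun_def bounded_iff)

setup_lifting type_definition_bcontfun

instantiation bcontfun :: (metric_space, cstar_algebra) cstar_algebra
begin

lift_definition one_bcontfun :: "'a \<Rightarrow>\<^sub>C 'b" is "\<lambda>_. 1"
  by (rule const_bcontfun)

lift_definition times_bcontfun :: "('a \<Rightarrow>\<^sub>C 'b) \<Rightarrow> ('a \<Rightarrow>\<^sub>C 'b) \<Rightarrow> ('a \<Rightarrow>\<^sub>C 'b)"
  is "\<lambda>f g x. f x * g x"
proof -
  fix f g :: "'a \<Rightarrow> 'b" assume fg: "f \<in> bcontfun" "g \<in> bcontfun"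
  then obtain c d where cd: "\<And>x. norm (f x) \<le> c" "\<And>x. norm (g x) \<le> d"
    by (auto simp: bcontfun_def bounded_iff)
  have "norm (f x * g x) \<le> c * d" for x
    using cd[of x] order_trans[OF norm_ge_zero cd(1)[of x]]
    by (intro order_trans[OF norm_mult_ineq] mult_mono) simp_all
  with fg show "(\<lambda>x. f x * g x) \<in> bcontfun"
    by (intro bcontfunI_norm continuous_intros) (auto simp: bcontfun_def)
qed

lift_definition scaleC_bcontfun :: "complex \<Rightarrow> ('a \<Rightarrow>\<^sub>C 'b) \<Rightarrow> ('a \<Rightarrow>\<^sub>C 'b)"
  is "\<lambda>c f x. c *\<^sub>C f x"
proof -
  fix c and f :: "'a \<Rightarrow> 'b" assume f: "f \<in> bcontfun"
  then obtain d where d: "\<And>x. norm (f x) \<le> d"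
    by (auto simp: bcontfun_def bounded_iff)
  have "continuous_on UNIV (\<lambda>x. (c *\<^sub>C 1) * f x)"
    using f by (intro continuous_intros) (auto simp: bcontfun_def)
  then have "continuous_on UNIV (\<lambda>x. c *\<^sub>C f x)"
    by (simp add: mult_scaleC_left)
  then show "(\<lambda>x. c *\<^sub>C f x) \<in> bcontfun"
    by (rule bcontfunI_norm[where c = "cmod c * d"]) (simp add: norm_scaleC d mult_left_mono)
qed

lift_definition star_bcontfun :: "('a \<Rightarrow>\<^sub>C 'b) \<Rightarrow> ('a \<Rightarrow>\<^sub>C 'b)" is "\<lambda>f x. star (f x)"
proof -
  fix f :: "'a \<Rightarrow> 'b" assume f: "f \<in> bcontfun"
  then obtain d where d: "\<And>x. norm (f x) \<le> d"
    by (auto simp: bcontfun_def bounded_iff)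
  have "continuous_on UNIV (star :: 'b \<Rightarrow> 'b)"
    unfolding continuous_on_iff dist_norm star_diff[symmetric] norm_star by blast
  then have "continuous_on UNIV (\<lambda>x. star (f x))"
    using f by (auto simp: bcontfun_def intro: continuous_on_compose2)
  then show "(\<lambda>x. star (f x)) \<in> bcontfun"
    by (rule bcontfunI_norm[where c = d]) (simp add: norm_star d)
qed

instance
proof
  fix f g h :: "'a \<Rightarrow>\<^sub>C 'b" and c d :: complex and r :: real
  note pw = plus_bcontfun.rep_eq times_bcontfun.rep_eq scaleC_bcontfun.rep_eq
    star_bcontfun.rep_eq one_bcontfun.rep_eq scaleR_bcontfun.rep_eq zero_bcontfun.rep_eq
  show "f * g * h = f * (g * h)" by (rule bcontfun_eqI) (simp add: pw algebra_simps)
  show "(f + g) * h = f * h + g * h" by (rule bcontfun_eqI) (simp add: pw algebra_simps)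
  show "f * (g + h) = f * g + f * h" by (rule bcontfun_eqI) (simp add: pw algebra_simps)
  show "r *\<^sub>R f * g = r *\<^sub>R (f * g)" by (rule bcontfun_eqI) (simp add: pw)
  show "f * r *\<^sub>R g = r *\<^sub>R (f * g)" by (rule bcontfun_eqI) (simp add: pw)
  show "1 * f = f" by (rule bcontfun_eqI) (simp add: pw)
  show "f * 1 = f" by (rule bcontfun_eqI) (simp add: pw)
  have "(0 :: 'a \<Rightarrow>\<^sub>C 'b) undefined \<noteq> (1 :: 'a \<Rightarrow>\<^sub>C 'b) undefined" by (simp add: pw)
  then show "(0 :: 'a \<Rightarrow>\<^sub>C 'b) \<noteq> 1" by metis
  show "norm (f * g) \<le> norm f * norm g"
    by (rule norm_bcontfun_leI, unfold times_bcontfun.rep_eq, rule order_trans[OF norm_mult_ineq])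
      (intro mult_mono norm_bcontfun_le norm_ge_zero)
  show "norm (1 :: 'a \<Rightarrow>\<^sub>C 'b) = 1"
    using norm_bcontfun_le[of "1 :: 'a \<Rightarrow>\<^sub>C 'b" undefined]
      norm_bcontfun_leI[of "1 :: 'a \<Rightarrow>\<^sub>C 'b" 1]
    by (simp add: one_bcontfun.rep_eq)
  show "c *\<^sub>C (f + g) = c *\<^sub>C f + c *\<^sub>C g"
    by (rule bcontfun_eqI) (simp add: pw scaleC_add_right)
  show "(c + d) *\<^sub>C f = c *\<^sub>C f + d *\<^sub>C f"
    by (rule bcontfun_eqI) (simp add: pw scaleC_add_left)
  show "c *\<^sub>C d *\<^sub>C f = (c * d) *\<^sub>C f" by (rule bcontfun_eqI) (simp add: pw scaleC_scaleC)
  show "r *\<^sub>R f = complex_of_real r *\<^sub>C f" by (rule bcontfun_eqI) (simp add: pw scaleR_scaleC)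
  show "c *\<^sub>C f * g = c *\<^sub>C (f * g)" by (rule bcontfun_eqI) (simp add: pw mult_scaleC_left)
  show "f * c *\<^sub>C g = c *\<^sub>C (f * g)" by (rule bcontfun_eqI) (simp add: pw mult_scaleC_right)
  show "star (f + g) = star f + star g" by (rule bcontfun_eqI) (simp add: pw star_add)
  show "star (c *\<^sub>C f) = cnj c *\<^sub>C star f" by (rule bcontfun_eqI) (simp add: pw star_scaleC)
  show "star (f * g) = star g * star f" by (rule bcontfun_eqI) (simp add: pw star_mult)
  show "star (star f) = f" by (rule bcontfun_eqI) (simp add: pw star_star)
  show "norm (c *\<^sub>C f) = cmod c * norm f"
  proof (cases "c = 0")
    case True
    have "0 *\<^sub>C y = 0" for y :: 'b using norm_scaleC[of 0 y] by simp
    then have "c *\<^sub>C f = 0" using True by (intro bcontfun_eqI) (simp add: pw)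
    then show ?thesis using True by simp
  next
    case False
    have "norm (f x) \<le> norm (c *\<^sub>C f) / cmod c" for x
      using norm_bcontfun_le[of "c *\<^sub>C f" x] False
      by (simp add: scaleC_bcontfun.rep_eq norm_scaleC field_simps)
    then have "norm f \<le> norm (c *\<^sub>C f) / cmod c" by (rule norm_bcontfun_leI)
    moreover have "norm (c *\<^sub>C f) \<le> cmod c * norm f"
      by (rule norm_bcontfun_leI)
        (simp add: scaleC_bcontfun.rep_eq norm_scaleC mult_left_mono norm_bcontfun_le)
    ultimately show ?thesis using False by (simp add: field_simps)
  qed
  show "norm (star f * f) = (norm f)\<^sup>2"
  proof (rule antisym)
    have pt: "norm ((star f * f) x) = (norm (f x))\<^sup>2" for x
      by (simp add: times_bcontfun.rep_eq star_bcontfun.rep_eq cstar_identity)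
    show "norm (star f * f) \<le> (norm f)\<^sup>2"
      by (rule norm_bcontfun_leI) (simp add: pt power_mono norm_bcontfun_le)
    have "norm (f x) \<le> sqrt (norm (star f * f))" for x
      using norm_bcontfun_le[of "star f * f" x] pt[of x] by (simp add: real_le_rsqrt)
    then have "norm f \<le> sqrt (norm (star f * f))" by (rule norm_bcontfun_leI)
    then show "(norm f)\<^sup>2 \<le> norm (star f * f)"
      using power_mono[of "norm f" "sqrt (norm (star f * f))" 2] by simp
  qed
qed

end

definition star_hom :: "('a::cstar_algebra \<Rightarrow> 'b::cstar_algebra) \<Rightarrow> bool" where
  "star_hom f \<longleftrightarrow>
     (\<forall>x y. f (x + y) = f x + f y) \<and> (\<forall>c x. f (c *\<^sub>C x) = c *\<^sub>C f x) \<and>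
     (\<forall>x y. f (x * y) = f x * f y) \<and> (\<forall>x. f (star x) = star (f x)) \<and> f 1 = 1"

definition star_automorphism :: "('a::cstar_algebra \<Rightarrow> 'a) \<Rightarrow> bool" where
  "star_automorphism f \<longleftrightarrow> star_hom f \<and> bij f"

definition unitary :: "'a::cstar_algebra \<Rightarrow> bool" where
  "unitary v \<longleftrightarrow> star v * v = 1 \<and> v * star v = 1"

definition cstar_subalgebra :: "'a::cstar_algebra set \<Rightarrow> bool" where
  "cstar_subalgebra S \<longleftrightarrow> closed S \<and> 1 \<in> S \<and>
     (\<forall>x\<in>S. \<forall>y\<in>S. x + y \<in> S \<and> x * y \<in> S) \<and> (\<forall>c. \<forall>x\<in>S. c *\<^sub>C x \<in> S) \<and> (\<forall>x\<in>S. star x \<in> S)"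

definition cstar_generated :: "'a::cstar_algebra set \<Rightarrow> 'a set" where
  "cstar_generated S = \<Inter>{T. cstar_subalgebra T \<and> S \<subseteq> T}"

text \<open>A state of the unital C*-subalgebra \<open>S\<close>; only the values of \<open>\<phi>\<close> on \<open>S\<close> matter.\<close>

definition state_on :: "'a::cstar_algebra set \<Rightarrow> ('a \<Rightarrow> complex) \<Rightarrow> bool" where
  "state_on S \<phi> \<longleftrightarrow>
     (\<forall>x\<in>S. \<forall>y\<in>S. \<phi> (x + y) = \<phi> x + \<phi> y) \<and> (\<forall>c. \<forall>x\<in>S. \<phi> (c *\<^sub>C x) = c * \<phi> x) \<and>
     (\<forall>x\<in>S. Im (\<phi> (star x * x)) = 0 \<and> 0 \<le> Re (\<phi> (star x * x))) \<and> \<phi> 1 = 1"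


section \<open>Locally compact groups\<close>

text \<open>Groups are written additively, as in the library class \<^class>\<open>topological_group_add\<close>;
  they need not be commutative.

  On a second-countable locally compact Hausdorff space every Borel measure that is finite on
  compact sets is regular, so regularity does not have to be demanded below.\<close>

definition left_haar_measure :: "'g::topological_group_add measure \<Rightarrow> bool" where
  "left_haar_measure M \<longleftrightarrow> sets M = sets borel \<and> emeasure M UNIV \<noteq> 0 \<and>
     (\<forall>K. compact K \<longrightarrow> emeasure M K < \<infinity>) \<and>
     (\<forall>g. \<forall>A\<in>sets borel. emeasure M ((\<lambda>x. g + x) ` A) = emeasure M A)"

definition right_invariant_measure :: "'g::topological_group_add measure \<Rightarrow> bool" where
  "right_invariant_measure M \<longleftrightarrow> (\<forall>g. \<forall>A\<in>sets borel. emeasure M ((\<lambda>x. x + g) ` A) = emeasure M A)"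

definition unimodular :: "'g::topological_group_add itself \<Rightarrow> bool" where
  "unimodular _ \<longleftrightarrow> (\<exists>M :: 'g measure. left_haar_measure M \<and> right_invariant_measure M)"

definition ess_bounded :: "'g measure \<Rightarrow> ('g \<Rightarrow> real) set" where
  "ess_bounded M = {f \<in> borel_measurable M. \<exists>C. AE x in M. \<bar>f x\<bar> \<le> C}"

text \<open>A left-invariant mean on the real space \<open>L\<^sup>\<infinity>(G)\<close>; linearity and positivity modulo null sets
  make \<open>m\<close> well defined on equivalence classes.\<close>

definition left_invariant_mean ::
  "'g::topological_group_add measure \<Rightarrow> (('g \<Rightarrow> real) \<Rightarrow> real) \<Rightarrow> bool" where
  "left_invariant_mean M m \<longleftrightarrow>
     (\<forall>f\<in>ess_bounded M. \<forall>h\<in>ess_bounded M. m (\<lambda>x. f x + h x) = m f + m h) \<and>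
     (\<forall>c. \<forall>f\<in>ess_bounded M. m (\<lambda>x. c * f x) = c * m f) \<and>
     (\<forall>f\<in>ess_bounded M. (AE x in M. 0 \<le> f x) \<longrightarrow> 0 \<le> m f) \<and>
     m (\<lambda>_. 1) = 1 \<and>
     (\<forall>g. \<forall>f\<in>ess_bounded M. m (\<lambda>x. f (g + x)) = m f)"

definition amenable :: "'g::topological_group_add itself \<Rightarrow> bool" where
  "amenable _ \<longleftrightarrow> (\<exists>M :: 'g measure. left_haar_measure M \<and> (\<exists>m. left_invariant_mean M m))"


section \<open>C*-dynamical systems\<close>

definition cstar_dynamical_system ::
  "('g::topological_group_add \<Rightarrow> 'b::cstar_algebra \<Rightarrow> 'b) \<Rightarrow> bool" where
  "cstar_dynamical_system \<beta> \<longleftrightarrow>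
     (\<forall>g. star_automorphism (\<beta> g)) \<and> (\<forall>g h. \<beta> (g + h) = \<beta> g \<circ> \<beta> h) \<and>
     (\<forall>b. continuous_on UNIV (\<lambda>g. \<beta> g b))"

definition invariant_state :: "('g \<Rightarrow> 'b::cstar_algebra \<Rightarrow> 'b) \<Rightarrow> ('b \<Rightarrow> complex) \<Rightarrow> bool" where
  "invariant_state \<beta> \<phi> \<longleftrightarrow> state_on UNIV \<phi> \<and> (\<forall>g. \<phi> \<circ> \<beta> g = \<phi>)"

definition uniquely_ergodic :: "('g \<Rightarrow> 'b::cstar_algebra \<Rightarrow> 'b) \<Rightarrow> bool" where
  "uniquely_ergodic \<beta> \<longleftrightarrow> (\<exists>!\<phi>. invariant_state \<beta> \<phi>)"

definition fixed_points :: "('g \<Rightarrow> 'b \<Rightarrow> 'b) \<Rightarrow> 'b set" where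
  "fixed_points \<beta> = {b. \<forall>g. \<beta> g b = b}"

definition uniquely_ergodic_wrt_fixed_points :: "('g \<Rightarrow> 'b::cstar_algebra \<Rightarrow> 'b) \<Rightarrow> bool" where
  "uniquely_ergodic_wrt_fixed_points \<beta> \<longleftrightarrow>
     (\<forall>\<phi>. state_on (fixed_points \<beta>) \<phi> \<longrightarrow>
        (\<exists>!\<psi>. invariant_state \<beta> \<psi> \<and> (\<forall>b\<in>fixed_points \<beta>. \<psi> b = \<phi> b)))"


section \<open>Universal crossed products by the integers\<close>

definition aut_power :: "('a \<Rightarrow> 'a) \<Rightarrow> int \<Rightarrow> 'a \<Rightarrow> 'a" where
  "aut_power \<alpha> n = (if 0 \<le> n then \<alpha> ^^ nat n else inv \<alpha> ^^ nat (- n))"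

definition unitary_power :: "'a::cstar_algebra \<Rightarrow> int \<Rightarrow> 'a" where
  "unitary_power V n = (if 0 \<le> n then V ^ nat n else star V ^ nat (- n))"

text \<open>The *-algebra of finite formal sums \<open>\<Sum>n. f n V\<^sup>n\<close>, with the multiplication and involution
  forced by \<open>V a V\<^sup>* = \<alpha> a\<close> and \<open>V\<^sup>* = V\<^sup>-\<^sup>1\<close>.\<close>

definition finite_sums :: "(int \<Rightarrow> 'a::zero) set" where
  "finite_sums = {f. finite {n. f n \<noteq> 0}}"

definition twisted_mult ::
  "('a::cstar_algebra \<Rightarrow> 'a) \<Rightarrow> (int \<Rightarrow> 'a) \<Rightarrow> (int \<Rightarrow> 'a) \<Rightarrow> int \<Rightarrow> 'a" where
  "twisted_mult \<alpha> f h n = (\<Sum>k | f k \<noteq> 0. f k * aut_power \<alpha> k (h (n - k)))"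

definition twisted_star :: "('a::cstar_algebra \<Rightarrow> 'a) \<Rightarrow> (int \<Rightarrow> 'a) \<Rightarrow> int \<Rightarrow> 'a" where
  "twisted_star \<alpha> f n = aut_power \<alpha> n (star (f (- n)))"

definition cstar_seminorm :: "('a::cstar_algebra \<Rightarrow> 'a) \<Rightarrow> ((int \<Rightarrow> 'a) \<Rightarrow> real) \<Rightarrow> bool" where
  "cstar_seminorm \<alpha> p \<longleftrightarrow>
     (\<forall>f\<in>finite_sums. 0 \<le> p f) \<and>
     (\<forall>f\<in>finite_sums. \<forall>h\<in>finite_sums. p (\<lambda>n. f n + h n) \<le> p f + p h) \<and>
     (\<forall>c. \<forall>f\<in>finite_sums. p (\<lambda>n. c *\<^sub>C f n) = cmod c * p f) \<and>
     (\<forall>f\<in>finite_sums. \<forall>h\<in>finite_sums. p (twisted_mult \<alpha> f h) \<le> p f * p h) \<and>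
     (\<forall>f\<in>finite_sums. p (twisted_mult \<alpha> (twisted_star \<alpha> f) f) = (p f)\<^sup>2)"

text \<open>\<open>crossed_product \<alpha> \<iota> V\<close>: the C*-algebra \<^typ>\<open>'b\<close>, with \<open>\<iota>\<close> embedding the C*-algebra \<^typ>\<open>'a\<close>,
  is the universal crossed product by \<open>\<alpha>\<close>.  A *-homomorphism from the finite sums to an arbitrary
  C*-algebra (that is, a covariant pair there) is, up to the choice of the C*-algebra around its
  image, the same as a C*-seminorm on the finite sums: pull back the norm, or conversely complete
  the quotient.  Universality thus says that the norm dominates every such seminorm, i.e. that it
  is the supremum of the norms in all covariant representations; put in this way it does not
  quantify over types.\<close>

definition crossed_product ::
  "('a::cstar_algebra \<Rightarrow> 'a) \<Rightarrow> ('a \<Rightarrow> 'b::cstar_algebra) \<Rightarrow> 'b \<Rightarrow> bool" where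
  "crossed_product \<alpha> \<iota> V \<longleftrightarrow>
     star_hom \<iota> \<and> inj \<iota> \<and> unitary V \<and>
     (\<forall>a. V * \<iota> a * star V = \<iota> (\<alpha> a)) \<and>
     cstar_generated (insert V (range \<iota>)) = UNIV \<and>
     (\<forall>p. cstar_seminorm \<alpha> p \<longrightarrow>
        (\<forall>f\<in>finite_sums. p f \<le> norm (\<Sum>n | f n \<noteq> 0. \<iota> (f n) * unitary_power V n)))"


section \<open>Cocycles, coboundaries and skew products\<close>

text \<open>The homeomorphism of \<open>X\<close> inducing an automorphism of \<open>C(X)\<close>.\<close>

definition induced_homeo :: "(('x::metric_space \<Rightarrow>\<^sub>C complex) \<Rightarrow> ('x \<Rightarrow>\<^sub>C complex)) \<Rightarrow> 'x \<Rightarrow> 'x" where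
  "induced_homeo \<sigma> =
     (THE h. homeomorphic_map euclidean euclidean h \<and>
        (\<forall>a x. apply_bcontfun (\<sigma> a) x = apply_bcontfun a (h x)))"

definition continuous_cocycle ::
  "('g::topological_group_add \<Rightarrow> ('x::metric_space \<Rightarrow>\<^sub>C complex) \<Rightarrow> ('x \<Rightarrow>\<^sub>C complex)) \<Rightarrow>
   ('g \<Rightarrow> ('x \<Rightarrow>\<^sub>C complex)) \<Rightarrow> bool" where
  "continuous_cocycle \<theta> u \<longleftrightarrow>
     continuous_on UNIV (\<lambda>(g, x). apply_bcontfun (u g) x) \<and>
     (\<forall>g x. cmod (apply_bcontfun (u g) x) = 1) \<and>
     (\<forall>g h. u (g + h) = \<theta> g (u h) * u g)"

definition continuous_coboundary ::
  "('g \<Rightarrow> ('x::metric_space \<Rightarrow>\<^sub>C complex) \<Rightarrow> ('x \<Rightarrow>\<^sub>C complex)) \<Rightarrow>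
   ('g \<Rightarrow> ('x \<Rightarrow>\<^sub>C complex)) \<Rightarrow> bool" where
  "continuous_coboundary \<theta> u \<longleftrightarrow>
     (\<exists>w. (\<forall>x. cmod (apply_bcontfun w x) = 1) \<and> (\<forall>g. u g = \<theta> g (star w) * w))"

definition measurable_coboundary ::
  "('g \<Rightarrow> ('x::metric_space \<Rightarrow>\<^sub>C complex) \<Rightarrow> ('x \<Rightarrow>\<^sub>C complex)) \<Rightarrow>
   'x measure \<Rightarrow> ('g \<Rightarrow> ('x \<Rightarrow>\<^sub>C complex)) \<Rightarrow> bool" where
  "measurable_coboundary \<theta> \<mu> u \<longleftrightarrow>
     (\<exists>w :: 'x \<Rightarrow> complex. w \<in> borel_measurable \<mu> \<and> (AE x in \<mu>. cmod (w x) = 1) \<and>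
        (\<forall>g. AE x in \<mu>. apply_bcontfun (u g) x = cnj (w (induced_homeo (\<theta> g) x)) * w x))"

definition cocycle_power ::
  "('a::cstar_algebra \<Rightarrow> 'a) \<Rightarrow> ('g \<Rightarrow> 'a) \<Rightarrow> int \<Rightarrow> 'g \<Rightarrow> 'a" where
  "cocycle_power \<alpha> u n g =
     (if 0 \<le> n then prod_list (map (\<lambda>k. aut_power \<alpha> k (u g)) [0..n - 1])
      else prod_list (map (\<lambda>k. aut_power \<alpha> k (star (u g))) [n..-1]))"

definition skew_product ::
  "('a \<Rightarrow> 'b::cstar_algebra) \<Rightarrow> 'b \<Rightarrow> ('g \<Rightarrow> 'a \<Rightarrow> 'a) \<Rightarrow> ('g \<Rightarrow> 'a) \<Rightarrow> 'g \<Rightarrow> 'b \<Rightarrow> 'b" where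
  "skew_product \<iota> V \<theta> u g =
     (THE \<Phi>. star_automorphism \<Phi> \<and> (\<forall>a. \<Phi> (\<iota> a) = \<iota> (\<theta> g a)) \<and> \<Phi> V = \<iota> (u g) * V)"

end

theory Submission
  imports Defs
begin

text \<open>An invariant state \<open>\<psi>\<close> of the skew product restricts to \<open>\<omega>\<^sub>0\<close> on \<open>C(X\<^sub>0)\<close>. By Cauchy--Schwarz the
  functional \<open>a \<mapsto> \<psi> (a V\<^sup>n)\<close> is bounded in \<open>L\<^sup>2(\<mu>\<^sub>0)\<close>, hence has a density \<open>h\<close>, and invariance reads
  \<open>h \<circ> \<theta>\<^sub>g = u\<^sub>g\<^sup>(\<^sup>n\<^sup>) h\<close>. Unique ergodicity makes \<open>\<bar>h\<bar>\<close> constant, so \<open>h \<noteq> 0\<close> exhibits \<open>u\<^sup>(\<^sup>n\<^sup>)\<close> as a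
  measurable coboundary. If all of these are continuous, with \<open>u\<^sub>g\<^sup>(\<^sup>n\<^sup>) = \<theta>\<^sub>g(w\<^sup>*) w\<close>, then \<open>w V\<^sup>n\<close> is fixed and
  \<open>\<psi> (a V\<^sup>n) = \<omega>\<^sub>0 (a w\<^sup>*) \<psi> (w V\<^sup>n)\<close>, so \<open>\<psi>\<close> is determined by its values on the fixed-point algebra. A state
  of that algebra is extended by Fejer averages of positive functionals built from the canonical
  state \<open>\<omega> = \<omega>\<^sub>0 \<circ> E\<close>, where \<open>E\<close> takes the zeroth Fourier coefficient.

  Conversely, a measurable coboundary \<open>u\<^sup>(\<^sup>n\<^sup>)\<close> yields an invariant state different from \<open>\<omega>\<close>, with nonzero values
  at some \<open>a V\<^sup>n\<close>. Unique ergodicity with respect to the fixed-point algebra separates the two states by a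
  fixed element; its \<open>n\<close>-th Fourier coefficient has constant modulus and continuously
  trivialises \<open>u\<^sup>(\<^sup>n\<^sup>)\<close>.\<close>

section \<open>Unital C*-algebras and states\<close>

text \<open>In the extension half the obstacle is positivity. The degrees \<open>n\<close> for which
  \<open>u^(n)\<close> is a continuous coboundary form a subgroup of the integers. If
  \<open>d > 0\<close> generates it, the fixed elements are limits of combinations of powers of one
  unitary \<open>W = w V^d\<close>, and the natural candidate for an extension of \<phi> sends
  \<open>b W^m\<close> to \<open>\<omega>\<^sub>0 b * \<phi> (W^m)\<close> and monomials of all
  other degrees to 0. This formula is neither visibly positive nor visibly bounded. Sandwiching with
  sums of powers of \<open>W\<close> gives functionals that are positive because \<omega> and \<phi>
  are, at the price of Fejer weights that tend to 1. The other constraint is that the norm of the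
  crossed product is known only as the largest C*-seminorm on finite sums. Maps out of it are
  therefore built as contractions on finite sums and extended by density. For Fourier coefficients
  and Fejer means contractivity comes from the dual action, averaged over finitely many roots of
  unity so that no integral over the circle enters.\<close>

interpretation scaleC: vector_space "scaleC :: complex \<Rightarrow> 'a::cstar_algebra \<Rightarrow> 'a"
proof
  fix c d :: complex and x y :: 'a
  show "1 *\<^sub>C x = x" using scaleR_scaleC[of 1 x] by simp
qed (simp_all add: scaleC_add_right scaleC_add_left scaleC_scaleC)

lemma star_zero [simp]: "star (0 :: 'a::cstar_algebra) = 0"
  using star_diff[of "0::'a" 0] by simp

lemma star_one [simp]: "star (1 :: 'a::cstar_algebra) = 1"
  by (metis mult_1 mult_1_right star_mult star_star)

lemma star_minus: "star (- x) = - star (x :: 'a::cstar_algebra)"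
  using star_diff[of 0 x] by simp

lemma star_sum: "star (sum f A) = (\<Sum>i\<in>A. star (f i :: 'a::cstar_algebra))"
  by (induction A rule: infinite_finite_induct) (simp_all add: star_add)

lemma star_power: "star (x ^ n) = star (x :: 'a::cstar_algebra) ^ n"
  by (induction n) (simp_all add: star_mult power_commutes)

lemma bounded_linear_star: "bounded_linear (star :: 'a::cstar_algebra \<Rightarrow> 'a)"
  by (rule bounded_linear_intro[where K = 1])
    (simp_all add: star_add norm_star scaleR_scaleC star_scaleC)

lemma bounded_linear_scaleC: "bounded_linear (scaleC c :: 'a::cstar_algebra \<Rightarrow> 'a)"
  by (rule bounded_linear_intro[where K = "cmod c"])
    (simp_all add: scaleC_add_right scaleR_scaleC scaleC_scaleC norm_scaleC mult.commute)

lemma norm_unitary: "star v * v = 1 \<Longrightarrow> norm (v :: 'a::cstar_algebra) = 1"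
  using cstar_identity[of v] by (simp add: power2_eq_1_iff) (use norm_ge_zero[of v] in linarith)

section \<open>Closure properties of C*-subalgebras\<close>

lemma cstar_subalgebra_UNIV: "cstar_subalgebra (UNIV :: 'a::cstar_algebra set)"
  by (simp add: cstar_subalgebra_def)

context
  fixes S :: "'a::cstar_algebra set"
  assumes S: "cstar_subalgebra S"
begin

lemma subalgebra_add: "x \<in> S \<Longrightarrow> y \<in> S \<Longrightarrow> x + y \<in> S"
  and subalgebra_mult: "x \<in> S \<Longrightarrow> y \<in> S \<Longrightarrow> x * y \<in> S"
  and subalgebra_scaleC: "x \<in> S \<Longrightarrow> c *\<^sub>C x \<in> S"
  and subalgebra_star: "x \<in> S \<Longrightarrow> star x \<in> S"
  and subalgebra_one: "1 \<in> S"
  and subalgebra_closed: "closed S"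
  using S by (auto simp: cstar_subalgebra_def)

lemma subalgebra_zero: "0 \<in> S"
  using subalgebra_scaleC[OF subalgebra_one, of 0] by simp

lemma subalgebra_uminus: "x \<in> S \<Longrightarrow> - x \<in> S"
  using subalgebra_scaleC[of x "- 1"] by (simp add: scaleC.scale_minus_left)

lemma subalgebra_diff: "x \<in> S \<Longrightarrow> y \<in> S \<Longrightarrow> x - y \<in> S"
  using subalgebra_add[of x "- y"] subalgebra_uminus[of y] by simp

lemma subalgebra_sum: "(\<And>i. i \<in> A \<Longrightarrow> f i \<in> S) \<Longrightarrow> sum f A \<in> S"
  by (induction A rule: infinite_finite_induct) (simp_all add: subalgebra_add subalgebra_zero)

lemma subalgebra_power: "x \<in> S \<Longrightarrow> x ^ n \<in> S"
  by (induction n) (simp_all add: subalgebra_mult subalgebra_one)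

lemma subalgebra_scaleR: "x \<in> S \<Longrightarrow> r *\<^sub>R x \<in> S"
  by (simp add: scaleR_scaleC subalgebra_scaleC)

end

lemmas subalgebra_intros = subalgebra_add subalgebra_mult subalgebra_scaleC subalgebra_star
  subalgebra_one subalgebra_zero subalgebra_uminus subalgebra_diff subalgebra_sum
  subalgebra_power subalgebra_scaleR

text \<open>The ratio of consecutive coefficients of \<open>sqrt (1 + x)\<close> is
  \<open>(1/2 - n) / (n + 1)\<close>, of modulus at most 1. Hence the binomial series in
  \<open>- a\<close> is dominated by the geometric series in \<open>norm a\<close>.\<close>

lemma abs_half_gbinomial_le: "\<bar>(1/2 :: real) gchoose n\<bar> \<le> 1"
proof (induction n)
  case (Suc n)
  have "((1/2::real) gchoose Suc n) = (1/2 gchoose n) * ((1/2 - real n) / real (Suc n))"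
    using gbinomial_mult_1[of "1/2 :: real" n] by (simp add: field_simps)
  moreover have "\<bar>(1/2 - real n) / real (Suc n)\<bar> \<le> 1"
    by (simp add: field_simps abs_le_iff)
  ultimately show ?case using Suc mult_mono[OF Suc, of _ 1] by (metis abs_ge_zero abs_mult mult_1 zero_le_one)
qed simp

text \<open>\<open>b\<close> is the sum of the binomial series of \<open>sqrt (1 - a)\<close>.\<close>

lemma cstar_sqrt:
  fixes a :: "'a::cstar_algebra"
  assumes S: "cstar_subalgebra S" and aS: "a \<in> S" and sa: "star a = a" and na: "norm a < 1"
  obtains b where "b \<in> S" "star b = b" "b * b = 1 - a" "\<And>c. c * a = a * c \<Longrightarrow> c * b = b * c"
proof -
  define t where "t n = ((1/2 :: real) gchoose n) *\<^sub>R (- a) ^ n" for n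
  have nt: "norm (t n) \<le> norm a ^ n" for n
  proof -
    have "norm (t n) \<le> 1 * norm ((- a) ^ n)"
      unfolding t_def norm_scaleR by (intro mult_right_mono abs_half_gbinomial_le) simp
    also have "\<dots> \<le> norm a ^ n" using norm_power_ineq[of "- a" n] by simp
    finally show ?thesis .
  qed
  have sn: "summable (\<lambda>n. norm (t n))"
    by (rule summable_comparison_test'[OF summable_geometric[of "norm a"]]) (use na nt in auto)
  then have st: "summable t" by (rule summable_norm_cancel)
  define b where "b = suminf t"
  have tS: "t n \<in> S" for n
    unfolding t_def by (intro subalgebra_intros[OF S] aS)
  have "(\<lambda>n. \<Sum>i<n. t i) \<longlonglongrightarrow> b" unfolding b_def by (rule summable_LIMSEQ[OF st])
  then have "b \<in> S"
    by (rule closed_sequentially[OF subalgebra_closed[OF S], rotated])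
      (intro subalgebra_intros[OF S] tS)
  moreover have "star b = b"
  proof -
    have "star (t n) = t n" for n
      by (simp add: t_def scaleR_scaleC star_scaleC star_power star_minus sa)
    then show ?thesis unfolding b_def
      using bounded_linear.suminf[OF bounded_linear_star st] by simp
  qed
  moreover have "c * b = b * c" if "c * a = a * c" for c
  proof -
    have "c * (- a) ^ n = (- a) ^ n * c" for n
      by (induction n) (simp_all, metis mult.assoc that)
    then have "c * t n = t n * c" for n by (simp add: t_def)
    then show ?thesis unfolding b_def
      by (simp add: suminf_mult[OF st, symmetric] suminf_mult2[OF st])
  qed
  moreover have "b * b = 1 - a"
  proof -
    \<comment> \<open>By Vandermonde the Cauchy square has the coefficients of
      \<open>(1 + x)^1\<close> at \<open>x = - a\<close>. They vanish from degree 2 on and leave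
      \<open>1 - a\<close>.\<close>
    have "(\<Sum>i\<le>k. t i * t (k - i)) = (1 gchoose k) *\<^sub>R (- a) ^ k" for k
    proof -
      have "(\<Sum>i\<le>k. t i * t (k - i)) =
          (\<Sum>i\<le>k. ((1/2 gchoose i) * (1/2 gchoose (k - i))) *\<^sub>R (- a) ^ k)"
        by (intro sum.cong refl) (simp add: t_def power_add[symmetric])
      also have "\<dots> = ((1/2 + 1/2 :: real) gchoose k) *\<^sub>R (- a) ^ k"
        using gbinomial_Vandermonde[of "1/2::real" "1/2" k]
        by (simp only: scaleR_sum_left[symmetric] atLeast0AtMost)
      finally show ?thesis by simp
    qed
    moreover have "(1 gchoose k :: real) = of_nat (1 choose k)" for k
      using binomial_gbinomial[of 1 k, where 'a = real] by simp
    ultimately have "(\<lambda>k. real (1 choose k) *\<^sub>R (- a) ^ k) sums (b * b)"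
      using Cauchy_product_sums[OF sn sn] by (simp add: b_def)
    moreover have "(\<lambda>k. real (1 choose k) *\<^sub>R (- a) ^ k) sums (\<Sum>k\<in>{..1}. real (1 choose k) *\<^sub>R (- a) ^ k)"
      by (rule sums_finite) (auto simp: binomial_eq_0)
    ultimately show ?thesis
      using sums_unique2 by fastforce
  qed
  ultimately show ?thesis using that by blast
qed

text \<open>For self-adjoint \<open>a\<close> with \<open>\<parallel>a\<parallel> < 1\<close> the element \<open>a + i sqrt (1 - a\<^sup>2)\<close> is unitary, so \<open>f a\<close> is
  the real part of a unitary. This avoids spectral theory.\<close>

lemma star_hom_norm_le:
  fixes f :: "'a::cstar_algebra \<Rightarrow> 'b::cstar_algebra"
  assumes f: "star_hom f"
  shows "norm (f x) \<le> norm x"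
proof -
  have add: "f (x + y) = f x + f y" and scale: "f (c *\<^sub>C x) = c *\<^sub>C f x"
    and mult: "f (x * y) = f x * f y" and star: "f (star x) = star (f x)" and one: "f 1 = 1"
    for x y c using f by (simp_all add: star_hom_def)
  have less: "norm (f a) \<le> 1" if a: "star a = a" "norm a < 1" for a
  proof -
    have "norm (a * a) < 1"
      using cstar_identity[of a] a by (simp add: power_less_one_iff)
    moreover have "star (a * a) = a * a" using a by (simp add: star_mult)
    ultimately obtain b where b: "star b = b" "b * b = 1 - a * a"
        "\<And>c. c * (a * a) = a * a * c \<Longrightarrow> c * b = b * c"
      using cstar_sqrt[OF cstar_subalgebra_UNIV UNIV_I, of "a * a"] by blast
    have ab: "a * b = b * a" by (rule b(3)) (simp add: mult.assoc)
    define v where "v = a + \<i> *\<^sub>C b"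
    have sv: "star v = a - \<i> *\<^sub>C b"
      by (simp add: v_def star_add star_scaleC a b scaleC.scale_minus_left)
    have "star v * v = (a - \<i> *\<^sub>C b) * (a + \<i> *\<^sub>C b)"
      by (subst sv) (simp add: v_def)
    also have "\<dots> = 1"
      by (simp add: left_diff_distrib distrib_left mult_scaleC_left mult_scaleC_right scaleC_scaleC
          scaleC_add_right scaleC.scale_right_diff_distrib ab b(2) scaleC.scale_minus_left)
    finally have "star v * v = 1" .
    then have "star (f v) * f v = 1" by (metis mult star one)
    then have nv: "norm (f v) = 1" by (rule norm_unitary)
    have "a = (1/2) *\<^sub>C (v + star v)"
    proof -
      have "v + star v = 2 *\<^sub>C a"
        unfolding sv using scaleC_add_left[of 1 1 a] by (simp add: v_def)
      then show ?thesis by (simp add: scaleC_scaleC)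
    qed
    then have "f a = (1/2) *\<^sub>C (f v + star (f v))"
      by (metis scale add star)
    then have "norm (f a) = norm (f v + star (f v)) / 2" by (simp add: norm_scaleC)
    also have "\<dots> \<le> 1"
      using norm_triangle_ineq[of "f v" "star (f v)"] nv by (simp add: norm_star)
    finally show ?thesis .
  qed
  have sa: "norm (f a) \<le> norm a" if a: "star a = a" for a
  proof (rule field_le_epsilon)
    fix e :: real assume e: "e > 0"
    \<comment> \<open>\<open>less\<close> covers only the open unit ball, where the square root
      series converges. Dividing by a number slightly above the norm brings every self-adjoint
      element into it.\<close>
    define r where "r = norm a + e"
    have r: "r > 0" "norm a < r" using e by (simp_all add: r_def add_nonneg_pos)
    have "norm (f (complex_of_real (1/r) *\<^sub>C a)) \<le> 1"
      by (rule less) (use a r in \<open>simp_all add: star_scaleC norm_scaleC norm_divide\<close>)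
    then have "norm (f a) \<le> r"
      using r by (simp add: scale norm_scaleC norm_divide field_simps)
    then show "norm (f a) \<le> norm a + e" by (simp add: r_def)
  qed
  have "(norm (f x))\<^sup>2 = norm (f (star x * x))"
    by (simp add: mult star cstar_identity)
  also have "\<dots> \<le> norm (star x * x)" by (rule sa) (simp add: star_mult star_star)
  also have "\<dots> = (norm x)\<^sup>2" by (rule cstar_identity)
  finally show ?thesis by (simp add: power2_le_iff_abs_le)
qed


section \<open>States: hermitian symmetry, Cauchy-Schwarz and boundedness\<close>

context
  fixes S :: "'a::cstar_algebra set" and \<phi> :: "'a \<Rightarrow> complex"
  assumes S: "cstar_subalgebra S" and \<phi>: "state_on S \<phi>"
begin

lemma state_add: "x \<in> S \<Longrightarrow> y \<in> S \<Longrightarrow> \<phi> (x + y) = \<phi> x + \<phi> y"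
  and state_scaleC: "x \<in> S \<Longrightarrow> \<phi> (c *\<^sub>C x) = c * \<phi> x"
  and state_one: "\<phi> 1 = 1"
  and state_Im: "x \<in> S \<Longrightarrow> Im (\<phi> (star x * x)) = 0"
  and state_Re: "x \<in> S \<Longrightarrow> 0 \<le> Re (\<phi> (star x * x))"
  using \<phi> by (simp_all add: state_on_def)

lemma state_zero: "\<phi> 0 = 0"
  using state_scaleC[of 1 0] by (simp add: subalgebra_intros[OF S])

lemma state_diff: "x \<in> S \<Longrightarrow> y \<in> S \<Longrightarrow> \<phi> (x - y) = \<phi> x - \<phi> y"
  using state_add[of x "(- 1) *\<^sub>C y"] state_scaleC[of y "- 1"]
  by (simp add: subalgebra_intros[OF S] scaleC.scale_minus_left)

lemma state_sum: "(\<And>i. i \<in> A \<Longrightarrow> f i \<in> S) \<Longrightarrow> \<phi> (sum f A) = (\<Sum>i\<in>A. \<phi> (f i))"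
  by (induction A rule: infinite_finite_induct)
    (simp_all add: state_zero state_add subalgebra_intros[OF S])

lemma state_expand:
  assumes x: "x \<in> S" and y: "y \<in> S"
  shows "\<phi> (star (x + l *\<^sub>C y) * (x + l *\<^sub>C y)) =
    \<phi> (star x * x) + l * \<phi> (star x * y) + cnj l * \<phi> (star y * x) + (cnj l * l) * \<phi> (star y * y)"
proof -
  have "star (x + l *\<^sub>C y) * (x + l *\<^sub>C y) =
    star x * x + l *\<^sub>C (star x * y) + cnj l *\<^sub>C (star y * x) + (cnj l * l) *\<^sub>C (star y * y)"
    by (simp add: star_add star_scaleC distrib_left distrib_right mult_scaleC_left
        mult_scaleC_right scaleC_scaleC scaleC_add_right add_ac mult.commute[of l])
  then show ?thesis
    by (simp add: state_add state_scaleC subalgebra_intros[OF S] x y)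
qed

text \<open>Polarisation: reality of the quadratic form at \<open>l = 1\<close> gives the imaginary
  parts, at \<open>l = \<i>\<close> the real parts.\<close>

lemma state_hermitian:
  assumes x: "x \<in> S" and y: "y \<in> S"
  shows "\<phi> (star x * y) = cnj (\<phi> (star y * x))"
proof -
  have "Im (\<phi> (star (x + l *\<^sub>C y) * (x + l *\<^sub>C y))) = 0" for l
    by (rule state_Im) (intro subalgebra_intros[OF S] x y)
  from this[of 1] this[of \<i>] show ?thesis
    unfolding state_expand[OF x y] by (simp add: complex_eq_iff state_Im x y)
qed

lemma state_Cauchy_Schwarz:
  assumes x: "x \<in> S" and y: "y \<in> S"
  shows "(cmod (\<phi> (star y * x)))\<^sup>2 \<le> Re (\<phi> (star x * x)) * Re (\<phi> (star y * y))"
proof -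
  define p where "p = \<phi> (star y * x)"
  define A where "A = Re (\<phi> (star x * x))"
  define B where "B = Re (\<phi> (star y * y))"
  have ge: "0 \<le> A - 2 * t * (cmod p)\<^sup>2 + t\<^sup>2 * (cmod p)\<^sup>2 * B" for t :: real
  proof -
    \<comment> \<open>The phase of \<open>p\<close> is absorbed into \<open>l\<close>, so that a
      real quadratic polynomial in \<open>t\<close> remains.\<close>
    define l where "l = - complex_of_real t * p"
    have "0 \<le> Re (\<phi> (star (x + l *\<^sub>C y) * (x + l *\<^sub>C y)))"
      by (rule state_Re) (intro subalgebra_intros[OF S] x y)
    also have "\<dots> = A + 2 * Re (cnj l * p) + (cmod l)\<^sup>2 * B"
      unfolding state_expand[OF x y] state_hermitian[OF x y]
      by (simp add: A_def B_def p_def state_Im y cmod_power2) (simp add: power2_eq_square algebra_simps)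
    also have "Re (cnj l * p) = - t * (cmod p)\<^sup>2"
      by (simp add: l_def cmod_power2) (simp add: power2_eq_square algebra_simps)
    also have "(cmod l)\<^sup>2 = t\<^sup>2 * (cmod p)\<^sup>2"
      by (simp add: l_def norm_mult power_mult_distrib)
    finally show ?thesis by simp
  qed
  have B: "B \<ge> 0" unfolding B_def by (rule state_Re[OF y])
  have "(cmod p)\<^sup>2 \<le> A * B"
  proof (cases "B = 0")
    case True
    have "(cmod p)\<^sup>2 = 0"
    proof (rule ccontr)
      assume "(cmod p)\<^sup>2 \<noteq> 0"
      \<comment> \<open>For \<open>B = 0\<close> the bound is affine in \<open>t\<close>, and this
        choice gives it the value -1.\<close>
      then show False using ge[of "(A + 1) / (2 * (cmod p)\<^sup>2)"] True by (simp add: field_simps)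
    qed
    then show ?thesis using True by simp
  next
    case False
    then show ?thesis using ge[of "1 / B"] B by (simp add: field_simps power2_eq_square)
  qed
  then show ?thesis by (simp add: p_def A_def B_def)
qed

text \<open>For \<open>c > norm x\<close> the element \<open>1 - star x * x / c^2\<close> is the
  square of a self-adjoint element of \<open>S\<close>, so \<phi> is nonnegative on it.
  Cauchy-Schwarz against 1 then passes from \<open>star x * x\<close> to \<open>x\<close>. The root
  has to lie in \<open>S\<close> because positivity is known only there.\<close>

lemma state_norm_le:
  assumes x: "x \<in> S"
  shows "cmod (\<phi> x) \<le> norm x"
proof (rule field_le_epsilon)
  fix e :: real assume e: "e > 0"
  define c where "c = norm x + e"
  have c: "c > 0" "norm x < c" using e by (simp_all add: c_def add_nonneg_pos)
  define a where "a = complex_of_real (1 / c\<^sup>2) *\<^sub>C (star x * x)"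
  have aS: "a \<in> S" unfolding a_def by (intro subalgebra_intros[OF S] x)
  have "norm a < 1"
    using c power_strict_mono[of "norm x" c 2]
    by (simp add: a_def norm_scaleC cstar_identity norm_divide norm_power)
  moreover have "star a = a" by (simp add: a_def star_scaleC star_mult star_star)
  ultimately obtain b where b: "b \<in> S" "star b = b" "b * b = 1 - a"
    using cstar_sqrt[OF S aS] by metis
  have "0 \<le> Re (\<phi> (1 - a))" using state_Re[OF b(1)] b by simp
  also have "\<dots> = 1 - Re (\<phi> (star x * x)) / c\<^sup>2"
    by (simp add: state_diff subalgebra_one[OF S] aS state_one)
      (simp add: a_def state_scaleC subalgebra_intros[OF S] x)
  finally have "Re (\<phi> (star x * x)) \<le> c\<^sup>2" using c by (simp add: field_simps)
  moreover have "(cmod (\<phi> x))\<^sup>2 \<le> Re (\<phi> (star x * x))"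
    using state_Cauchy_Schwarz[OF x subalgebra_one[OF S]] by (simp add: state_one)
  ultimately have "(cmod (\<phi> x))\<^sup>2 \<le> c\<^sup>2" by linarith
  then show "cmod (\<phi> x) \<le> norm x + e"
    using c power2_le_imp_le[of "cmod (\<phi> x)" c] by (simp add: c_def)
qed

end

lemma state_on_subset:
  "state_on UNIV \<phi> \<Longrightarrow> state_on S \<phi>"
  by (simp add: state_on_def)

section \<open>Algebras of continuous functions\<close>

lemmas bcontfun_apply_simps = plus_bcontfun.rep_eq minus_bcontfun.rep_eq uminus_bcontfun.rep_eq
  times_bcontfun.rep_eq scaleC_bcontfun.rep_eq star_bcontfun.rep_eq one_bcontfun.rep_eq
  scaleR_bcontfun.rep_eq zero_bcontfun.rep_eq scaleC_complex_def star_complex_def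

lemma bcontfun_mult_commute: "f * g = g * (f :: 'x::metric_space \<Rightarrow>\<^sub>C complex)"
  by (rule bcontfun_eqI) (simp add: bcontfun_apply_simps)

lemma bcontfun_mult_left_commute: "f * (g * h) = g * (f * (h :: 'x::metric_space \<Rightarrow>\<^sub>C complex))"
  by (rule bcontfun_eqI) (simp add: bcontfun_apply_simps)

lemma bcontfun_apply_power:
  "apply_bcontfun (f ^ n) x = apply_bcontfun (f :: 'x::metric_space \<Rightarrow>\<^sub>C complex) x ^ n"
  by (induction n) (simp_all add: bcontfun_apply_simps)

lemma bcontfun_apply_sum:
  "apply_bcontfun (sum f A) x = (\<Sum>i\<in>A. apply_bcontfun (f i :: 'x::metric_space \<Rightarrow>\<^sub>C complex) x)"
  by (induction A rule: infinite_finite_induct) (simp_all add: bcontfun_apply_simps)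

lemma continuous_on_apply_bcontfun: "continuous_on S (apply_bcontfun f)"
  using apply_bcontfun[of f] continuous_on_subset by (auto simp: bcontfun_def)

lemma continuous_on_apply_bcontfun_compose [continuous_intros]:
  "continuous_on S g \<Longrightarrow> continuous_on S (\<lambda>x. apply_bcontfun f (g x))"
  using continuous_on_compose2[OF continuous_on_apply_bcontfun[of UNIV f]] by auto

lemma apply_Bcontfun_compact:
  fixes f :: "'x::metric_space \<Rightarrow> complex"
  assumes "compact (UNIV :: 'x set)" "continuous_on UNIV f"
  shows "apply_bcontfun (Bcontfun f) = f"
  using assms compact_imp_bounded[OF compact_continuous_image[OF assms(2,1)]]
  by (intro Bcontfun_inverse) (simp add: bcontfun_def)

lemma apply_Bcontfun_compact':
  fixes f :: "'x::metric_space \<Rightarrow> complex"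
  assumes "compact (UNIV :: 'x set)" "continuous_on UNIV f"
  shows "apply_bcontfun (Bcontfun f) x = f x"
  using apply_Bcontfun_compact[OF assms] by simp

text \<open>If \<psi> were no evaluation, its kernel would contain for each point an element nonzero
  there. By compactness finitely many of them have a sum of \<open>star b * b\<close> that vanishes
  nowhere, which puts an invertible element into the kernel.\<close>

lemma character_is_evaluation:
  fixes \<psi> :: "('x::metric_space \<Rightarrow>\<^sub>C complex) \<Rightarrow> complex"
  assumes X: "compact (UNIV :: 'x set)" and \<psi>: "star_hom \<psi>"
  shows "\<exists>y. \<forall>a. \<psi> a = apply_bcontfun a y"
proof (rule ccontr)
  assume "\<not> ?thesis"
  then have "\<forall>y. \<exists>a. \<psi> a \<noteq> apply_bcontfun a y" by blast
  then obtain a where a: "\<And>y. \<psi> (a y) \<noteq> apply_bcontfun (a y) y" by metis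
  have add: "\<psi> (x + y) = \<psi> x + \<psi> y" and scale: "\<psi> (c *\<^sub>C x) = c * \<psi> x"
    and mult: "\<psi> (x * y) = \<psi> x * \<psi> y" and one: "\<psi> 1 = 1"
    for x y c using \<psi> by (simp_all add: star_hom_def scaleC_complex_def)
  define b where "b y = a y + (- \<psi> (a y)) *\<^sub>C 1" for y
  have \<psi>b: "\<psi> (b y) = 0" for y by (simp only: b_def add scale one) simp
  have by0: "apply_bcontfun (b y) y \<noteq> 0" for y
    using a[of y] by (simp add: b_def bcontfun_apply_simps)
  define U where "U y = {t. apply_bcontfun (b y) t \<noteq> 0}" for y
  have "open (U y)" for y
    unfolding U_def by (intro open_Collect_neq continuous_on_apply_bcontfun continuous_on_const)
  moreover have "UNIV \<subseteq> (\<Union>y\<in>UNIV. U y)" using by0 by (auto simp: U_def)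
  ultimately obtain Y where Y: "finite Y" "UNIV \<subseteq> (\<Union>y\<in>Y. U y)"
    by (rule compactE_image[OF X, of UNIV U]) auto
  define s where "s = (\<Sum>y\<in>Y. star (b y) * b y)"
  have s: "apply_bcontfun s t = of_real (\<Sum>y\<in>Y. (cmod (apply_bcontfun (b y) t))\<^sup>2)" for t
    by (simp add: s_def bcontfun_apply_sum bcontfun_apply_simps complex_norm_square mult.commute
        del: of_real_power)
  have s0: "apply_bcontfun s t \<noteq> 0" for t
  proof -
    obtain y where "y \<in> Y" "apply_bcontfun (b y) t \<noteq> 0" using Y by (auto simp: U_def)
    then have "0 < (\<Sum>y\<in>Y. (cmod (apply_bcontfun (b y) t))\<^sup>2)"
      using Y(1) by (intro sum_pos2[of _ y]) auto
    then show ?thesis unfolding s of_real_eq_0_iff by linarith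
  qed
  have "continuous_on UNIV (\<lambda>t. inverse (apply_bcontfun s t))"
    using s0 by (intro continuous_intros) auto
  then have "Bcontfun (\<lambda>t. inverse (apply_bcontfun s t)) * s = 1"
    using s0 by (intro bcontfun_eqI) (simp add: bcontfun_apply_simps apply_Bcontfun_compact'[OF X])
  moreover have "\<psi> s = 0"
  proof -
    have "\<psi> 0 = 0" using scale[of 0 0] by simp
    then have "\<psi> (sum f A) = (\<Sum>i\<in>A. \<psi> (f i))" for f :: "'x \<Rightarrow> _" and A
      by (induction A rule: infinite_finite_induct) (simp_all add: add)
    then show ?thesis by (simp add: s_def mult \<psi>b)
  qed
  ultimately show False using mult[of "Bcontfun (\<lambda>t. inverse (apply_bcontfun s t))" s] one by simp
qed

section \<open>Automorphisms of C(X) as homeomorphisms of X\<close>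

lemma star_automorphism_inv:
  assumes "star_automorphism \<sigma>" shows "star_automorphism (inv \<sigma>)"
proof -
  have b: "bij \<sigma>" and h: "star_hom \<sigma>" using assms by (simp_all add: star_automorphism_def)
  have e: "inv \<sigma> y = x" if "\<sigma> x = y" for x y
    using that b by (auto simp: bij_def)
  have r: "\<sigma> (inv \<sigma> y) = y" for y using b by (simp add: bij_def surj_f_inv_f)
  have "star_hom (inv \<sigma>)"
    unfolding star_hom_def using h by (intro conjI allI e) (simp_all add: star_hom_def r)
  then show ?thesis using b by (simp add: star_automorphism_def bij_imp_bij_inv)
qed

lemma continuous_separating:
  fixes y z :: "'x::metric_space"
  assumes X: "compact (UNIV :: 'x set)"
    and "\<And>a :: 'x \<Rightarrow>\<^sub>C complex. apply_bcontfun a y = apply_bcontfun a z"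
  shows "y = z"
proof -
  have "continuous_on UNIV (\<lambda>t. complex_of_real (dist t z))" by (intro continuous_intros)
  then show ?thesis
    using assms(2)[of "Bcontfun (\<lambda>t. complex_of_real (dist t z))"]
    by (simp add: apply_Bcontfun_compact'[OF X])
qed

lemma star_automorphism_point_map:
  fixes \<sigma> :: "('x::metric_space \<Rightarrow>\<^sub>C complex) \<Rightarrow> ('x \<Rightarrow>\<^sub>C complex)"
  assumes X: "compact (UNIV :: 'x set)" and \<sigma>: "star_automorphism \<sigma>"
  obtains h where "\<And>a x. apply_bcontfun (\<sigma> a) x = apply_bcontfun a (h x)" "continuous_on UNIV h"
proof -
  have hom: "star_hom \<sigma>" using \<sigma> by (simp add: star_automorphism_def)
  have "star_hom (\<lambda>a. apply_bcontfun (\<sigma> a) x)" for x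
    using hom by (simp add: star_hom_def bcontfun_apply_simps)
  then have "\<forall>x. \<exists>y. \<forall>a. apply_bcontfun (\<sigma> a) x = apply_bcontfun a y"
    using character_is_evaluation[OF X] by blast
  then obtain h where h: "\<And>a x. apply_bcontfun (\<sigma> a) x = apply_bcontfun a (h x)" by metis
  have "continuous_on UNIV h"
    unfolding continuous_on_iff
  proof (intro ballI allI impI)
    fix x and e :: real assume e: "e > 0"
    \<comment> \<open>The image of the distance to \<open>h x\<close> under \<sigma> is
      \<open>dist (h t) (h x)\<close> as a function of \<open>t\<close>; its continuity at
      \<open>x\<close> is exactly continuity of \<open>h\<close> at \<open>x\<close>.\<close>
    define a where "a = Bcontfun (\<lambda>t. complex_of_real (dist t (h x)))"
    have "continuous_on UNIV (\<lambda>t. complex_of_real (dist t (h x)))" by (intro continuous_intros)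
    then have "apply_bcontfun a t = complex_of_real (dist t (h x))" for t
      by (simp add: a_def apply_Bcontfun_compact'[OF X])
    then have ad: "apply_bcontfun (\<sigma> a) t = complex_of_real (dist (h t) (h x))" for t by (simp add: h)
    obtain d where "d > 0" "\<And>x'. dist x' x < d \<Longrightarrow> dist (apply_bcontfun (\<sigma> a) x') (apply_bcontfun (\<sigma> a) x) < e"
      using continuous_on_apply_bcontfun[of UNIV "\<sigma> a"] e unfolding continuous_on_iff by blast
    then show "\<exists>d>0. \<forall>x'\<in>UNIV. dist x' x < d \<longrightarrow> dist (h x') (h x) < e"
      unfolding ad by (auto simp: dist_norm)
  qed
  with h show ?thesis using that by blast
qed

text \<open>\<open>induced_homeo\<close> is a definite description. The point map of the inverse
  automorphism supplies a continuous inverse, and uniqueness holds because continuous functions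
  separate points.\<close>

lemma
  fixes \<sigma> :: "('x::metric_space \<Rightarrow>\<^sub>C complex) \<Rightarrow> ('x \<Rightarrow>\<^sub>C complex)"
  assumes X: "compact (UNIV :: 'x set)" and \<sigma>: "star_automorphism \<sigma>"
  shows induced_homeo_apply: "apply_bcontfun (\<sigma> a) x = apply_bcontfun a (induced_homeo \<sigma> x)"
    and continuous_induced_homeo: "continuous_on UNIV (induced_homeo \<sigma>)"
proof -
  obtain h where h: "\<And>a x. apply_bcontfun (\<sigma> a) x = apply_bcontfun a (h x)" "continuous_on UNIV h"
    by (rule star_automorphism_point_map[OF X \<sigma>]) (rule that)
  obtain k where k: "\<And>a x. apply_bcontfun (inv \<sigma> a) x = apply_bcontfun a (k x)" "continuous_on UNIV k"
    by (rule star_automorphism_point_map[OF X star_automorphism_inv[OF \<sigma>]]) (rule that)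
  have b: "\<sigma> (inv \<sigma> a) = a" "inv \<sigma> (\<sigma> a) = a" for a
    using \<sigma> by (simp_all add: star_automorphism_def bij_def surj_f_inv_f)
  have "h (k x) = x" for x by (rule continuous_separating[OF X]) (metis h(1) k(1) b)
  moreover have "k (h x) = x" for x by (rule continuous_separating[OF X]) (metis h(1) k(1) b)
  ultimately have hm: "homeomorphic_map euclidean euclidean h"
    unfolding homeomorphic_map_maps homeomorphic_maps_def using h(2) k(2) by auto
  have ih: "induced_homeo \<sigma> = h"
    unfolding induced_homeo_def
  proof (rule the_equality)
    fix h' assume h': "homeomorphic_map euclidean euclidean h' \<and>
      (\<forall>a x. apply_bcontfun (\<sigma> a) x = apply_bcontfun a (h' x))"
    then show "h' = h" using h(1) by (intro ext continuous_separating[OF X]) metis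
  qed (use hm h(1) in blast)
  show "apply_bcontfun (\<sigma> a) x = apply_bcontfun a (induced_homeo \<sigma> x)"
    "continuous_on UNIV (induced_homeo \<sigma>)" using h ih by auto
qed

text \<open>If \<open>\<iota>\<close> shrank the norm of \<open>s = a\<^sup>*a\<close> below \<open>\<delta> < \<parallel>s\<parallel>\<close>, then \<open>b = max (s - \<delta>) 0\<close> would be
  divisible by every \<open>s\<^sup>n\<close> with a quotient of norm at most \<open>\<parallel>b\<parallel> / \<delta>\<^sup>n\<close>, forcing \<open>\<iota> b = 0\<close>.\<close>

lemma inj_star_hom_isometric:
  fixes \<iota> :: "('x::metric_space \<Rightarrow>\<^sub>C complex) \<Rightarrow> 'b::cstar_algebra"
  assumes X: "compact (UNIV :: 'x set)" and hom: "star_hom \<iota>" and inj: "inj \<iota>"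
  shows "norm (\<iota> a) = norm a"
proof (rule antisym)
  show "norm (\<iota> a) \<le> norm a" by (rule star_hom_norm_le[OF hom])
  show "norm a \<le> norm (\<iota> a)"
  proof (rule ccontr)
    assume "\<not> ?thesis"
    then have lt: "norm (\<iota> a) < norm a" by simp
    have mult: "\<iota> (x * y) = \<iota> x * \<iota> y" and star: "\<iota> (star x) = star (\<iota> x)" and one: "\<iota> 1 = 1"
      and scale: "\<iota> (c *\<^sub>C x) = c *\<^sub>C \<iota> x" for x y c
      using hom by (simp_all add: star_hom_def)
    define s where "s = star a * a"
    define p where "p t = (cmod (apply_bcontfun a t))\<^sup>2" for t
    have s: "apply_bcontfun s t = of_real (p t)" for t
      by (simp add: s_def p_def bcontfun_apply_simps complex_norm_square mult.commute del: of_real_power)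
    have cp: "continuous_on UNIV p" unfolding p_def by (intro continuous_intros continuous_on_apply_bcontfun)
    have rs: "norm (\<iota> s) = (norm (\<iota> a))\<^sup>2" by (simp add: s_def mult star cstar_identity)
    have "norm (\<iota> s) < norm s"
      unfolding rs using lt by (simp add: s_def cstar_identity power_strict_mono)
    then obtain \<delta> where \<delta>: "norm (\<iota> s) < \<delta>" "\<delta> < norm s" using dense by blast
    have \<delta>0: "\<delta> > 0" using \<delta>(1) norm_ge_zero[of "\<iota> s"] by linarith
    obtain x0 where x0: "p x0 > \<delta>"
    proof (rule ccontr)
      assume *: "\<not> thesis"
      have "p x \<le> \<delta>" for x using that * by (meson not_le)
      then have "norm (apply_bcontfun s x) \<le> \<delta>" for x
        unfolding s norm_of_real by (simp add: p_def)
      then have "norm s \<le> \<delta>" by (rule norm_bcontfun_leI)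
      then show False using \<delta>(2) by linarith
    qed
    define b where "b = Bcontfun (\<lambda>t. complex_of_real (max (p t - \<delta>) 0))"
    have b: "apply_bcontfun b t = complex_of_real (max (p t - \<delta>) 0)" for t
      unfolding b_def by (intro apply_Bcontfun_compact'[OF X] continuous_intros cp)
    have le: "norm (\<iota> b) \<le> norm b * (norm (\<iota> s) / \<delta>) ^ n" for n
    proof -
      define c where "c = Bcontfun (\<lambda>t. complex_of_real (max (p t - \<delta>) 0 / max (p t) \<delta> ^ n))"
      have m0: "max (p t) \<delta> ^ n \<noteq> 0" for t using \<delta>0 by auto
      have c: "apply_bcontfun c t = complex_of_real (max (p t - \<delta>) 0 / max (p t) \<delta> ^ n)" for t
        unfolding c_def using m0 by (intro apply_Bcontfun_compact'[OF X] continuous_intros cp) auto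
      have "b = c * s ^ n"
      proof (rule bcontfun_eqI)
        fix t
        show "apply_bcontfun b t = apply_bcontfun (c * s ^ n) t"
        proof (cases "p t > \<delta>")
          case True
          then show ?thesis using \<delta>0
            by (simp add: b c s bcontfun_apply_simps bcontfun_apply_power)
        next
          case False
          then have "max (p t - \<delta>) 0 = 0" by simp
          then show ?thesis by (simp only: b c s bcontfun_apply_simps) simp
        qed
      qed
      moreover have "norm c \<le> norm b / \<delta> ^ n"
      proof (rule norm_bcontfun_leI)
        fix t
        have "norm (apply_bcontfun c t) = max (p t - \<delta>) 0 / max (p t) \<delta> ^ n"
          unfolding c norm_of_real using \<delta>0 by (intro abs_of_nonneg) auto
        also have "\<dots> \<le> max (p t - \<delta>) 0 / \<delta> ^ n"
          using \<delta>0 by (intro divide_left_mono power_mono mult_pos_pos zero_less_power) auto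
        also have "\<dots> = norm (apply_bcontfun b t) / \<delta> ^ n" by (simp add: b)
        also have "\<dots> \<le> norm b / \<delta> ^ n"
          using \<delta>0 by (intro divide_right_mono norm_bcontfun_le) simp
        finally show "norm (apply_bcontfun c t) \<le> norm b / \<delta> ^ n" .
      qed
      moreover have pw: "\<iota> (s ^ n) = \<iota> s ^ n" by (induction n) (simp_all add: one mult)
      ultimately have "norm (\<iota> b) \<le> norm (\<iota> c) * norm (\<iota> s ^ n)"
        by (simp add: mult norm_mult_ineq)
      also have "\<dots> \<le> (norm b / \<delta> ^ n) * norm (\<iota> s) ^ n"
        using \<open>norm c \<le> norm b / \<delta> ^ n\<close> star_hom_norm_le[OF hom, of c]
        by (intro mult_mono norm_power_ineq) (auto intro: order_trans[OF norm_ge_zero])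
      finally show ?thesis by (simp add: power_divide)
    qed
    have "(\<lambda>n. norm b * (norm (\<iota> s) / \<delta>) ^ n) \<longlonglongrightarrow> norm b * 0"
      using \<delta>(1) \<delta>0 by (intro tendsto_intros LIMSEQ_power_zero) simp
    then have "norm (\<iota> b) \<le> norm b * 0"
      by (rule Lim_bounded2) (use le in auto)
    then have "\<iota> b = 0" by simp
    moreover have "\<iota> 0 = 0" using scale[of 0 0] by simp
    ultimately have "b = 0" using inj by (metis injD)
    then show False using b[of x0] x0 by (simp add: zero_bcontfun.rep_eq)
  qed
qed

section \<open>Measures on metric spaces\<close>

lemma apply_bcontfun_borel: "apply_bcontfun (f :: 'x::metric_space \<Rightarrow>\<^sub>C complex) \<in> borel_measurable borel"
  by (intro borel_measurable_continuous_onI continuous_on_apply_bcontfun)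

lemma apply_star_mult_self:
  "apply_bcontfun (star a * a) x = of_real ((cmod (apply_bcontfun (a :: 'x::metric_space \<Rightarrow>\<^sub>C complex) x))\<^sup>2)"
  by (simp add: bcontfun_apply_simps complex_norm_square mult.commute del: of_real_power)

lemma finite_measure_eqI_continuous:
  fixes M N :: "'x::metric_space measure"
  assumes "finite_measure M" "finite_measure N" and sM: "sets M = sets borel" and sN: "sets N = sets borel"
    and eq: "\<And>f :: 'x \<Rightarrow> real. continuous_on UNIV f \<Longrightarrow> (\<And>x. 0 \<le> f x) \<Longrightarrow> (\<And>x. f x \<le> 1) \<Longrightarrow>
      (\<integral>x. f x \<partial>M) = (\<integral>x. f x \<partial>N)"
  shows "M = N"
proof -
  interpret M: finite_measure M by fact
  interpret N: finite_measure N by fact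
  have closed: "emeasure M C = emeasure N C" if C: "closed C" for C
  proof (cases "C = {}")
    case False
    define f where "f n x = max 0 (1 - real n * infdist x C)" for n x
    have cf: "continuous_on UNIV (f n)" for n unfolding f_def by (intro continuous_intros)
    have f01: "0 \<le> f n x" "f n x \<le> 1" for n x by (auto simp: f_def infdist_nonneg)
    have lim: "(\<lambda>n. f n x) \<longlonglongrightarrow> indicator C x" for x
    proof (cases "x \<in> C")
      case True
      then show ?thesis by (simp add: f_def)
    next
      case xC: False
      have "infdist x C > 0"
        using in_closed_iff_infdist_zero[OF C False] xC infdist_nonneg[of x C] by (simp add: less_le)
      then obtain n0 where n0: "1 < real n0 * infdist x C" using reals_Archimedean3 by blast
      have "f n x = 0" if "n \<ge> n0" for n
      proof -
        have "real n0 * infdist x C \<le> real n * infdist x C"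
          using that by (intro mult_right_mono infdist_nonneg) simp
        then show ?thesis using n0 by (simp add: f_def)
      qed
      then have "\<forall>\<^sub>F n in sequentially. f n x = indicator C x"
        using xC by (intro eventually_sequentiallyI[of n0]) simp
      then show ?thesis by (rule tendsto_eventually)
    qed
    have fb: "f n \<in> borel_measurable borel" for n
      by (rule borel_measurable_continuous_onI[OF cf])
    have conv: "(\<lambda>n. \<integral>x. f n x \<partial>L) \<longlonglongrightarrow> measure L C" if L: "finite_measure L" "sets L = sets borel" for L
    proof -
      interpret L: finite_measure L by fact
      have "(\<lambda>n. \<integral>x. f n x \<partial>L) \<longlonglongrightarrow> (\<integral>x. indicator C x \<partial>L)"
        using C fb f01 lim
        by (intro integral_dominated_convergence[where w = "\<lambda>_. 1"])
          (simp_all add: measurable_cong_sets[OF L(2) refl] L)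
      then show ?thesis using C by (simp add: L sets_eq_imp_space_eq[OF L(2)])
    qed
    have "measure M C = measure N C"
      using LIMSEQ_unique[OF conv[OF assms(1) sM]] conv[OF assms(2) sN] eq[OF cf f01] by simp
    then show ?thesis by (simp add: M.emeasure_eq_measure N.emeasure_eq_measure)
  qed simp
  show ?thesis
  proof (rule measure_eqI_generator_eq[where E = "Collect closed" and \<Omega> = UNIV and A = "\<lambda>_. UNIV"])
    show "Int_stable (Collect (closed :: 'x set \<Rightarrow> bool))" by (auto simp: Int_stable_def)
    have "sets borel = sigma_sets UNIV (Collect (closed :: 'x set \<Rightarrow> bool))"
      unfolding borel_eq_closed by (rule sets_measure_of) simp
    then show "sets M = sigma_sets UNIV (Collect closed)" "sets N = sigma_sets UNIV (Collect closed)"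
      using sM sN by simp_all
  qed (use closed in \<open>auto simp: M.emeasure_eq_measure\<close>)
qed

section \<open>Integrable functions tested against C(X)\<close>

context
  fixes \<mu> :: "'x::metric_space measure"
  assumes \<mu>: "prob_space \<mu>" and sets_\<mu>: "sets \<mu> = sets borel"
begin

interpretation prob_space \<mu> by (rule \<mu>)

lemma measurable_\<mu>: "f \<in> borel_measurable borel \<Longrightarrow> f \<in> borel_measurable \<mu>"
  by (simp add: measurable_cong_sets[OF sets_\<mu> refl])

lemma integrable_mult_bcontfun:
  fixes h :: "'x \<Rightarrow> complex"
  assumes "integrable \<mu> h" shows "integrable \<mu> (\<lambda>x. apply_bcontfun a x * h x)"
proof (rule Bochner_Integration.integrable_bound)
  show "integrable \<mu> (\<lambda>x. norm a * norm (h x))" using assms by simp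
  show "(\<lambda>x. apply_bcontfun a x * h x) \<in> borel_measurable \<mu>"
    using assms measurable_\<mu>[OF apply_bcontfun_borel] by (intro borel_measurable_times) auto
  show "AE x in \<mu>. norm (apply_bcontfun a x * h x) \<le> norm (norm a * norm (h x))"
    by (simp add: norm_mult mult_right_mono norm_bcontfun_le)
qed

lemma integrable_bcontfun: "integrable \<mu> (apply_bcontfun (a :: 'x \<Rightarrow>\<^sub>C complex))"
  using integrable_mult_bcontfun[of "\<lambda>_. 1" a] by simp

text \<open>The positive and negative parts of \<open>h\<close> are densities of two finite measures
  with the same integrals of continuous functions, hence of equal measures.\<close>

lemma AE_zero_if_integral_zero_real:
  fixes h :: "'x \<Rightarrow> real"
  assumes h: "integrable \<mu> h"
    and zero: "\<And>f :: 'x \<Rightarrow> real. continuous_on UNIV f \<Longrightarrow> (\<And>x. 0 \<le> f x) \<Longrightarrow> (\<And>x. f x \<le> 1) \<Longrightarrow>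
      (\<integral>x. f x * h x \<partial>\<mu>) = 0"
  shows "AE x in \<mu>. h x = 0"
proof -
  have hm [measurable]: "h \<in> borel_measurable \<mu>" using h by simp
  have fin: "finite_measure (density \<mu> (\<lambda>x. ennreal (k x)))" if "integrable \<mu> k" "\<And>x. 0 \<le> k x" for k
  proof (rule finite_measureI)
    have "(\<integral>\<^sup>+x. ennreal (k x) \<partial>\<mu>) < \<infinity>"
      using that by (subst nn_integral_eq_integral) auto
    then show "emeasure (density \<mu> (\<lambda>x. ennreal (k x))) (space (density \<mu> (\<lambda>x. ennreal (k x)))) \<noteq> \<infinity>"
      using that by (simp add: emeasure_density cong: nn_integral_cong)
  qed
  define p where "p x = max 0 (h x)" for x
  define q where "q x = max 0 (- h x)" for x
  have pq: "integrable \<mu> p" "integrable \<mu> q" "\<And>x. 0 \<le> p x" "\<And>x. 0 \<le> q x" "\<And>x. h x = p x - q x"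
    using h by (auto simp: p_def[abs_def] q_def[abs_def])
  have pqm [measurable]: "p \<in> borel_measurable \<mu>" "q \<in> borel_measurable \<mu>" using pq by simp_all
  have "density \<mu> (\<lambda>x. ennreal (p x)) = density \<mu> (\<lambda>x. ennreal (q x))"
  proof (rule finite_measure_eqI_continuous)
    fix f :: "'x \<Rightarrow> real" assume f: "continuous_on UNIV f" "\<And>x. 0 \<le> f x" "\<And>x. f x \<le> 1"
    have fm [measurable]: "f \<in> borel_measurable \<mu>"
      by (intro measurable_\<mu> borel_measurable_continuous_onI f)
    have i: "integrable \<mu> (\<lambda>x. k x * f x)" if "integrable \<mu> k" "\<And>x. 0 \<le> k x" for k
      using that f by (intro Bochner_Integration.integrable_bound[OF that(1)])
        (auto simp: abs_mult intro!: mult_left_le)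
    have "(\<integral>x. p x * f x \<partial>\<mu>) - (\<integral>x. q x * f x \<partial>\<mu>) = (\<integral>x. f x * h x \<partial>\<mu>)"
      using Bochner_Integration.integral_diff[OF i[OF pq(1,3)] i[OF pq(2,4)]]
      by (simp add: pq(5) algebra_simps)
    also have "\<dots> = 0" by (rule zero[OF f])
    finally show "(\<integral>x. f x \<partial>density \<mu> (\<lambda>x. ennreal (p x))) = (\<integral>x. f x \<partial>density \<mu> (\<lambda>x. ennreal (q x)))"
      by (simp add: integral_density pq)
  qed (auto simp: fin pq sets_\<mu>)
  then have "AE x in \<mu>. ennreal (p x) = ennreal (q x)" by (intro density_unique) auto
  then show ?thesis by eventually_elim (simp add: pq)
qed

lemma AE_zero_if_integral_zero:
  fixes h :: "'x \<Rightarrow> complex"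
  assumes h: "integrable \<mu> h"
    and zero: "\<And>a. (\<integral>x. apply_bcontfun a x * h x \<partial>\<mu>) = 0"
  shows "AE x in \<mu>. h x = 0"
proof -
  have *: "(\<integral>x. complex_of_real (f x) * h x \<partial>\<mu>) = 0" "integrable \<mu> (\<lambda>x. complex_of_real (f x) * h x)"
    if "continuous_on UNIV f" "\<And>x. 0 \<le> f x" "\<And>x. f x \<le> 1" for f :: "'x \<Rightarrow> real"
  proof -
    have "(\<lambda>x. complex_of_real (f x)) \<in> bcontfun"
      using that by (intro bcontfunI_norm[where c = 1] continuous_intros) auto
    then show "(\<integral>x. complex_of_real (f x) * h x \<partial>\<mu>) = 0" "integrable \<mu> (\<lambda>x. complex_of_real (f x) * h x)"
      using zero[of "Bcontfun (\<lambda>x. complex_of_real (f x))"]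
        integrable_mult_bcontfun[OF h, of "Bcontfun (\<lambda>x. complex_of_real (f x))"]
      by (simp_all add: Bcontfun_inverse)
  qed
  have "AE x in \<mu>. Re (h x) = 0"
  proof (rule AE_zero_if_integral_zero_real)
    fix f :: "'x \<Rightarrow> real" assume f: "continuous_on UNIV f" "\<And>x. 0 \<le> f x" "\<And>x. f x \<le> 1"
    have "(\<integral>x. f x * Re (h x) \<partial>\<mu>) = Re (\<integral>x. complex_of_real (f x) * h x \<partial>\<mu>)"
      using integral_Re[OF *(2)[OF f]] by simp
    then show "(\<integral>x. f x * Re (h x) \<partial>\<mu>) = 0" using *(1)[OF f] by simp
  qed (use h in simp)
  moreover have "AE x in \<mu>. Im (h x) = 0"
  proof (rule AE_zero_if_integral_zero_real)
    fix f :: "'x \<Rightarrow> real" assume f: "continuous_on UNIV f" "\<And>x. 0 \<le> f x" "\<And>x. f x \<le> 1"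
    have "(\<integral>x. f x * Im (h x) \<partial>\<mu>) = Im (\<integral>x. complex_of_real (f x) * h x \<partial>\<mu>)"
      using integral_Im[OF *(2)[OF f]] by simp
    then show "(\<integral>x. f x * Im (h x) \<partial>\<mu>) = 0" using *(1)[OF f] by simp
  qed (use h in simp)
  ultimately show ?thesis by eventually_elim (simp add: complex_eq_iff)
qed

text \<open>A minimising sequence of \<open>\<omega> (a\<^sup>*a) - 2 Re (l a)\<close>, chosen to converge fast, is Cauchy
  by the parallelogram law and so converges in \<open>L\<^sup>1\<close>.\<close>

lemma L2_bounded_functional_density:
  fixes l :: "('x \<Rightarrow>\<^sub>C complex) \<Rightarrow> complex"
  assumes \<omega>: "state_on UNIV \<omega>" "\<And>a. \<omega> a = (\<integral>x. apply_bcontfun a x \<partial>\<mu>)"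
    and add: "\<And>a b. l (a + b) = l a + l b" and scale: "\<And>c a. l (c *\<^sub>C a) = c * l a"
    and bound: "\<And>a. (cmod (l a))\<^sup>2 \<le> Re (\<omega> (star a * a))"
  obtains h where "integrable \<mu> h" "\<And>a. l a = (\<integral>x. apply_bcontfun a x * h x \<partial>\<mu>)"
proof -
  note st = cstar_subalgebra_UNIV \<omega>(1)
  define Q where "Q a = Re (\<omega> (star a * a))" for a
  define J where "J a = Q a - 2 * Re (l a)" for a
  have Q0: "Q a \<ge> 0" for a unfolding Q_def by (rule state_Re[OF st]) simp
  have Qexp: "Q (a + s *\<^sub>C b) = Q a + 2 * Re (s * \<omega> (star a * b)) + (cmod s)\<^sup>2 * Q b" for a b s
  proof -
    have "Re (cnj s * \<omega> (star b * a)) = Re (s * \<omega> (star a * b))"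
      unfolding state_hermitian[OF st UNIV_I UNIV_I, of b a] by simp
    moreover have "Re ((cnj s * s) * \<omega> (star b * b)) = (cmod s)\<^sup>2 * Q b"
      by (simp add: Q_def state_Im[OF st] cmod_power2) (simp add: power2_eq_square)
    ultimately show ?thesis
      unfolding Q_def state_expand[OF st UNIV_I UNIV_I] by simp
  qed
  have Jexp: "J (a + s *\<^sub>C b) = J a + 2 * Re (s * (\<omega> (star a * b) - l b)) + (cmod s)\<^sup>2 * Q b" for a b s
    by (simp add: J_def Qexp add scale algebra_simps)
  have Jlow: "- 1 \<le> J a" for a
  proof -
    have "2 * Re (l a) \<le> 2 * cmod (l a)" using complex_Re_le_cmod[of "l a"] by simp
    also have "\<dots> \<le> (cmod (l a))\<^sup>2 + 1"
      using sum_squares_bound[of "cmod (l a)" 1] by simp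
    also have "\<dots> \<le> Q a + 1" using bound[of a] by (simp add: Q_def)
    finally show ?thesis by (simp add: J_def)
  qed
  define m where "m = Inf (range J)"
  have bd: "bdd_below (range J)" using Jlow by (intro bdd_belowI[of _ "- 1"]) auto
  have m: "m \<le> J a" for a unfolding m_def by (rule cInf_lower[OF _ bd]) simp
  \<comment> \<open>The tolerance is a quarter of \<open>(1/4)^j\<close> because the parallelogram
    identity below multiplies it by four. Consecutive terms are then within \<open>(1/2)^j\<close>
    in L2, which is summable.\<close>
  have "\<exists>a. J a < m + (1/4) ^ j / 4" for j :: nat
    using cInf_lessD[of "range J" "m + (1/4) ^ j / 4"] by (auto simp: m_def)
  then obtain A where A: "\<And>j :: nat. J (A j) < m + (1/4) ^ j / 4" by metis
  have close: "Q (A (Suc j) - A j) \<le> (1/4) ^ j" for j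
  proof -
    define d where "d = A (Suc j) - A j"
    have half: "m \<le> J (A j + (1/2) *\<^sub>C d)" by (rule m)
    have full: "J (A (Suc j)) = J (A j + 1 *\<^sub>C d)" by (simp add: d_def)
    have "J (A j) + J (A (Suc j)) = 2 * J (A j + (1/2) *\<^sub>C d) + Q d / 2"
      unfolding full Jexp by (simp add: power2_eq_square)
    moreover have "J (A (Suc j)) < m + (1/4) ^ j / 4"
      by (rule less_le_trans[OF A]) simp
    ultimately have "Q d \<le> (1/4) ^ j" using half A[of j] by linarith
    then show ?thesis by (simp add: d_def)
  qed
  have weak: "(cmod (\<omega> (star (A j) * b) - l b))\<^sup>2 \<le> (Q b + 1) * (1/4) ^ j" for j b
  proof -
    define p where "p = \<omega> (star (A j) * b) - l b"
    \<comment> \<open>A perturbation of the near-minimiser \<open>A j\<close> along \<open>b\<close>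
      bounds the first variation \<open>p\<close>. The step \<open>t\<close> is close to the optimal
      \<open>1 / Q b\<close>; the added 1 keeps it defined when \<open>Q b = 0\<close>.\<close>
    define t where "t = 1 / (Q b + 1)"
    have t: "t > 0" "t * (Q b + 1) = 1" using Q0[of b] by (simp_all add: t_def)
    have "m \<le> J (A j + (- complex_of_real t * cnj p) *\<^sub>C b)" by (rule m)
    also have "\<dots> = J (A j) - 2 * t * (cmod p)\<^sup>2 + t\<^sup>2 * (cmod p)\<^sup>2 * Q b"
      unfolding Jexp p_def[symmetric]
      by (simp add: norm_mult power_mult_distrib cmod_power2) (simp add: power2_eq_square algebra_simps)
    finally have "2 * t * (cmod p)\<^sup>2 - t\<^sup>2 * (cmod p)\<^sup>2 * Q b \<le> (1/4) ^ j / 4"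
      using A[of j] by linarith
    moreover have "t\<^sup>2 * (cmod p)\<^sup>2 * Q b \<le> t * (cmod p)\<^sup>2"
    proof -
      have "t * Q b \<le> 1" using t by (simp add: algebra_simps)
      then have "(t * (cmod p)\<^sup>2) * (t * Q b) \<le> (t * (cmod p)\<^sup>2) * 1"
        using t(1) by (intro mult_left_mono) simp_all
      then show ?thesis by (simp add: power2_eq_square mult_ac)
    qed
    moreover have "(1/4) ^ j / 4 \<le> (1/4 :: real) ^ j" by simp
    ultimately have "t * (cmod p)\<^sup>2 \<le> (1/4) ^ j" by linarith
    then have "(Q b + 1) * (t * (cmod p)\<^sup>2) \<le> (Q b + 1) * (1/4) ^ j"
      using Q0[of b] by (intro mult_left_mono) auto
    then show ?thesis using t by (simp add: p_def mult.assoc[symmetric] mult.commute)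
  qed
  have weak_lim: "(\<lambda>j. \<omega> (star (A j) * b)) \<longlonglongrightarrow> l b" for b
  proof -
    have "(\<lambda>j. (Q b + 1) * (1/4 :: real) ^ j) \<longlonglongrightarrow> (Q b + 1) * 0"
      by (intro tendsto_mult tendsto_const LIMSEQ_power_zero) simp
    then have lim0: "(\<lambda>j. (Q b + 1) * (1/4 :: real) ^ j) \<longlonglongrightarrow> 0" by simp
    have "\<forall>\<^sub>F j in sequentially. norm ((cmod (\<omega> (star (A j) * b) - l b))\<^sup>2) \<le> (Q b + 1) * (1/4) ^ j"
      using weak by simp
    from Lim_null_comparison[OF this lim0] have "(\<lambda>j. (cmod (\<omega> (star (A j) * b) - l b))\<^sup>2) \<longlonglongrightarrow> 0" .
    from tendsto_real_sqrt[OF this] have "(\<lambda>j. cmod (\<omega> (star (A j) * b) - l b)) \<longlonglongrightarrow> 0"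
      by (simp only: real_sqrt_abs abs_norm_cancel real_sqrt_zero)
    then have "(\<lambda>j. \<omega> (star (A j) * b) - l b) \<longlonglongrightarrow> 0" by (rule tendsto_norm_zero_cancel)
    then show ?thesis by (rule LIM_zero_cancel)
  qed
  \<comment> \<open>Starting at 0 makes the partial sums of \<open>f\<close> telescope to
    \<open>star (e n)\<close>. The star matches the weak limit, where \<open>star (A j)\<close>
    stands on the left of \<open>b\<close>.\<close>
  define e where "e n = (case n of 0 \<Rightarrow> 0 | Suc j \<Rightarrow> A j)" for n
  define f where "f n x = apply_bcontfun (star (e (Suc n) - e n)) x" for n x
  have fi: "integrable \<mu> (f n)" for n unfolding f_def by (rule integrable_bcontfun)
  have fnorm: "(\<integral>x. norm (f (Suc n) x) \<partial>\<mu>) \<le> (1/2) ^ n" for n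
  proof -
    define d where "d = A (Suc n) - A n"
    define s where "s = (1/2 :: real) ^ n"
    have s: "s > 0" "s * s = (1/4) ^ n" by (simp_all add: s_def power_mult_distrib[symmetric])
    have fd: "norm (f (Suc n) x) = cmod (apply_bcontfun d x)" for x
      by (simp add: f_def e_def d_def bcontfun_apply_simps del: complex_cnj_diff)
    have Qd: "Q d = (\<integral>x. (cmod (apply_bcontfun d x))\<^sup>2 \<partial>\<mu>)"
    proof -
      have "Q d = Re (\<integral>x. apply_bcontfun (star d * d) x \<partial>\<mu>)" by (simp add: Q_def \<omega>)
      also have "\<dots> = (\<integral>x. Re (apply_bcontfun (star d * d) x) \<partial>\<mu>)"
        by (simp add: integral_Re integrable_bcontfun)
      finally show ?thesis
        by (simp only: apply_star_mult_self Re_complex_of_real)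
    qed
    have i2: "integrable \<mu> (\<lambda>x. (cmod (apply_bcontfun d x))\<^sup>2)"
      using integrable_Re[OF integrable_bcontfun[of "star d * d"]]
      by (simp only: apply_star_mult_self Re_complex_of_real)
    \<comment> \<open>Young's inequality with weight \<open>s\<close> bounds the L1 norm by the L2
      norm; since \<open>Q d \<le> s * s\<close>, both terms contribute at most
      \<open>s / 2\<close>.\<close>
    have "(\<integral>x. norm (f (Suc n) x) \<partial>\<mu>) \<le> (\<integral>x. (cmod (apply_bcontfun d x))\<^sup>2 / (2 * s) + s / 2 \<partial>\<mu>)"
    proof (rule integral_mono)
      fix x
      have "2 * cmod (apply_bcontfun d x) * s \<le> (cmod (apply_bcontfun d x))\<^sup>2 + s\<^sup>2"
        by (rule sum_squares_bound)
      then show "norm (f (Suc n) x) \<le> (cmod (apply_bcontfun d x))\<^sup>2 / (2 * s) + s / 2"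
        unfolding fd using s(1) by (simp add: field_simps power2_eq_square)
    qed (use i2 in \<open>auto simp: fi\<close>)
    also have "\<dots> = Q d / (2 * s) + s / 2"
      using i2 by (simp add: Qd prob_space)
    also have "\<dots> \<le> s"
    proof -
      have "Q d \<le> s * s" unfolding s using close[of n] by (simp add: d_def)
      then show ?thesis using s(1) by (simp add: field_simps power2_eq_square)
    qed
    finally show ?thesis by (simp add: s_def)
  qed
  have sumnorm: "summable (\<lambda>n. \<integral>x. norm (f n x) \<partial>\<mu>)"
  proof (subst summable_Suc_iff[symmetric], rule summable_comparison_test'[OF summable_geometric[of "1/2 :: real"]])
    show "norm (\<integral>x. norm (f (Suc n) x) \<partial>\<mu>) \<le> (1/2) ^ n" for n
      using fnorm[of n] by simp
  qed simp
  have AEsum: "AE x in \<mu>. summable (\<lambda>n. norm (f n x))"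
  proof -
    have fm [measurable]: "f n \<in> borel_measurable \<mu>" for n using fi by simp
    have "(\<integral>\<^sup>+x. (\<Sum>n. ennreal (norm (f n x))) \<partial>\<mu>) = (\<Sum>n. \<integral>\<^sup>+x. ennreal (norm (f n x)) \<partial>\<mu>)"
      by (rule nn_integral_suminf) measurable
    also have "\<dots> = (\<Sum>n. ennreal (\<integral>x. norm (f n x) \<partial>\<mu>))"
      by (intro suminf_cong nn_integral_eq_integral integrable_norm fi) simp
    also have "\<dots> \<noteq> \<infinity>"
      using sumnorm by (simp add: suminf_ennreal2 ennreal_suminf_neq_top)
    finally have "AE x in \<mu>. (\<Sum>n. ennreal (norm (f n x))) \<noteq> \<infinity>"
      by (intro nn_integral_PInf_AE) auto
    then show ?thesis
      by eventually_elim (auto intro: summable_suminf_not_top)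
  qed
  define h where "h x = (\<Sum>n. f n x)" for x
  have hi: "integrable \<mu> h"
    unfolding h_def by (rule integrable_suminf[OF fi AEsum sumnorm])
  have "l b = (\<integral>x. apply_bcontfun b x * h x \<partial>\<mu>)" for b
  proof -
    define g where "g n x = apply_bcontfun b x * f n x" for n x
    have gi: "integrable \<mu> (g n)" for n unfolding g_def by (rule integrable_mult_bcontfun[OF fi])
    have gn: "norm (g n x) \<le> norm b * norm (f n x)" for n x
      by (simp add: g_def norm_mult mult_right_mono norm_bcontfun_le)
    have gAE: "AE x in \<mu>. summable (\<lambda>n. norm (g n x))"
      using AEsum
    proof eventually_elim
      case (elim x)
      show ?case by (rule summable_comparison_test'[OF summable_mult[OF elim, of "norm b"]]) (simp add: gn)
    qed
    have gsum: "summable (\<lambda>n. \<integral>x. norm (g n x) \<partial>\<mu>)"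
    proof (rule summable_comparison_test'[OF summable_mult[OF sumnorm, of "norm b"]])
      fix n
      have "(\<integral>x. norm (g n x) \<partial>\<mu>) \<le> (\<integral>x. norm b * norm (f n x) \<partial>\<mu>)"
        by (intro integral_mono integrable_norm gi gn) (use fi in auto)
      then show "norm (\<integral>x. norm (g n x) \<partial>\<mu>) \<le> norm b * (\<integral>x. norm (f n x) \<partial>\<mu>)" by simp
    qed
    have "(\<lambda>n. \<integral>x. g n x \<partial>\<mu>) sums (\<integral>x. (\<Sum>n. g n x) \<partial>\<mu>)"
      by (rule sums_integral[OF gi gAE gsum])
    also have "(\<integral>x. (\<Sum>n. g n x) \<partial>\<mu>) = (\<integral>x. apply_bcontfun b x * h x \<partial>\<mu>)"
    proof (rule integral_cong_AE)
      show "AE x in \<mu>. (\<Sum>n. g n x) = apply_bcontfun b x * h x"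
        using AEsum
      proof eventually_elim
        case (elim x)
        show ?case unfolding g_def h_def by (rule suminf_mult[OF summable_norm_cancel[OF elim]])
      qed
      show "(\<lambda>x. \<Sum>n. g n x) \<in> borel_measurable \<mu>"
        using integrable_suminf[OF gi gAE gsum] by simp
      show "(\<lambda>x. apply_bcontfun b x * h x) \<in> borel_measurable \<mu>"
        using integrable_mult_bcontfun[OF hi] by simp
    qed
    finally have "(\<lambda>n. \<Sum>i<n. \<integral>x. g i x \<partial>\<mu>) \<longlonglongrightarrow> (\<integral>x. apply_bcontfun b x * h x \<partial>\<mu>)"
      by (simp add: sums_def)
    moreover have "(\<Sum>i<n. \<integral>x. g i x \<partial>\<mu>) = \<omega> (star (e n) * b)" for n
    proof -
      have "(\<integral>x. g i x \<partial>\<mu>) = \<omega> (star (e (Suc i)) * b) - \<omega> (star (e i) * b)" for i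
      proof -
        have "(\<integral>x. g i x \<partial>\<mu>) = \<omega> (star (e (Suc i) - e i) * b)"
          unfolding \<omega>(2) g_def f_def
          by (intro Bochner_Integration.integral_cong refl) (simp add: times_bcontfun.rep_eq mult.commute)
        then show ?thesis by (simp add: star_diff left_diff_distrib state_diff[OF st])
      qed
      then have "(\<Sum>i<n. \<integral>x. g i x \<partial>\<mu>) = \<omega> (star (e n) * b) - \<omega> (star (e 0) * b)"
        using sum_lessThan_telescope[of "\<lambda>i. \<omega> (star (e i) * b)" n] by simp
      then show ?thesis by (simp add: e_def state_zero[OF st])
    qed
    ultimately have "(\<lambda>n. \<omega> (star (e n) * b)) \<longlonglongrightarrow> (\<integral>x. apply_bcontfun b x * h x \<partial>\<mu>)" by simp
    from LIMSEQ_Suc[OF this] have "(\<lambda>n. \<omega> (star (A n) * b)) \<longlonglongrightarrow> (\<integral>x. apply_bcontfun b x * h x \<partial>\<mu>)"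
      by (simp add: e_def)
    then show ?thesis using weak_lim[of b] LIMSEQ_unique by blast
  qed
  with hi show ?thesis using that by blast
qed

end

section \<open>Crossed products by the integers\<close>

lemma bounded_linear_scaleC_homI:
  fixes Q :: "'a::cstar_algebra \<Rightarrow> 'c::cstar_algebra"
  assumes "\<And>x y. Q (x + y) = Q x + Q y" "\<And>c x. Q (c *\<^sub>C x) = c *\<^sub>C Q x" "\<And>x. norm (Q x) \<le> norm x * K"
  shows "bounded_linear Q"
  by (rule bounded_linear_intro[where K = K]) (simp_all add: assms scaleR_scaleC)

lemma bounded_linear_star_hom: "star_hom f \<Longrightarrow> bounded_linear f"
  by (rule bounded_linear_scaleC_homI[where K = 1]) (simp_all add: star_hom_def star_hom_norm_le)

lemma bounded_linear_state: "state_on UNIV \<phi> \<Longrightarrow> bounded_linear \<phi>"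
  using state_norm_le[OF cstar_subalgebra_UNIV]
  by (intro bounded_linear_scaleC_homI[where K = 1]) (simp_all add: state_on_def scaleC_complex_def)

lemma
  assumes "star_hom f"
  shows star_hom_add: "f (x + y) = f x + f y"
    and star_hom_scaleC: "f (c *\<^sub>C x) = c *\<^sub>C f x"
    and star_hom_mult: "f (x * y) = f x * f y"
    and star_hom_star: "f (star x) = star (f x)"
    and star_hom_one: "f 1 = 1"
  using assms by (simp_all add: star_hom_def)

lemma star_hom_zero: "star_hom f \<Longrightarrow> f 0 = 0"
  using star_hom_scaleC[of f 0 0] by simp

lemma star_hom_sum: "star_hom f \<Longrightarrow> f (sum g A) = (\<Sum>i\<in>A. f (g i))"
  by (induction A rule: infinite_finite_induct) (simp_all add: star_hom_zero star_hom_add)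

lemma star_hom_power: "star_hom f \<Longrightarrow> f (x ^ n) = f x ^ n"
  by (induction n) (simp_all add: star_hom_one star_hom_mult)

lemma star_hom_unitary_power: "star_hom f \<Longrightarrow> f (unitary_power v n) = unitary_power (f v) n"
  by (simp add: unitary_power_def star_hom_power star_hom_star)

lemma star_hom_compose: "star_hom f \<Longrightarrow> star_hom g \<Longrightarrow> star_hom (\<lambda>x. f (g x))"
  by (simp add: star_hom_def)

lemma star_automorphism_star_hom: "star_automorphism f \<Longrightarrow> star_hom f"
  by (simp add: star_automorphism_def)

lemma star_automorphism_funpow: "star_automorphism f \<Longrightarrow> star_automorphism (f ^^ n)"
  by (induction n) (auto simp: star_automorphism_def star_hom_def intro: bij_comp)

subsection \<open>Integer powers\<close>

context
  fixes U :: "'b::cstar_algebra"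
  assumes U: "unitary U"
begin

lemma unitary_power_0 [simp]: "unitary_power U 0 = 1"
  by (simp add: unitary_power_def)

lemma unitary_power_1 [simp]: "unitary_power U 1 = U"
  by (simp add: unitary_power_def)

lemma unitary_power_Suc: "unitary_power U (n + 1) = unitary_power U n * U"
proof (cases "0 \<le> n")
  case True
  then have "nat (n + 1) = Suc (nat n)" by simp
  then show ?thesis using True by (simp add: unitary_power_def power_Suc2 del: power_Suc)
next
  case False
  then obtain k where k: "n = - int (Suc k)" by (metis int_cases not_le of_nat_0_le_iff)
  have "star U ^ Suc k * U = star U ^ k * (star U * U)" by (simp only: power_Suc2 mult.assoc)
  then show ?thesis using U by (cases k) (simp_all add: k unitary_power_def unitary_def nat_add_distrib)
qed

lemma unitary_power_pred: "unitary_power U (n - 1) = unitary_power U n * star U"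
  using unitary_power_Suc[of "n - 1"] U by (simp add: mult.assoc unitary_def)

lemma unitary_power_add: "unitary_power U (m + n) = unitary_power U m * unitary_power U n"
proof (induction n rule: int_induct[where k = 0])
  case (step1 i)
  then show ?case using unitary_power_Suc[of "m + i"] by (simp add: unitary_power_Suc mult.assoc add.assoc)
next
  case (step2 i)
  then show ?case using unitary_power_pred[of "m + i"] by (simp add: unitary_power_pred mult.assoc algebra_simps)
qed simp

lemma star_unitary_power: "star (unitary_power U n) = unitary_power U (- n)"
  by (auto simp: unitary_power_def star_power star_star)

lemma unitary_power_inverse:
  "unitary_power U n * unitary_power U (- n) = 1" "unitary_power U (- n) * unitary_power U n = 1"
  using unitary_power_add[of n "- n"] unitary_power_add[of "- n" n] by simp_all

lemma unitary_unitary_power: "unitary (unitary_power U n)"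
  by (simp add: unitary_def star_unitary_power unitary_power_inverse)

lemma unitary_cis: "unitary (cis t *\<^sub>C U)"
  using U by (simp add: unitary_def star_scaleC mult_scaleC_left mult_scaleC_right scaleC_scaleC
      cis_cnj cis_mult)

end

lemma unitary_power_cis:
  "unitary U \<Longrightarrow> unitary_power (cis t *\<^sub>C U) n = cis (t * n) *\<^sub>C unitary_power U n"
proof (induction n rule: int_induct[where k = 0])
  case base
  then show ?case by (simp add: unitary_power_0 unitary_cis)
next
  case (step1 i)
  then show ?case
    by (simp add: unitary_power_Suc unitary_cis mult_scaleC_left mult_scaleC_right scaleC_scaleC
        cis_mult distrib_left add.commute[of t])
next
  case (step2 i)
  then show ?case
    by (simp add: unitary_power_pred unitary_cis mult_scaleC_left mult_scaleC_right scaleC_scaleC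
        star_scaleC cis_cnj cis_mult right_diff_distrib)
qed

context
  fixes \<alpha> :: "'a::cstar_algebra \<Rightarrow> 'a"
  assumes \<alpha>: "star_automorphism \<alpha>"
begin

lemma aut_power_0 [simp]: "aut_power \<alpha> 0 a = a"
  by (simp add: aut_power_def)

lemma automorphism_inv: "\<alpha> (inv \<alpha> a) = a" "inv \<alpha> (\<alpha> a) = a"
  using \<alpha> by (simp_all add: star_automorphism_def bij_def surj_f_inv_f)

lemma aut_power_Suc: "aut_power \<alpha> (n + 1) a = \<alpha> (aut_power \<alpha> n a)"
proof (cases "0 \<le> n")
  case True
  then have "nat (n + 1) = Suc (nat n)" by simp
  then show ?thesis using True by (simp add: aut_power_def)
next
  case False
  then obtain k where k: "n = - int (Suc k)" by (metis int_cases not_le of_nat_0_le_iff)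
  show ?thesis by (cases k) (simp_all add: k aut_power_def automorphism_inv nat_add_distrib)
qed

lemma aut_power_pred: "aut_power \<alpha> (n - 1) a = inv \<alpha> (aut_power \<alpha> n a)"
  using aut_power_Suc[of "n - 1" a] by (simp add: automorphism_inv)

lemma aut_power_add: "aut_power \<alpha> (m + n) a = aut_power \<alpha> m (aut_power \<alpha> n a)"
proof (induction m rule: int_induct[where k = 0])
  case (step1 i)
  then show ?case using aut_power_Suc[of "i + n" a]
    by (simp add: aut_power_Suc add.assoc add.commute[of 1])
next
  case (step2 i)
  then show ?case using aut_power_pred[of "i + n" a]
    by (simp add: aut_power_pred diff_add_eq)
qed simp

lemma aut_power_inverse: "aut_power \<alpha> n (aut_power \<alpha> (- n) a) = a" "aut_power \<alpha> (- n) (aut_power \<alpha> n a) = a"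
  using aut_power_add[of n "- n" a] aut_power_add[of "- n" n a] by simp_all

lemma star_automorphism_aut_power: "star_automorphism (aut_power \<alpha> n)"
  by (simp add: aut_power_def star_automorphism_funpow star_automorphism_inv \<alpha>)

end

subsection \<open>Covariant pairs and finite sums\<close>

definition covariant :: "('a::cstar_algebra \<Rightarrow> 'a) \<Rightarrow> ('a \<Rightarrow> 'b::cstar_algebra) \<Rightarrow> 'b \<Rightarrow> bool" where
  "covariant \<alpha> j U \<longleftrightarrow> star_hom j \<and> unitary U \<and> (\<forall>a. U * j a * star U = j (\<alpha> a))"

text \<open>The integrated form of the pair \<open>(j, U)\<close>, evaluated on formal sums.\<close>

definition psum :: "('a::cstar_algebra \<Rightarrow> 'b::cstar_algebra) \<Rightarrow> 'b \<Rightarrow> (int \<Rightarrow> 'a) \<Rightarrow> 'b" where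
  "psum j U f = (\<Sum>n | f n \<noteq> 0. j (f n) * unitary_power U n)"

definition single :: "int \<Rightarrow> 'a::zero \<Rightarrow> int \<Rightarrow> 'a" where
  "single n a = (\<lambda>m. if m = n then a else 0)"

lemma single_finite_sums: "single n a \<in> finite_sums"
  unfolding finite_sums_def single_def by (auto intro: finite_subset[of _ "{n}"])

lemma finite_sums_add: "f \<in> finite_sums \<Longrightarrow> h \<in> finite_sums \<Longrightarrow> (\<lambda>n. f n + h n :: 'a::cstar_algebra) \<in> finite_sums"
  unfolding finite_sums_def
  by (auto intro: finite_subset[of _ "{n. f n \<noteq> 0} \<union> {n. h n \<noteq> 0}"])

lemma finite_sums_scaleC: "f \<in> finite_sums \<Longrightarrow> (\<lambda>n. c *\<^sub>C f n :: 'a::cstar_algebra) \<in> finite_sums"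
  unfolding finite_sums_def by (auto intro: finite_subset[of _ "{n. f n \<noteq> 0}"])

context
  fixes \<alpha> :: "'a::cstar_algebra \<Rightarrow> 'a" and j :: "'a \<Rightarrow> 'b::cstar_algebra" and U :: 'b
  assumes \<alpha>: "star_automorphism \<alpha>" and cov: "covariant \<alpha> j U"
begin

lemma covariant_hom: "star_hom j" and covariant_unitary: "unitary U"
  using cov by (simp_all add: covariant_def)

lemma covariant_commute: "unitary_power U n * j a = j (aut_power \<alpha> n a) * unitary_power U n"
proof -
  note up = unitary_power_0[OF covariant_unitary] unitary_power_1[OF covariant_unitary]
  have uu: "star U * U = 1" "U * star U = 1" using covariant_unitary by (simp_all add: unitary_def)
  have one: "U * j a = j (\<alpha> a) * U" for a
  proof -
    have "U * j a * (star U * U) = U * j a * star U * U" by (simp only: mult.assoc)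
    also have "\<dots> = j (\<alpha> a) * U" using cov by (simp add: covariant_def)
    finally show ?thesis by (simp add: uu)
  qed
  have neg: "star U * j a = j (inv \<alpha> a) * star U" for a
  proof -
    have "star U * j a = star U * (j (\<alpha> (inv \<alpha> a)) * U) * star U"
      by (simp add: automorphism_inv[OF \<alpha>] mult.assoc uu)
    also have "\<dots> = (star U * U) * j (inv \<alpha> a) * star U" by (simp only: one[symmetric] mult.assoc)
    finally show ?thesis by (simp add: uu)
  qed
  show ?thesis
  proof (induction n arbitrary: a rule: int_induct[where k = 0])
    case base
    then show ?case by (simp add: up aut_power_0[OF \<alpha>])
  next
    case (step1 i)
    have "unitary_power U (i + 1) * j a = unitary_power U i * (U * j a)"
      by (simp only: unitary_power_Suc[OF covariant_unitary] mult.assoc)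
    also have "\<dots> = (unitary_power U i * j (\<alpha> a)) * U" by (simp only: one mult.assoc)
    also have "\<dots> = j (aut_power \<alpha> i (\<alpha> a)) * unitary_power U (i + 1)"
      by (simp only: step1 unitary_power_Suc[OF covariant_unitary] mult.assoc)
    also have "aut_power \<alpha> i (\<alpha> a) = aut_power \<alpha> (i + 1) a"
      using aut_power_Suc[OF \<alpha>, of 0 a] by (simp add: aut_power_add[OF \<alpha>] aut_power_0[OF \<alpha>])
    finally show ?case .
  next
    case (step2 i)
    have "unitary_power U (i - 1) * j a = unitary_power U i * (star U * j a)"
      by (simp only: unitary_power_pred[OF covariant_unitary] mult.assoc)
    also have "\<dots> = (unitary_power U i * j (inv \<alpha> a)) * star U" by (simp only: neg mult.assoc)
    also have "\<dots> = j (aut_power \<alpha> i (inv \<alpha> a)) * unitary_power U (i - 1)"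
      by (simp only: step2 unitary_power_pred[OF covariant_unitary] mult.assoc)
    also have "aut_power \<alpha> i (inv \<alpha> a) = aut_power \<alpha> (i - 1) a"
      using aut_power_pred[OF \<alpha>, of 0 a] aut_power_add[OF \<alpha>, of i "- 1" a]
      by (simp add: aut_power_0[OF \<alpha>])
    finally show ?case .
  qed
qed

lemma monomial_mult:
  "(j a * unitary_power U m) * (j b * unitary_power U n) = j (a * aut_power \<alpha> m b) * unitary_power U (m + n)"
proof -
  have "(j a * unitary_power U m) * (j b * unitary_power U n) =
      j a * (unitary_power U m * j b) * unitary_power U n" by (simp only: mult.assoc)
  then show ?thesis
    by (simp add: covariant_commute star_hom_mult[OF covariant_hom] mult.assoc
        unitary_power_add[OF covariant_unitary])
qed

lemma monomial_star:
  "star (j a * unitary_power U n) = j (aut_power \<alpha> (- n) (star a)) * unitary_power U (- n)"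
  by (simp add: star_mult star_unitary_power[OF covariant_unitary] covariant_commute
      star_hom_star[OF covariant_hom, symmetric])

lemma psum_superset:
  assumes "finite N" "{n. f n \<noteq> 0} \<subseteq> N"
  shows "psum j U f = (\<Sum>n\<in>N. j (f n) * unitary_power U n)"
  unfolding psum_def using assms
  by (intro sum.mono_neutral_left) (auto simp: star_hom_zero[OF covariant_hom])

lemma psum_single: "psum j U (single n a) = j a * unitary_power U n"
  by (subst psum_superset[of "{n}"]) (auto simp: single_def)

lemma psum_add:
  assumes "f \<in> finite_sums" "h \<in> finite_sums"
  shows "psum j U (\<lambda>n. f n + h n) = psum j U f + psum j U h"
proof -
  define N where "N = {n. f n \<noteq> 0} \<union> {n. h n \<noteq> 0}"
  have N: "finite N" "{n. f n \<noteq> 0} \<subseteq> N" "{n. h n \<noteq> 0} \<subseteq> N" "{n. f n + h n \<noteq> 0} \<subseteq> N"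
    using assms by (auto simp: N_def finite_sums_def)
  show ?thesis
    by (simp add: psum_superset[OF N(1,2)] psum_superset[OF N(1,3)] psum_superset[OF N(1,4)]
        star_hom_add[OF covariant_hom] distrib_right sum.distrib)
qed

lemma psum_scaleC:
  assumes "f \<in> finite_sums"
  shows "psum j U (\<lambda>n. c *\<^sub>C f n) = c *\<^sub>C psum j U f"
proof -
  define N where "N = {n. f n \<noteq> 0}"
  have N: "finite N" "{n. f n \<noteq> 0} \<subseteq> N" "{n. c *\<^sub>C f n \<noteq> 0} \<subseteq> N"
    using assms by (auto simp: N_def finite_sums_def)
  show ?thesis
    by (simp add: psum_superset[OF N(1,2)] psum_superset[OF N(1,3)]
        star_hom_scaleC[OF covariant_hom] mult_scaleC_left scaleC.scale_sum_right)
qed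

lemma psum_twisted_mult:
  assumes f: "f \<in> finite_sums" and h: "h \<in> finite_sums"
  shows "psum j U (twisted_mult \<alpha> f h) = psum j U f * psum j U h"
proof -
  have a0: "aut_power \<alpha> k 0 = 0" for k
    by (rule star_hom_zero) (simp add: star_automorphism_star_hom star_automorphism_aut_power[OF \<alpha>])
  define F where "F = {n. f n \<noteq> 0}"
  define H where "H = {n. h n \<noteq> 0}"
  have fin: "finite F" "finite H" using f h by (simp_all add: F_def H_def finite_sums_def)
  \<comment> \<open>The sumset of the supports. It may exceed the support of the product, where
    coefficients can cancel, but it permits the reindexing \<open>n = k + l\<close>.\<close>
  define N where "N = (\<lambda>(k, l). k + l) ` (F \<times> H)"
  have N: "finite N" using fin by (simp add: N_def)
  have sub: "{n. twisted_mult \<alpha> f h n \<noteq> 0} \<subseteq> N"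
  proof
    fix n assume "n \<in> {n. twisted_mult \<alpha> f h n \<noteq> 0}"
    then obtain k where "k \<in> F" "f k * aut_power \<alpha> k (h (n - k)) \<noteq> 0"
      unfolding twisted_mult_def F_def by (auto elim: sum.not_neutral_contains_not_neutral)
    then have "n - k \<in> H" by (auto simp: H_def a0)
    then show "n \<in> N" using \<open>k \<in> F\<close> unfolding N_def by (intro image_eqI[of _ _ "(k, n - k)"]) auto
  qed
  have inner: "(\<Sum>n\<in>N. j (f k * aut_power \<alpha> k (h (n - k))) * unitary_power U n) =
      (\<Sum>l\<in>H. (j (f k) * unitary_power U k) * (j (h l) * unitary_power U l))" if k: "k \<in> F" for k
  proof -
    have "(\<Sum>n\<in>N. j (f k * aut_power \<alpha> k (h (n - k))) * unitary_power U n) =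
        (\<Sum>n\<in>(\<lambda>l. k + l) ` H. j (f k * aut_power \<alpha> k (h (n - k))) * unitary_power U n)"
    proof (rule sum.mono_neutral_right[OF N])
      show "(\<lambda>l. k + l) ` H \<subseteq> N" using k by (auto simp: N_def)
      show "\<forall>n\<in>N - (\<lambda>l. k + l) ` H. j (f k * aut_power \<alpha> k (h (n - k))) * unitary_power U n = 0"
      proof
        fix n assume "n \<in> N - (\<lambda>l. k + l) ` H"
        then have "n \<notin> (\<lambda>l. k + l) ` H" by simp
        then have "n - k \<notin> H" by (metis add_diff_cancel_left' diff_add_cancel add.commute image_eqI)
        then show "j (f k * aut_power \<alpha> k (h (n - k))) * unitary_power U n = 0"
          by (simp add: H_def a0 star_hom_zero[OF covariant_hom])
      qed
    qed
    also have "\<dots> = (\<Sum>l\<in>H. j (f k * aut_power \<alpha> k (h l)) * unitary_power U (k + l))"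
      by (subst sum.reindex) (auto simp: inj_on_def)
    finally show ?thesis by (simp add: monomial_mult)
  qed
  have "psum j U (twisted_mult \<alpha> f h) =
      (\<Sum>n\<in>N. \<Sum>k\<in>F. j (f k * aut_power \<alpha> k (h (n - k))) * unitary_power U n)"
    unfolding psum_superset[OF N sub] twisted_mult_def F_def[symmetric] star_hom_sum[OF covariant_hom]
      sum_distrib_right ..
  also have "\<dots> = (\<Sum>k\<in>F. \<Sum>l\<in>H. (j (f k) * unitary_power U k) * (j (h l) * unitary_power U l))"
    by (subst sum.swap) (intro sum.cong refl inner)
  also have "\<dots> = psum j U f * psum j U h"
    unfolding psum_def F_def[symmetric] H_def[symmetric] by (simp only: sum_product)
  finally show ?thesis .
qed

lemma psum_twisted_star:
  assumes f: "f \<in> finite_sums"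
  shows "psum j U (twisted_star \<alpha> f) = star (psum j U f)"
proof -
  have a0: "aut_power \<alpha> k 0 = 0" for k
    by (rule star_hom_zero) (simp add: star_automorphism_star_hom star_automorphism_aut_power[OF \<alpha>])
  define F where "F = {n. f n \<noteq> 0}"
  have fin: "finite (uminus ` F)" using f by (simp add: F_def finite_sums_def)
  have sub: "{n. twisted_star \<alpha> f n \<noteq> 0} \<subseteq> uminus ` F"
  proof
    fix n assume "n \<in> {n. twisted_star \<alpha> f n \<noteq> 0}"
    then have "- n \<in> F" by (auto simp: twisted_star_def F_def a0)
    then show "n \<in> uminus ` F" by force
  qed
  have "psum j U (twisted_star \<alpha> f) = (\<Sum>n\<in>F. star (j (f n) * unitary_power U n))"
    unfolding psum_superset[OF fin sub]
    by (subst sum.reindex) (auto simp: inj_on_def twisted_star_def monomial_star)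
  then show ?thesis unfolding psum_def F_def[symmetric] star_sum .
qed

lemma finite_sums_twisted_star: "f \<in> finite_sums \<Longrightarrow> twisted_star \<alpha> f \<in> finite_sums"
proof -
  assume f: "f \<in> finite_sums"
  have "{n. twisted_star \<alpha> f n \<noteq> 0} \<subseteq> uminus ` {n. f n \<noteq> 0}"
  proof
    fix n assume "n \<in> {n. twisted_star \<alpha> f n \<noteq> 0}"
    moreover have "aut_power \<alpha> n 0 = 0"
      by (rule star_hom_zero) (simp add: star_automorphism_star_hom star_automorphism_aut_power[OF \<alpha>])
    ultimately have "f (- n) \<noteq> 0" by (auto simp: twisted_star_def)
    then show "n \<in> uminus ` {n. f n \<noteq> 0}" by force
  qed
  then show ?thesis using f finite_subset by (auto simp: finite_sums_def)
qed

text \<open>Through this seminorm the maximality clause in \<open>crossed_product\<close> applies to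
  a covariant pair in a C*-algebra of any type.\<close>

lemma cstar_seminorm_psum: "cstar_seminorm \<alpha> (\<lambda>f. norm (psum j U f))"
  unfolding cstar_seminorm_def
  by (intro conjI allI ballI) (simp_all add: psum_add psum_scaleC psum_twisted_mult psum_twisted_star finite_sums_twisted_star
      norm_triangle_ineq norm_scaleC norm_mult_ineq cstar_identity)

end

text \<open>The set where two *-homomorphisms agree is closed, since both are contractive, and it is
  a C*-subalgebra.\<close>

lemma star_hom_eqI:
  fixes f g :: "'b::cstar_algebra \<Rightarrow> 'c::cstar_algebra"
  assumes gen: "cstar_generated S = UNIV" and f: "star_hom f" and g: "star_hom g"
    and eq: "\<And>x. x \<in> S \<Longrightarrow> f x = g x"
  shows "f = g"
proof -
  have "cstar_subalgebra {x. f x = g x}"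
    unfolding cstar_subalgebra_def
  proof (intro conjI)
    show "closed {x. f x = g x}"
      by (rule closed_Collect_eq) (simp_all add: linear_continuous_on bounded_linear_star_hom f g)
  qed (use f g in \<open>auto simp: star_hom_def\<close>)
  then have "cstar_generated S \<subseteq> {x. f x = g x}" using eq unfolding cstar_generated_def by blast
  then show ?thesis using gen by auto
qed

text \<open>Discrete orthogonality of characters. The bound on \<open>n\<close> excludes the nonzero
  multiples of \<open>N\<close>, at which the sum would be \<open>N\<close> again.\<close>

lemma sum_roots_of_unity:
  fixes n :: int and N :: nat
  assumes N: "N > 0" and n: "\<bar>n\<bar> < int N"
  shows "(\<Sum>k<N. cis (2 * pi * real k / real N * of_int n)) = (if n = 0 then of_nat N else 0)"
proof (cases "n = 0")
  case False
  define z where "z = cis (2 * pi * of_int n / real N)"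
  have pw: "z ^ k = cis (2 * pi * real k / real N * of_int n)" for k
    by (simp only: z_def Complex.DeMoivre) (simp add: mult_ac)
  have "z ^ N = 1"
    using N cis_multiple_2pi[of "real_of_int n"] by (simp add: pw)
  moreover have "z \<noteq> 1"
  proof
    assume "z = 1"
    then have "cos (2 * pi * of_int n / real N) = 1" by (simp add: z_def complex_eq_iff)
    then obtain m :: int where "2 * pi * of_int n / real N = of_int m * 2 * pi"
      by (auto simp: cos_one_2pi_int)
    then have "real_of_int n = of_int m * real N" using N by (simp add: field_simps)
    then have e: "n = m * int N" by (metis of_int_eq_iff of_int_mult of_int_of_nat_eq)
    then have "\<bar>m\<bar> * int N < 1 * int N" using n by (simp add: abs_mult)
    then have "\<bar>m\<bar> < 1" by (rule mult_right_less_imp_less) simp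
    then have "m = 0" by simp
    then show False using e False by simp
  qed
  ultimately show ?thesis using False geometric_sum[of z N] by (simp add: pw)
qed simp

section \<open>Crossed products of C(X): density, universal property and Fourier
  coefficients\<close>

locale crossed_product_CX =
  fixes \<alpha> :: "('x::metric_space \<Rightarrow>\<^sub>C complex) \<Rightarrow> ('x \<Rightarrow>\<^sub>C complex)"
    and \<iota> :: "('x \<Rightarrow>\<^sub>C complex) \<Rightarrow> 'b::cstar_algebra" and V :: 'b
  assumes compact_X: "compact (UNIV :: 'x set)"
    and \<alpha>: "star_automorphism \<alpha>"
    and crossed: "crossed_product \<alpha> \<iota> V"
begin

lemma \<iota>_hom: "star_hom \<iota>" and V_unitary: "unitary V" and inj_\<iota>: "inj \<iota>"
  and covariant_\<iota>_V: "covariant \<alpha> \<iota> V"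
  and generated: "cstar_generated (insert V (range \<iota>)) = UNIV"
  using crossed by (simp_all add: crossed_product_def covariant_def)

lemmas \<iota>_simps = star_hom_add[OF \<iota>_hom] star_hom_scaleC[OF \<iota>_hom] star_hom_mult[OF \<iota>_hom]
  star_hom_star[OF \<iota>_hom] star_hom_one[OF \<iota>_hom] star_hom_zero[OF \<iota>_hom]

lemma norm_\<iota>: "norm (\<iota> a) = norm a"
  by (rule inj_star_hom_isometric[OF compact_X \<iota>_hom inj_\<iota>])

lemma universal:
  fixes j :: "('x \<Rightarrow>\<^sub>C complex) \<Rightarrow> 'c::cstar_algebra"
  shows "covariant \<alpha> j U \<Longrightarrow> f \<in> finite_sums \<Longrightarrow> norm (psum j U f) \<le> norm (psum \<iota> V f)"
  using crossed cstar_seminorm_psum[OF \<alpha>] unfolding crossed_product_def psum_def[of \<iota> V] by blast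

definition vmono :: "('x \<Rightarrow>\<^sub>C complex) \<Rightarrow> int \<Rightarrow> 'b" where
  "vmono a n = \<iota> a * unitary_power V n"

lemma vmono_mult: "vmono a m * vmono b n = vmono (a * aut_power \<alpha> m b) (m + n)"
  unfolding vmono_def by (rule monomial_mult[OF \<alpha> covariant_\<iota>_V])

lemma vmono_star: "star (vmono a n) = vmono (aut_power \<alpha> (- n) (star a)) (- n)"
  unfolding vmono_def by (rule monomial_star[OF \<alpha> covariant_\<iota>_V])

lemma psum_vmono: "psum \<iota> V (single n a) = vmono a n"
  unfolding vmono_def by (rule psum_single[OF \<alpha> covariant_\<iota>_V])

lemma \<iota>_eq_vmono: "\<iota> a = vmono a 0" and V_eq_vmono: "V = vmono 1 1" and one_eq_vmono: "1 = vmono 1 0"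
  and power_eq_vmono: "unitary_power V n = vmono 1 n"
  by (simp_all add: vmono_def \<iota>_simps unitary_power_0[OF V_unitary] unitary_power_1[OF V_unitary])

lemma vmono_zero: "vmono 0 n = 0"
  by (simp add: vmono_def \<iota>_simps)

lemma vmono_scaleC: "vmono (c *\<^sub>C a) n = c *\<^sub>C vmono a n"
  by (simp add: vmono_def \<iota>_simps mult_scaleC_left)

lemma psum_eq_sum_vmono: "psum \<iota> V f = (\<Sum>n | f n \<noteq> 0. vmono (f n) n)"
  by (simp add: psum_def vmono_def)

text \<open>The finite sums form a *-algebra, so their closure is a C*-subalgebra; it contains the
  generators.\<close>

lemma dense_finite_sums: "closure (psum \<iota> V ` finite_sums) = UNIV"
proof -
  note P = \<alpha> covariant_\<iota>_V
  let ?S = "psum \<iota> V ` finite_sums"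
  have add: "x + y \<in> ?S" if xy: "x \<in> ?S" "y \<in> ?S" for x y
  proof -
    obtain f h where "f \<in> finite_sums" "x = psum \<iota> V f" "h \<in> finite_sums" "y = psum \<iota> V h"
      using xy by blast
    then show ?thesis
      using psum_add[OF P] finite_sums_add by (intro image_eqI[of _ _ "\<lambda>n. f n + h n"]) auto
  qed
  have scale: "c *\<^sub>C x \<in> ?S" if x: "x \<in> ?S" for x c
  proof -
    obtain f where "f \<in> finite_sums" "x = psum \<iota> V f" using x by blast
    then show ?thesis
      using psum_scaleC[OF P] finite_sums_scaleC by (intro image_eqI[of _ _ "\<lambda>n. c *\<^sub>C f n"]) auto
  qed
  have star: "star x \<in> ?S" if x: "x \<in> ?S" for x
  proof -
    obtain f where "f \<in> finite_sums" "x = psum \<iota> V f" using x by blast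
    then show ?thesis
      using psum_twisted_star[OF P] finite_sums_twisted_star[OF P]
      by (intro image_eqI[of _ _ "twisted_star \<alpha> f"]) auto
  qed
  have m: "vmono a n \<in> ?S" for a n
    using psum_vmono single_finite_sums by (metis image_eqI)
  have sum: "sum g A \<in> ?S" if "\<And>i. i \<in> A \<Longrightarrow> g i \<in> ?S" for g and A :: "'i set"
    using that m[of 0 0]
    by (induction A rule: infinite_finite_induct) (auto simp: vmono_zero intro: add)
  have mult: "x * y \<in> ?S" if xy: "x \<in> ?S" "y \<in> ?S" for x y
  proof -
    obtain f h where "x = psum \<iota> V f" "y = psum \<iota> V h" using xy by blast
    then have "x * y = (\<Sum>k | f k \<noteq> 0. \<Sum>l | h l \<noteq> 0. vmono (f k * aut_power \<alpha> k (h l)) (k + l))"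
      by (simp add: psum_eq_sum_vmono sum_product vmono_mult)
    also have "\<dots> \<in> ?S" by (intro sum m)
    finally show ?thesis .
  qed
  have "cstar_subalgebra (closure ?S)"
    unfolding cstar_subalgebra_def
  proof (intro conjI ballI allI)
    show "1 \<in> closure ?S" unfolding one_eq_vmono by (rule subsetD[OF closure_subset m])
    fix x y assume "x \<in> closure ?S" "y \<in> closure ?S"
    then obtain s t where st: "\<forall>k. s k \<in> ?S" "s \<longlonglongrightarrow> x" "\<forall>k. t k \<in> ?S" "t \<longlonglongrightarrow> y"
      unfolding closure_sequential by metis
    show "x + y \<in> closure ?S"
      unfolding closure_sequential using st add tendsto_add[OF st(2,4)]
      by (intro exI[of _ "\<lambda>k. s k + t k"]) simp
    show "x * y \<in> closure ?S"
      unfolding closure_sequential using st mult tendsto_mult[OF st(2,4)]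
      by (intro exI[of _ "\<lambda>k. s k * t k"]) simp
  next
    fix x c assume "x \<in> closure ?S"
    then obtain s where st: "\<forall>k. s k \<in> ?S" "s \<longlonglongrightarrow> x" unfolding closure_sequential by metis
    show "c *\<^sub>C x \<in> closure ?S"
      unfolding closure_sequential using st scale bounded_linear.tendsto[OF bounded_linear_scaleC st(2)]
      by (intro exI[of _ "\<lambda>k. c *\<^sub>C s k"]) simp
  next
    fix x assume "x \<in> closure ?S"
    then obtain s where st: "\<forall>k. s k \<in> ?S" "s \<longlonglongrightarrow> x" unfolding closure_sequential by metis
    show "star x \<in> closure ?S"
      unfolding closure_sequential using st star bounded_linear.tendsto[OF bounded_linear_star st(2)]
      by (intro exI[of _ "\<lambda>k. star (s k)"]) simp
  qed simp
  moreover have "insert V (range \<iota>) \<subseteq> closure ?S"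
  proof -
    have "V \<in> closure ?S" by (subst V_eq_vmono) (rule subsetD[OF closure_subset m])
    moreover have "\<iota> a \<in> closure ?S" for a
      by (subst \<iota>_eq_vmono) (rule subsetD[OF closure_subset m])
    ultimately show ?thesis by blast
  qed
  ultimately have "cstar_generated (insert V (range \<iota>)) \<subseteq> closure ?S"
    unfolding cstar_generated_def by blast
  then show ?thesis using generated by auto
qed

lemma approx_finite_sums: obtains f where "\<And>k::nat. f k \<in> finite_sums" "(\<lambda>k. psum \<iota> V (f k)) \<longlonglongrightarrow> x"
proof -
  have "x \<in> closure (psum \<iota> V ` finite_sums)" using dense_finite_sums by simp
  then obtain s where s: "\<forall>k. s k \<in> psum \<iota> V ` finite_sums" "s \<longlonglongrightarrow> x"
    unfolding closure_sequential by blast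
  then have "\<forall>k. \<exists>f. f \<in> finite_sums \<and> s k = psum \<iota> V f" by blast
  then obtain f where "\<forall>k. f k \<in> finite_sums \<and> s k = psum \<iota> V (f k)" by metis
  then show ?thesis using that[of f] s(2) by presburger
qed

text \<open>A finite sum is a sum of monomials whose coefficients absorb all scalars, so additivity
  and closedness reach every element.\<close>

lemma crossed_product_induct [case_names closed add vmono]:
  assumes closed: "closed {x. P x}" and add: "\<And>x y. P x \<Longrightarrow> P y \<Longrightarrow> P (x + y)"
    and vmono: "\<And>a n. P (vmono a n)"
  shows "P x"
proof -
  have "P (psum \<iota> V f)" for f
  proof -
    have "P (sum g A)" if "\<And>i. i \<in> A \<Longrightarrow> P (g i)" for g and A :: "int set"
      using that vmono[of 0 0]
      by (induction A rule: infinite_finite_induct) (simp_all add: vmono_zero add)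
    then show ?thesis unfolding psum_eq_sum_vmono by (simp add: vmono)
  qed
  then have "closure (psum \<iota> V ` finite_sums) \<subseteq> {x. P x}"
    by (intro closure_minimal closed) auto
  then show ?thesis using dense_finite_sums by auto
qed

lemma bounded_linear_eqI:
  assumes "bounded_linear S" "bounded_linear T" "\<And>a n. S (vmono a n) = T (vmono a n)"
  shows "S x = (T x :: 'c::real_normed_vector)"
proof (induction x rule: crossed_product_induct)
  case closed
  then show ?case by (rule closed_Collect_eq) (simp_all add: linear_continuous_on assms)
next
  case (add x y)
  then show ?case
    by (simp add: linear_add[OF bounded_linear.linear[OF assms(1)]]
        linear_add[OF bounded_linear.linear[OF assms(2)]])
qed (rule assms(3))

text \<open>The source of all maps out of the crossed product. The bound also makes \<open>q\<close>
  depend only on the element that a formal sum represents, not on the sum.\<close>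

lemma extend_from_finite_sums:
  fixes q :: "(int \<Rightarrow> 'x \<Rightarrow>\<^sub>C complex) \<Rightarrow> 'c::cstar_algebra"
  assumes add: "\<And>f h. f \<in> finite_sums \<Longrightarrow> h \<in> finite_sums \<Longrightarrow> q (\<lambda>n. f n + h n) = q f + q h"
    and scale: "\<And>c f. f \<in> finite_sums \<Longrightarrow> q (\<lambda>n. c *\<^sub>C f n) = c *\<^sub>C q f"
    and bound: "\<And>f. f \<in> finite_sums \<Longrightarrow> norm (q f) \<le> norm (psum \<iota> V f)"
  shows "\<exists>Q. (\<forall>x y. Q (x + y) = Q x + Q y) \<and> (\<forall>c x. Q (c *\<^sub>C x) = c *\<^sub>C Q x) \<and>
     (\<forall>x. norm (Q x) \<le> norm x) \<and> (\<forall>f\<in>finite_sums. Q (psum \<iota> V f) = q f)"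
proof -
  note P = \<alpha> covariant_\<iota>_V
  have diff: "norm (q f - q h) \<le> norm (psum \<iota> V f - psum \<iota> V h)"
    if fh: "f \<in> finite_sums" "h \<in> finite_sums" for f h
  proof -
    have h': "(\<lambda>n. (- 1) *\<^sub>C h n) \<in> finite_sums" by (rule finite_sums_scaleC[OF fh(2)])
    have "q f - q h = q (\<lambda>n. f n + (- 1) *\<^sub>C h n)"
      unfolding add[OF fh(1) h'] scale[OF fh(2)] by (simp add: scaleC.scale_minus_left)
    also have "norm \<dots> \<le> norm (psum \<iota> V (\<lambda>n. f n + (- 1) *\<^sub>C h n))"
      by (rule bound[OF finite_sums_add[OF fh(1) h']])
    also have "psum \<iota> V (\<lambda>n. f n + (- 1) *\<^sub>C h n) = psum \<iota> V f - psum \<iota> V h"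
      unfolding psum_add[OF P fh(1) h'] psum_scaleC[OF P fh(2)] by (simp add: scaleC.scale_minus_left)
    finally show ?thesis .
  qed
  have "\<forall>x. \<exists>f. (\<forall>k::nat. f k \<in> finite_sums) \<and> (\<lambda>k. psum \<iota> V (f k)) \<longlonglongrightarrow> x"
    using approx_finite_sums by metis
  then obtain F where F: "\<And>x k. F x (k::nat) \<in> finite_sums" "\<And>x. (\<lambda>k. psum \<iota> V (F x k)) \<longlonglongrightarrow> x"
    by metis
  define Q where "Q x = lim (\<lambda>k. q (F x k))" for x
  have conv: "(\<lambda>k. q (F x k)) \<longlonglongrightarrow> Q x" for x
  proof -
    have "Cauchy (\<lambda>k. q (F x k))"
    proof (rule metric_CauchyI)
      fix e :: real assume "e > 0"
      then obtain M where "\<forall>m\<ge>M. \<forall>n\<ge>M. dist (psum \<iota> V (F x m)) (psum \<iota> V (F x n)) < e"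
        using metric_CauchyD[OF LIMSEQ_imp_Cauchy[OF F(2)[of x]]] by blast
      then show "\<exists>M. \<forall>m\<ge>M. \<forall>n\<ge>M. dist (q (F x m)) (q (F x n)) < e"
        using diff[OF F(1) F(1)] unfolding dist_norm by (meson le_less_trans)
    qed
    then show ?thesis unfolding Q_def by (simp add: Cauchy_convergent_iff convergent_LIMSEQ_iff)
  qed
  \<comment> \<open>\<open>Q\<close> uses one chosen approximating sequence per element. Every other
    sequence gives the same limit, which is what linearity requires: the choice for
    \<open>x + y\<close> is unrelated to those for \<open>x\<close> and \<open>y\<close>.\<close>
  have key: "(\<lambda>k. q (g k)) \<longlonglongrightarrow> Q x"
    if g: "\<And>k::nat. g k \<in> finite_sums" "(\<lambda>k. psum \<iota> V (g k)) \<longlonglongrightarrow> x" for g x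
  proof -
    have "(\<lambda>k. norm (psum \<iota> V (g k) - psum \<iota> V (F x k))) \<longlonglongrightarrow> 0"
      using tendsto_norm[OF tendsto_diff[OF g(2) F(2)[of x]]] by simp
    then have "(\<lambda>k. q (g k) - q (F x k)) \<longlonglongrightarrow> 0"
      by (rule Lim_null_comparison[rotated]) (simp add: diff g(1) F(1))
    from tendsto_add[OF this conv[of x]] show ?thesis by simp
  qed
  show ?thesis
  proof (intro exI[of _ Q] conjI allI ballI)
    fix x y
    have "(\<lambda>k. psum \<iota> V (\<lambda>n. F x k n + F y k n)) \<longlonglongrightarrow> x + y"
      unfolding psum_add[OF P F(1) F(1)] by (intro tendsto_add F)
    from key[OF finite_sums_add[OF F(1) F(1)] this]
    have "(\<lambda>k. q (F x k) + q (F y k)) \<longlonglongrightarrow> Q (x + y)" by (simp add: add[OF F(1) F(1)])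
    then show "Q (x + y) = Q x + Q y" using tendsto_add[OF conv conv] LIMSEQ_unique by blast
  next
    fix c x
    have "(\<lambda>k. psum \<iota> V (\<lambda>n. c *\<^sub>C F x k n)) \<longlonglongrightarrow> c *\<^sub>C x"
      unfolding psum_scaleC[OF P F(1)] by (intro bounded_linear.tendsto[OF bounded_linear_scaleC] F)
    from key[OF finite_sums_scaleC[OF F(1)] this]
    have "(\<lambda>k. c *\<^sub>C q (F x k)) \<longlonglongrightarrow> Q (c *\<^sub>C x)" by (simp add: scale[OF F(1)])
    then show "Q (c *\<^sub>C x) = c *\<^sub>C Q x"
      using bounded_linear.tendsto[OF bounded_linear_scaleC conv] LIMSEQ_unique by blast
  next
    fix x show "norm (Q x) \<le> norm x"
      by (rule LIMSEQ_le[OF tendsto_norm[OF conv] tendsto_norm[OF F(2)]]) (use bound F(1) in auto)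
  next
    fix f :: "int \<Rightarrow> 'x \<Rightarrow>\<^sub>C complex" assume f: "f \<in> finite_sums"
    have "(\<lambda>k::nat. q f) \<longlonglongrightarrow> Q (psum \<iota> V f)" by (rule key) (use f in auto)
    then show "Q (psum \<iota> V f) = q f" using LIMSEQ_unique tendsto_const by blast
  qed
qed

text \<open>The usual universal property, for an arbitrary target type, recovered from the
  domination of seminorms.\<close>

lemma covariant_extends:
  fixes j :: "('x \<Rightarrow>\<^sub>C complex) \<Rightarrow> 'c::cstar_algebra"
  assumes cov: "covariant \<alpha> j U"
  obtains \<rho> where "star_hom \<rho>" "\<And>a. \<rho> (\<iota> a) = j a" "\<rho> V = U"
proof -
  note C = \<alpha> cov
  note jh = covariant_hom[OF C]
  have "\<exists>Q. (\<forall>x y. Q (x + y) = Q x + Q y) \<and> (\<forall>c x. Q (c *\<^sub>C x) = c *\<^sub>C Q x) \<and>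
     (\<forall>x. norm (Q x) \<le> norm x) \<and> (\<forall>f\<in>finite_sums. Q (psum \<iota> V f) = psum j U f)"
    by (rule extend_from_finite_sums)
      (simp_all add: psum_add[OF C] psum_scaleC[OF C] universal[OF cov])
  then obtain \<rho> where add: "\<And>x y. \<rho> (x + y) = \<rho> x + \<rho> y" and scale: "\<And>c x. \<rho> (c *\<^sub>C x) = c *\<^sub>C \<rho> x"
    and bound: "\<And>x. norm (\<rho> x) \<le> norm x"
    and \<rho>: "\<And>f. f \<in> finite_sums \<Longrightarrow> \<rho> (psum \<iota> V f) = psum j U f"
    by metis
  have bl: "bounded_linear \<rho>"
    by (rule bounded_linear_scaleC_homI[where K = 1]) (simp_all add: add scale bound)
  have cont: "continuous_on UNIV (\<lambda>x. \<rho> (x * z))" "continuous_on UNIV (\<lambda>x. \<rho> (z * x))"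
    "continuous_on UNIV (\<lambda>x. \<rho> x * z')" "continuous_on UNIV (\<lambda>x. z' * \<rho> x)"
    "continuous_on UNIV (\<lambda>x. \<rho> (star x))" "continuous_on UNIV (\<lambda>x. star (\<rho> x))" for z z'
    by (intro linear_continuous_on bounded_linear_compose[OF bl] bounded_linear_mult_left
        bounded_linear_mult_right bounded_linear_star
        bounded_linear_compose[OF bounded_linear_mult_left bl]
        bounded_linear_compose[OF bounded_linear_mult_right bl]
        bounded_linear_compose[OF bounded_linear_star bl])+
  have \<rho>m: "\<rho> (vmono a n) = j a * unitary_power U n" for a n
    using \<rho>[OF single_finite_sums, of n a] by (simp add: psum_vmono psum_single[OF C])
  \<comment> \<open>Multiplicativity passes from monomials to the closure in one factor at a
    time.\<close>
  have m1: "\<rho> (x * vmono b n) = \<rho> x * \<rho> (vmono b n)" for x b n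
  proof (induction x rule: crossed_product_induct)
    case closed
    show ?case by (rule closed_Collect_eq[OF cont(1) cont(3)])
  qed (simp_all add: distrib_right add vmono_mult \<rho>m monomial_mult[OF C])
  have mult: "\<rho> (x * y) = \<rho> x * \<rho> y" for x y
  proof (induction y rule: crossed_product_induct)
    case closed
    show ?case by (rule closed_Collect_eq[OF cont(2) cont(4)])
  qed (simp_all add: distrib_left add m1)
  have star: "\<rho> (star x) = star (\<rho> x)" for x
  proof (induction x rule: crossed_product_induct)
    case closed
    show ?case by (rule closed_Collect_eq[OF cont(5) cont(6)])
  qed (simp_all add: add star_add vmono_star \<rho>m monomial_star[OF C])
  have i: "\<rho> (\<iota> a) = j a" for a
    by (simp add: \<iota>_eq_vmono \<rho>m unitary_power_0[OF covariant_unitary[OF C]])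
  have "\<rho> 1 = 1"
    using \<rho>m[of 1 0] by (simp add: one_eq_vmono[symmetric] star_hom_one[OF jh]
        unitary_power_0[OF covariant_unitary[OF C]])
  then have "star_hom \<rho>" by (simp add: star_hom_def add scale mult star)
  moreover have "\<rho> V = U"
    by (subst V_eq_vmono, subst \<rho>m) (simp add: star_hom_one[OF jh] unitary_power_1[OF covariant_unitary[OF C]])
  ultimately show ?thesis using that i by blast
qed

lemma star_hom_vmono: "star_hom \<rho> \<Longrightarrow> \<rho> (vmono a n) = \<rho> (\<iota> a) * unitary_power (\<rho> V) n"
  by (simp add: vmono_def star_hom_mult star_hom_unitary_power)

text \<open>The pair behind the dual action of the circle. Universality for it says that rotating
  the \<open>n\<close>-th coefficient by \<open>cis (t * n)\<close> does not increase the
  norm.\<close>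

lemma covariant_dual: "covariant \<alpha> \<iota> (cis t *\<^sub>C V)"
  using covariant_\<iota>_V unfolding covariant_def
  by (simp add: unitary_cis star_scaleC mult_scaleC_left mult_scaleC_right scaleC_scaleC cis_cnj cis_mult)

lemma psum_dual: "psum \<iota> (cis t *\<^sub>C V) f = (\<Sum>n | f n \<noteq> 0. cis (t * n) *\<^sub>C vmono (f n) n)"
  by (simp add: psum_def vmono_def unitary_power_cis[OF V_unitary] mult_scaleC_right)

lemma norm_psum_dual_le: "f \<in> finite_sums \<Longrightarrow>
    norm (\<Sum>n | f n \<noteq> 0. cis (t * n) *\<^sub>C vmono (f n) n) \<le> norm (psum \<iota> V f)"
  unfolding psum_dual[symmetric] by (rule universal[OF covariant_dual])

text \<open>\<open>f 0\<close> is the average of the images of the sum under the dual action \<open>V \<mapsto> e\<^sup>i\<^sup>t V\<close>, taken over the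
  \<open>N\<close>-th roots of unity for large \<open>N\<close>.\<close>

lemma norm_zero_coefficient_le:
  assumes f: "f \<in> finite_sums"
  shows "norm (f 0) \<le> norm (psum \<iota> V f)"
proof -
  define F where "F = {n. f n \<noteq> 0}"
  have F: "finite F" using f by (simp add: F_def finite_sums_def)
  obtain N :: nat where N: "N > 0" "\<And>n. n \<in> F \<Longrightarrow> \<bar>n\<bar> < int N"
  proof -
    have "\<bar>n\<bar> < int (Suc (nat (\<Sum>n\<in>F. \<bar>n\<bar>)))" if "n \<in> F" for n
      using member_le_sum[OF that, of abs] F by simp
    then show ?thesis using that by blast
  qed
  define t where "t k = 2 * pi * real k / real N" for k
  have "(\<Sum>k<N. \<Sum>n\<in>F. cis (t k * n) *\<^sub>C vmono (f n) n) =
      (\<Sum>n\<in>F. (\<Sum>k<N. cis (t k * n)) *\<^sub>C vmono (f n) n)"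
    by (subst sum.swap) (simp add: scaleC.scale_sum_left)
  also have "\<dots> = (\<Sum>n\<in>F. if n = 0 then of_nat N *\<^sub>C vmono (f n) n else 0)"
    unfolding t_def using sum_roots_of_unity[OF N] by (intro sum.cong refl) simp
  also have "\<dots> = of_nat N *\<^sub>C vmono (f 0) 0"
    using F by (auto simp: F_def vmono_zero)
  finally have "real N * norm (f 0) = norm (\<Sum>k<N. \<Sum>n\<in>F. cis (t k * n) *\<^sub>C vmono (f n) n)"
    by (simp add: norm_scaleC \<iota>_eq_vmono[symmetric] norm_\<iota>)
  also have "\<dots> \<le> (\<Sum>k<N. norm (psum \<iota> V f))"
    unfolding F_def by (intro sum_norm_le norm_psum_dual_le f)
  finally show ?thesis using N(1) by simp
qed

text \<open>The canonical conditional expectation onto C(X). The extension result gives existence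
  only, hence the choice operator; density makes the map unique.\<close>

definition coeff0 :: "'b \<Rightarrow> ('x \<Rightarrow>\<^sub>C complex)" where
  "coeff0 = (SOME E. (\<forall>x y. E (x + y) = E x + E y) \<and> (\<forall>c x. E (c *\<^sub>C x) = c *\<^sub>C E x) \<and>
     (\<forall>x. norm (E x) \<le> norm x) \<and> (\<forall>f\<in>finite_sums. E (psum \<iota> V f) = f 0))"

lemma coeff0: "coeff0 (x + y) = coeff0 x + coeff0 y" "coeff0 (c *\<^sub>C x) = c *\<^sub>C coeff0 x"
  "norm (coeff0 x) \<le> norm x" "f \<in> finite_sums \<Longrightarrow> coeff0 (psum \<iota> V f) = f 0"
proof -
  have "\<exists>E. (\<forall>x y. E (x + y) = E x + E y) \<and> (\<forall>c x. E (c *\<^sub>C x) = c *\<^sub>C E x) \<and>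
     (\<forall>x. norm (E x) \<le> norm x) \<and> (\<forall>f\<in>finite_sums. E (psum \<iota> V f) = f 0)"
    by (rule extend_from_finite_sums) (simp_all add: norm_zero_coefficient_le)
  from someI_ex[OF this] show "coeff0 (x + y) = coeff0 x + coeff0 y" "coeff0 (c *\<^sub>C x) = c *\<^sub>C coeff0 x"
    "norm (coeff0 x) \<le> norm x" "f \<in> finite_sums \<Longrightarrow> coeff0 (psum \<iota> V f) = f 0"
    unfolding coeff0_def[symmetric] by simp_all
qed

lemma bounded_linear_coeff0: "bounded_linear coeff0"
  by (rule bounded_linear_scaleC_homI[where K = 1]) (simp_all add: coeff0)

lemma coeff0_vmono: "coeff0 (vmono a n) = (if n = 0 then a else 0)"
  using coeff0(4)[OF single_finite_sums, of n a] unfolding psum_vmono by (simp add: single_def)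

text \<open>Multiplying by the inverse power on the right leaves the coefficient to the left of
  \<open>V^n\<close>, so no power of \<alpha> appears.\<close>

definition coeff :: "int \<Rightarrow> 'b \<Rightarrow> ('x \<Rightarrow>\<^sub>C complex)" where
  "coeff n x = coeff0 (x * unitary_power V (- n))"

lemma bounded_linear_coeff: "bounded_linear (coeff n)"
  unfolding coeff_def
  by (rule bounded_linear_compose[OF bounded_linear_coeff0 bounded_linear_mult_left])

lemma coeff_vmono: "coeff n (vmono a m) = (if n = m then a else 0)"
proof -
  have "coeff n (vmono a m) = coeff0 (vmono (a * aut_power \<alpha> m 1) (m - n))"
    by (simp add: coeff_def power_eq_vmono vmono_mult)
  also have "aut_power \<alpha> m 1 = 1"
    by (simp add: star_hom_one star_automorphism_star_hom star_automorphism_aut_power[OF \<alpha>])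
  finally show ?thesis by (simp add: coeff0_vmono)
qed

end

section \<open>Fejer means\<close>

text \<open>Counts the pairs in a square of side \<open>N\<close> with difference \<open>n\<close>.
  Truncated subtraction gives 0 for \<open>\<bar>n\<bar> \<ge> N\<close>, as it should; these counts
  are the Fejer weights.\<close>

lemma sum_diff_eq_indicator:
  fixes c :: "'a::semiring_1"
  shows "(\<Sum>i<N. \<Sum>j<N. if int i - int j = n then c else 0) = of_nat (N - nat \<bar>n\<bar>) * c"
proof -
  have inner: "(\<Sum>j<N. if int i - int j = n then c else 0) = (if 0 \<le> int i - n \<and> int i - n < int N then c else 0)"
    for i :: nat
  proof -
    have "(int i - int j = n) = (0 \<le> int i - n \<and> j = nat (int i - n))" for j by auto
    then have "(\<Sum>j<N. if int i - int j = n then c else 0) =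
        (\<Sum>j<N. if j = nat (int i - n) then (if 0 \<le> int i - n then c else 0) else 0)"
      by (intro sum.cong refl) auto
    also have "\<dots> = (if 0 \<le> int i - n \<and> int i - n < int N then c else 0)"
      by auto
    finally show ?thesis .
  qed
  have set: "{i \<in> {..<N}. 0 \<le> int i - n \<and> int i - n < int N} =
      (if 0 \<le> n then {nat n..<N} else {..<N - nat (- n)})" by auto
  have "(\<Sum>i<N. if 0 \<le> int i - n \<and> int i - n < int N then c else 0) =
      of_nat (card {i \<in> {..<N}. 0 \<le> int i - n \<and> int i - n < int N}) * c"
    by (subst sum.inter_filter[symmetric]) simp_all
  also have "card {i \<in> {..<N}. 0 \<le> int i - n \<and> int i - n < int N} = N - nat \<bar>n\<bar>"
    unfolding set by simp
  finally show ?thesis unfolding inner .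
qed

lemma cesaro_weight_tendsto: "(\<lambda>N. real (N - nat \<bar>n\<bar>) / real N) \<longlonglongrightarrow> 1"
proof -
  have "(\<lambda>N. 1 - real (nat \<bar>n\<bar>) / real N) \<longlonglongrightarrow> 1 - 0"
    by (intro tendsto_diff tendsto_const lim_const_over_n)
  moreover have "\<forall>\<^sub>F N in sequentially. 1 - real (nat \<bar>n\<bar>) / real N = real (N - nat \<bar>n\<bar>) / real N"
    using eventually_gt_at_top[of "nat \<bar>n\<bar>"] by eventually_elim (simp add: of_nat_diff field_simps)
  ultimately show ?thesis by (simp add: filterlim_cong[OF refl refl])
qed

text \<open>A one-sided Dirichlet sum; its squared modulus is \<open>N\<close> times the Fejer
  kernel.\<close>

definition dirichlet :: "nat \<Rightarrow> real \<Rightarrow> complex" where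
  "dirichlet N t = (\<Sum>i<N. cis (t * real i))"

lemma dirichlet_square:
  "complex_of_real ((cmod (dirichlet N t))\<^sup>2) = (\<Sum>i<N. \<Sum>j<N. cis (t * of_int (int j - int i)))"
proof -
  have "complex_of_real ((cmod (dirichlet N t))\<^sup>2) = cnj (dirichlet N t) * dirichlet N t"
    by (simp add: complex_norm_square mult.commute del: of_real_power)
  also have "\<dots> = (\<Sum>i<N. \<Sum>j<N. cis (- (t * real i)) * cis (t * real j))"
    by (simp add: dirichlet_def sum_product cis_cnj)
  finally show ?thesis by (simp add: cis_mult algebra_simps)
qed

text \<open>The equidistant quadrature is exact here: all frequencies \<open>j - i + n\<close> have
  modulus below \<open>M\<close>.\<close>

lemma fejer_sum:
  assumes N: "N > 0" and M: "\<bar>n\<bar> + int N \<le> int M"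
  shows "(\<Sum>k<M. complex_of_real ((cmod (dirichlet N (2 * pi * real k / real M)))\<^sup>2) *
      cis (2 * pi * real k / real M * of_int n)) = of_nat M * of_nat (N - nat \<bar>n\<bar>)"
proof -
  have M0: "M > 0" using N M by linarith
  have "(\<Sum>k<M. complex_of_real ((cmod (dirichlet N (2 * pi * real k / real M)))\<^sup>2) *
      cis (2 * pi * real k / real M * of_int n)) =
    (\<Sum>k<M. \<Sum>i<N. \<Sum>j<N. cis (2 * pi * real k / real M * of_int (int j - int i + n)))"
    unfolding dirichlet_square sum_distrib_right cis_mult
    by (simp only: distrib_left[symmetric] of_int_add)
  also have "\<dots> = (\<Sum>i<N. \<Sum>j<N. \<Sum>k<M. cis (2 * pi * real k / real M * of_int (int j - int i + n)))"
    by (rule trans[OF sum.swap sum.cong[OF refl sum.swap]])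
  also have "\<dots> = (\<Sum>i<N. \<Sum>j<N. if int i - int j = n then of_nat M else 0)"
  proof (intro sum.cong refl)
    fix i j assume "i \<in> {..<N}" "j \<in> {..<N}"
    then have "\<bar>int j - int i + n\<bar> < int M" using M by auto
    from sum_roots_of_unity[OF M0 this]
    show "(\<Sum>k<M. cis (2 * pi * real k / real M * of_int (int j - int i + n))) =
        (if int i - int j = n then of_nat M else 0)" by auto
  qed
  finally show ?thesis by (simp only: sum_diff_eq_indicator mult.commute)
qed

context crossed_product_CX
begin

text \<open>Uniform contractivity makes the set of points of convergence closed, so convergence on
  monomials suffices. It serves both the Cesaro means and the approximating states of the
  extension.\<close>

lemma operator_limit:
  fixes T :: "nat \<Rightarrow> 'b \<Rightarrow> 'c::banach"
  assumes bl: "\<And>N. bounded_linear (T N)" and le: "\<And>N x. norm (T N x) \<le> norm x"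
    and conv: "\<And>a n. convergent (\<lambda>N. T N (vmono a n))"
  obtains Q where "bounded_linear Q" "\<And>x. (\<lambda>N. T N x) \<longlonglongrightarrow> Q x"
proof -
  have T: "T N (x + y) = T N x + T N y" "T N (x - y) = T N x - T N y" "T N (r *\<^sub>R x) = r *\<^sub>R T N x" for N x y r
    using bl[of N] by (simp_all add: bounded_linear.linear linear_add linear_diff linear_scale)
  have "convergent (\<lambda>N. T N x)" for x
  proof (induction x rule: crossed_product_induct)
    case closed
    show ?case
      unfolding closed_sequential_limits
    proof (intro allI impI, elim conjE)
      fix s x assume s: "\<forall>k. s k \<in> {x. convergent (\<lambda>N. T N x)}" and lim: "s \<longlonglongrightarrow> x"
      have "Cauchy (\<lambda>N. T N x)"
      proof (rule metric_CauchyI)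
        fix e :: real assume "e > 0"
        then have e3: "e / 3 > 0" by simp
        obtain k where k: "dist (s k) x < e / 3"
          using metric_LIMSEQ_D[OF lim e3] by blast
        have "Cauchy (\<lambda>N. T N (s k))" using s by (simp add: Cauchy_convergent_iff)
        then obtain M where M: "\<And>m n. m \<ge> M \<Longrightarrow> n \<ge> M \<Longrightarrow> dist (T m (s k)) (T n (s k)) < e / 3"
          using metric_CauchyD e3 by meson
        have d: "dist (T m x) (T m (s k)) < e / 3" for m
          using le[of m "x - s k"] k by (simp add: dist_norm T norm_minus_commute)
        have "dist (T m x) (T n x) < e" if "m \<ge> M" "n \<ge> M" for m n
        proof -
          have "dist (T m x) (T n x) \<le> dist (T m x) (T m (s k)) + dist (T m (s k)) (T n (s k)) + dist (T n (s k)) (T n x)"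
            by (meson add_mono dist_triangle order_refl order_trans)
          then show ?thesis using d[of m] d[of n] M[OF that] by (simp add: dist_commute)
        qed
        then show "\<exists>M. \<forall>m\<ge>M. \<forall>n\<ge>M. dist (T m x) (T n x) < e" by blast
      qed
      then show "x \<in> {x. convergent (\<lambda>N. T N x)}" by (simp add: Cauchy_convergent_iff)
    qed
  next
    case (add x y)
    then show ?case by (simp add: T convergent_add)
  qed (rule conv)
  then have "\<forall>x. \<exists>q. (\<lambda>N. T N x) \<longlonglongrightarrow> q" by (simp add: convergent_def)
  then obtain Q where Q: "\<And>x. (\<lambda>N. T N x) \<longlonglongrightarrow> Q x" by metis
  have "bounded_linear Q"
  proof (rule bounded_linear_intro[where K = 1])
    fix x y and r :: real
    show "Q (x + y) = Q x + Q y"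
      using LIMSEQ_unique[OF Q[of "x + y"]] tendsto_add[OF Q[of x] Q[of y]] by (simp add: T)
    show "Q (r *\<^sub>R x) = r *\<^sub>R Q x"
      using LIMSEQ_unique[OF Q[of "r *\<^sub>R x"]] tendsto_scaleR[OF tendsto_const Q[of x]] by (simp add: T)
    show "norm (Q x) \<le> norm x * 1"
      using Lim_bounded[OF tendsto_norm[OF Q[of x]]] le by simp
  qed
  then show ?thesis using that Q by blast
qed

text \<open>Each difference \<open>n = i - j\<close> occurs \<open>N - \<bar>n\<bar>\<close> times,
  so this is the \<open>N\<close>-th Fejer mean of the Fourier series.\<close>

definition cesaro :: "nat \<Rightarrow> 'b \<Rightarrow> 'b" where
  "cesaro N x = (1 / real N) *\<^sub>R (\<Sum>i<N. \<Sum>j<N. vmono (coeff (int i - int j) x) (int i - int j))"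

lemma bounded_linear_cesaro: "bounded_linear (cesaro N)"
proof -
  have "bounded_linear (\<lambda>x. vmono (coeff n x) n)" for n
    unfolding vmono_def
    by (rule bounded_linear_compose[OF bounded_linear_mult_left
          bounded_linear_compose[OF bounded_linear_star_hom[OF \<iota>_hom] bounded_linear_coeff]])
  then show ?thesis
    unfolding cesaro_def
    by (intro bounded_linear_compose[OF bounded_linear_scaleR_right] bounded_linear_sum)
qed

lemma cesaro_vmono: "cesaro N (vmono a n) = (real (N - nat \<bar>n\<bar>) / real N) *\<^sub>R vmono a n"
proof -
  have "(\<Sum>i<N. \<Sum>j<N. vmono (coeff (int i - int j) (vmono a n)) (int i - int j)) =
      (\<Sum>i<N. \<Sum>j<N. if int i - int j = n then vmono a n else 0)"
    by (intro sum.cong refl) (auto simp: coeff_vmono vmono_zero)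
  also have "\<dots> = real (N - nat \<bar>n\<bar>) *\<^sub>R vmono a n"
    by (simp add: sum_diff_eq_indicator scaleR_conv_of_real)
  finally show ?thesis by (simp add: cesaro_def)
qed

text \<open>\<open>M * N\<close> times the Fejer mean is a sum of dual-action images with
  nonnegative weights of total mass \<open>M * N\<close>, and each image has norm at most that of
  the element.\<close>

lemma norm_cesaro_psum_le:
  assumes f: "f \<in> finite_sums"
  shows "norm (cesaro N (psum \<iota> V f)) \<le> norm (psum \<iota> V f)"
proof (cases "N = 0")
  case False
  then have N: "N > 0" by simp
  define F where "F = {n. f n \<noteq> 0}"
  have F: "finite F" using f by (simp add: F_def finite_sums_def)
  \<comment> \<open>Large enough for the quadrature to be exact at every degree in the
    support.\<close>
  define M where "M = N + nat (\<Sum>n\<in>F. \<bar>n\<bar>)"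
  have M: "\<bar>n\<bar> + int N \<le> int M" if "n \<in> F" for n
    using member_le_sum[OF that, of abs] F by (simp add: M_def)
  have M0: "M > 0" "\<bar>0\<bar> + int N \<le> int M" using N by (simp_all add: M_def)
  define t where "t k = 2 * pi * real k / real M" for k
  define w where "w k = (cmod (dirichlet N (t k)))\<^sup>2" for k
  have w: "(\<Sum>k<M. complex_of_real (w k) * cis (t k * of_int n)) = of_nat M * of_nat (N - nat \<bar>n\<bar>)"
    if "\<bar>n\<bar> + int N \<le> int M" for n
    unfolding w_def t_def by (rule fejer_sum[OF N that])
  have "complex_of_real (\<Sum>k<M. w k) = complex_of_real (real M * real N)"
    using w[OF M0(2)] by simp
  then have wsum: "(\<Sum>k<M. w k) = real M * real N" by (simp only: of_real_eq_iff)
  have lin: "cesaro N (sum g A) = (\<Sum>i\<in>A. cesaro N (g i))" for g and A :: "int set"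
    by (rule linear_sum[OF bounded_linear.linear[OF bounded_linear_cesaro]])
  have "(\<Sum>k<M. w k *\<^sub>R (\<Sum>n\<in>F. cis (t k * n) *\<^sub>C vmono (f n) n)) =
      (\<Sum>n\<in>F. (\<Sum>k<M. complex_of_real (w k) * cis (t k * of_int n)) *\<^sub>C vmono (f n) n)"
    by (simp only: scaleR_scaleC scaleC.scale_sum_right scaleC_scaleC scaleC.scale_sum_left)
      (rule sum.swap)
  also have "\<dots> = (\<Sum>n\<in>F. (real M * real N) *\<^sub>R cesaro N (vmono (f n) n))"
  proof (intro sum.cong refl)
    fix n assume n: "n \<in> F"
    show "(\<Sum>k<M. complex_of_real (w k) * cis (t k * of_int n)) *\<^sub>C vmono (f n) n =
        (real M * real N) *\<^sub>R cesaro N (vmono (f n) n)"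
      unfolding w[OF M[OF n]] cesaro_vmono using N by (simp add: scaleR_scaleC scaleC_scaleC)
  qed
  also have "\<dots> = (real M * real N) *\<^sub>R cesaro N (psum \<iota> V f)"
    by (simp add: psum_eq_sum_vmono F_def lin scaleR_sum_right)
  finally have "real M * real N * norm (cesaro N (psum \<iota> V f)) =
      norm (\<Sum>k<M. w k *\<^sub>R (\<Sum>n\<in>F. cis (t k * n) *\<^sub>C vmono (f n) n))"
    by simp
  also have "\<dots> \<le> (\<Sum>k<M. w k * norm (psum \<iota> V f))"
  proof (rule sum_norm_le)
    fix k
    show "norm (w k *\<^sub>R (\<Sum>n\<in>F. cis (t k * n) *\<^sub>C vmono (f n) n)) \<le> w k * norm (psum \<iota> V f)"
      using mult_left_mono[OF norm_psum_dual_le[OF f, of "t k"], of "w k"]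
      by (simp add: F_def w_def)
  qed
  also have "\<dots> = real M * real N * norm (psum \<iota> V f)"
    by (simp add: sum_distrib_right[symmetric] wsum)
  finally show ?thesis using N M0(1) by simp
qed (simp add: cesaro_def)

lemma norm_cesaro_le: "norm (cesaro N x) \<le> norm x"
proof -
  obtain f where f: "\<And>k::nat. f k \<in> finite_sums" "(\<lambda>k. psum \<iota> V (f k)) \<longlonglongrightarrow> x"
    using approx_finite_sums by metis
  show ?thesis
    by (rule LIMSEQ_le[OF tendsto_norm[OF bounded_linear.tendsto[OF bounded_linear_cesaro f(2)]]
          tendsto_norm[OF f(2)]]) (use norm_cesaro_psum_le f(1) in blast)
qed

lemma cesaro_tendsto: "(\<lambda>N. cesaro N x) \<longlonglongrightarrow> x"
proof -
  have lim: "(\<lambda>N. cesaro N (vmono a n)) \<longlonglongrightarrow> vmono a n" for a n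
    unfolding cesaro_vmono using tendsto_scaleR[OF cesaro_weight_tendsto[of n] tendsto_const[of "vmono a n"]]
    by simp
  obtain Q where Q: "bounded_linear Q" "\<And>x. (\<lambda>N. cesaro N x) \<longlonglongrightarrow> Q x"
    using operator_limit[of cesaro, OF bounded_linear_cesaro norm_cesaro_le convergentI[OF lim]] by blast
  have "Q x = x"
    by (rule bounded_linear_eqI[OF Q(1) bounded_linear_ident LIMSEQ_unique[OF Q(2) lim]])
  then show ?thesis using Q(2)[of x] by simp
qed

end

section \<open>Skew products\<close>

lemma bounded_linear_apply_bcontfun:
  "bounded_linear (\<lambda>a :: 'x::metric_space \<Rightarrow>\<^sub>C complex. apply_bcontfun a x)"
  by (rule bounded_linear_intro[where K = 1])
    (simp_all add: plus_bcontfun.rep_eq scaleR_bcontfun.rep_eq norm_bcontfun_le)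

lemma star_mult_self_eq_one_iff:
  fixes w :: "'x::metric_space \<Rightarrow>\<^sub>C complex"
  shows "star w * w = 1 \<longleftrightarrow> (\<forall>x. cmod (apply_bcontfun w x) = 1)"
proof
  assume "star w * w = 1"
  then have "complex_of_real ((cmod (apply_bcontfun w x))\<^sup>2) = 1" for x
    using apply_star_mult_self[of w x] by (simp add: one_bcontfun.rep_eq)
  then have "(cmod (apply_bcontfun w x))\<^sup>2 = 1" for x by (metis of_real_eq_1_iff)
  then show "\<forall>x. cmod (apply_bcontfun w x) = 1" by (simp add: power2_eq_1_iff) (smt (verit) norm_ge_zero)
next
  assume "\<forall>x. cmod (apply_bcontfun w x) = 1"
  then show "star w * w = 1"
    by (intro bcontfun_eqI) (simp only: apply_star_mult_self one_bcontfun.rep_eq, simp)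
qed

locale skew_setting = crossed_product_CX \<alpha> \<iota> V
  for \<alpha> :: "('x::metric_space \<Rightarrow>\<^sub>C complex) \<Rightarrow> ('x \<Rightarrow>\<^sub>C complex)"
    and \<iota> :: "('x \<Rightarrow>\<^sub>C complex) \<Rightarrow> 'b::cstar_algebra" and V :: 'b +
  fixes \<theta> :: "'g::topological_group_add \<Rightarrow> ('x \<Rightarrow>\<^sub>C complex) \<Rightarrow> ('x \<Rightarrow>\<^sub>C complex)"
    and \<omega>\<^sub>0 :: "('x \<Rightarrow>\<^sub>C complex) \<Rightarrow> complex" and \<mu> :: "'x measure"
    and u :: "'g \<Rightarrow> ('x \<Rightarrow>\<^sub>C complex)"
  assumes amenable: "amenable TYPE('g)"
    and dynamical: "cstar_dynamical_system \<theta>"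
    and unique: "uniquely_ergodic \<theta>"
    and \<omega>\<^sub>0: "invariant_state \<theta> \<omega>\<^sub>0"
    and \<mu>: "prob_space \<mu>" and sets_\<mu>: "sets \<mu> = sets borel"
    and \<omega>\<^sub>0_eq: "\<omega>\<^sub>0 f = (\<integral>x. apply_bcontfun f x \<partial>\<mu>)"
    and commute: "\<alpha> \<circ> \<theta> g = \<theta> g \<circ> \<alpha>"
    and cocycle: "continuous_cocycle \<theta> u"
begin

lemma \<theta>_aut: "star_automorphism (\<theta> g)"
  using dynamical by (simp add: cstar_dynamical_system_def)

lemma \<theta>_hom: "star_hom (\<theta> g)"
  by (rule star_automorphism_star_hom[OF \<theta>_aut])

lemmas \<theta>_simps = star_hom_add[OF \<theta>_hom] star_hom_scaleC[OF \<theta>_hom] star_hom_mult[OF \<theta>_hom]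
  star_hom_star[OF \<theta>_hom] star_hom_one[OF \<theta>_hom] star_hom_zero[OF \<theta>_hom]

lemma \<theta>_add: "\<theta> (g + h) a = \<theta> g (\<theta> h a)"
  using dynamical by (simp add: cstar_dynamical_system_def)

lemma \<theta>_0: "\<theta> 0 a = a"
  using \<theta>_add[of 0 0 a] \<theta>_aut[of 0] by (simp add: star_automorphism_def bij_def inj_eq)

lemma \<theta>_inverse: "\<theta> g (\<theta> (- g) a) = a" "\<theta> (- g) (\<theta> g a) = a"
  using \<theta>_add[of g "- g" a] \<theta>_add[of "- g" g a] by (simp_all add: \<theta>_0)

lemma \<alpha>_\<theta>: "\<alpha> (\<theta> g a) = \<theta> g (\<alpha> a)"
  using fun_cong[OF commute[of g], of a] by simp

lemma u_unitary: "star (u g) * u g = 1"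
  using cocycle by (simp add: star_mult_self_eq_one_iff continuous_cocycle_def)

lemma u_add: "u (g + h) = \<theta> g (u h) * u g"
  using cocycle by (simp add: continuous_cocycle_def)

lemma u_0: "u 0 = 1"
proof -
  have "u 0 * u 0 = u 0" using u_add[of 0 0] by (simp add: \<theta>_0)
  then have "star (u 0) * u 0 * u 0 = star (u 0) * u 0" by (simp add: mult.assoc)
  then show ?thesis by (simp add: u_unitary)
qed

subsection \<open>The skew product\<close>

text \<open>The pair to which universality is applied to get the skew product. It is covariant
  because \<alpha> commutes with \<theta> and, C(X) being commutative, \<open>u g\<close> cancels
  against its adjoint.\<close>

lemma covariant_skew: "covariant \<alpha> (\<lambda>a. \<iota> (\<theta> g a)) (\<iota> (u g) * V)"
proof -
  have vv: "star V * V = 1" "V * star V = 1" using V_unitary by (simp_all add: unitary_def)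
  have uu: "star (\<iota> (u g)) * \<iota> (u g) = 1" "\<iota> (u g) * star (\<iota> (u g)) = 1"
    using u_unitary[of g] bcontfun_mult_commute[of "star (u g)" "u g"]
    by (simp_all add: \<iota>_simps(3,4)[symmetric] \<iota>_simps(5))
  have "unitary (\<iota> (u g) * V)"
  proof -
    have "star (\<iota> (u g) * V) * (\<iota> (u g) * V) = star V * (star (\<iota> (u g)) * \<iota> (u g)) * V"
      "\<iota> (u g) * V * star (\<iota> (u g) * V) = \<iota> (u g) * (V * star V) * star (\<iota> (u g))"
      by (simp_all only: star_mult mult.assoc)
    then show ?thesis by (simp add: unitary_def uu vv)
  qed
  moreover have "\<iota> (u g) * V * \<iota> (\<theta> g a) * star (\<iota> (u g) * V) = \<iota> (\<theta> g (\<alpha> a))" for a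
  proof -
    have "\<iota> (u g) * V * \<iota> (\<theta> g a) * star (\<iota> (u g) * V) =
        \<iota> (u g) * (V * \<iota> (\<theta> g a) * star V) * star (\<iota> (u g))"
      by (simp only: star_mult mult.assoc)
    also have "V * \<iota> (\<theta> g a) * star V = \<iota> (\<theta> g (\<alpha> a))"
      using covariant_\<iota>_V by (simp add: covariant_def \<alpha>_\<theta>)
    also have "\<iota> (u g) * \<iota> (\<theta> g (\<alpha> a)) * star (\<iota> (u g)) = \<iota> (star (u g) * u g * \<theta> g (\<alpha> a))"
      by (simp only: \<iota>_simps(3,4)[symmetric]) (simp only: bcontfun_mult_commute bcontfun_mult_left_commute)
    finally show ?thesis by (simp add: u_unitary)
  qed
  ultimately show ?thesis
    by (simp add: covariant_def star_hom_compose[OF \<iota>_hom \<theta>_hom])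
qed

definition \<Phi> :: "'g \<Rightarrow> 'b \<Rightarrow> 'b" where
  "\<Phi> = skew_product \<iota> V \<theta> u"

lemma crossed_star_hom_eqI:
  "star_hom f \<Longrightarrow> star_hom g \<Longrightarrow> (\<And>a. f (\<iota> a) = g (\<iota> a)) \<Longrightarrow> f V = g V \<Longrightarrow> f = g"
  by (rule star_hom_eqI[OF generated]) auto

text \<open>\<open>skew_product\<close> is a definite description. Universality gives a homomorphism
  for each group element; those for \<open>g\<close> and \<open>- g\<close> are mutually inverse by
  the cocycle identity. Uniqueness holds because \<open>V\<close> and \<open>range \<iota>\<close>
  generate.\<close>

lemma \<Phi>_exists: "star_automorphism (\<Phi> g) \<and> (\<forall>a. \<Phi> g (\<iota> a) = \<iota> (\<theta> g a)) \<and> \<Phi> g V = \<iota> (u g) * V"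
proof -
  have "\<exists>\<rho>. star_hom \<rho> \<and> (\<forall>a. \<rho> (\<iota> a) = \<iota> (\<theta> g a)) \<and> \<rho> V = \<iota> (u g) * V" for g
    using covariant_extends[OF covariant_skew[of g]] by metis
  then obtain \<rho> where \<rho>: "\<And>g. star_hom (\<rho> g)" "\<And>g a. \<rho> g (\<iota> a) = \<iota> (\<theta> g a)" "\<And>g. \<rho> g V = \<iota> (u g) * V"
    by metis
  have comp: "\<rho> g (\<rho> h x) = x" if "g + h = 0" for g h x
  proof -
    have "(\<lambda>x. \<rho> g (\<rho> h x)) = (\<lambda>x. x)"
    proof (rule crossed_star_hom_eqI)
      show "star_hom (\<lambda>x. \<rho> g (\<rho> h x))" by (rule star_hom_compose[OF \<rho>(1) \<rho>(1)])
      show "star_hom (\<lambda>x::'b. x)" by (simp add: star_hom_def)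
      show "\<rho> g (\<rho> h (\<iota> a)) = \<iota> a" for a
        using \<theta>_add[of g h a] that by (simp add: \<rho> \<theta>_0)
      have "\<rho> g (\<rho> h V) = \<iota> (\<theta> g (u h) * u g) * V"
        by (simp add: \<rho> star_hom_mult[OF \<rho>(1)] \<iota>_simps mult.assoc)
      moreover have "\<theta> g (u h) * u g = 1" using u_add[of g h] that by (simp add: u_0)
      ultimately show "\<rho> g (\<rho> h V) = V" by (simp only: \<iota>_simps(5) mult_1_left)
    qed
    then show ?thesis by metis
  qed
  have "bij (\<rho> g)"
    by (rule o_bij[of "\<rho> (- g)"]) (auto simp: comp)
  then have *: "star_automorphism (\<rho> g) \<and> (\<forall>a. \<rho> g (\<iota> a) = \<iota> (\<theta> g a)) \<and> \<rho> g V = \<iota> (u g) * V"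
    using \<rho> by (simp add: star_automorphism_def)
  show ?thesis
    unfolding \<Phi>_def skew_product_def
  proof (rule theI[of "\<lambda>\<Phi>. star_automorphism \<Phi> \<and> (\<forall>a. \<Phi> (\<iota> a) = \<iota> (\<theta> g a)) \<and> \<Phi> V = \<iota> (u g) * V", OF *])
    fix \<sigma> assume \<sigma>: "star_automorphism \<sigma> \<and> (\<forall>a. \<sigma> (\<iota> a) = \<iota> (\<theta> g a)) \<and> \<sigma> V = \<iota> (u g) * V"
    show "\<sigma> = \<rho> g"
      by (rule crossed_star_hom_eqI) (use \<sigma> * in \<open>auto simp: star_automorphism_star_hom\<close>)
  qed
qed

lemma \<Phi>_hom: "star_hom (\<Phi> g)" and \<Phi>_\<iota>: "\<Phi> g (\<iota> a) = \<iota> (\<theta> g a)" and \<Phi>_V: "\<Phi> g V = \<iota> (u g) * V"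
  using \<Phi>_exists[of g] by (simp_all add: star_automorphism_star_hom)

abbreviation Fix :: "'b set" where
  "Fix \<equiv> fixed_points \<Phi>"

abbreviation c :: "int \<Rightarrow> 'g \<Rightarrow> ('x \<Rightarrow>\<^sub>C complex)" where
  "c \<equiv> cocycle_power \<alpha> u"

lemma cocycle_power_0: "c 0 g = 1"
  by (simp add: cocycle_power_def)

lemma cocycle_power_Suc: "0 \<le> n \<Longrightarrow> c (n + 1) g = c n g * aut_power \<alpha> n (u g)"
  by (simp add: cocycle_power_def upto_rec2)

lemma cocycle_power_pred: "n \<le> 0 \<Longrightarrow> c (n - 1) g = aut_power \<alpha> (n - 1) (star (u g)) * c n g"
  by (cases "n = 0") (auto simp: cocycle_power_def upto_rec1)

text \<open>Shows where \<open>cocycle_power\<close> comes from: it is the coefficient collected by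
  the powers of \<open>\<iota> (u g) * V\<close>. Downwards the factors appear in reverse order,
  which commutativity of C(X) repairs.\<close>

lemma skew_power: "unitary_power (\<iota> (u g) * V) n = vmono (c n g) n"
proof -
  have U: "unitary (\<iota> (u g) * V)" using covariant_skew by (simp add: covariant_def)
  have uV: "\<iota> (u g) * V = vmono (u g) 1"
    by (simp add: vmono_def unitary_power_1[OF V_unitary])
  show ?thesis
  proof (induction n rule: int_induct[where k = 0])
    case base
    then show ?case by (simp add: unitary_power_0[OF U] cocycle_power_0 one_eq_vmono[symmetric])
  next
    case (step1 i)
    have "unitary_power (\<iota> (u g) * V) (i + 1) = vmono (c i g) i * vmono (u g) 1"
      by (simp only: unitary_power_Suc[OF U] step1(2) uV[symmetric])
    then show ?case by (simp only: vmono_mult cocycle_power_Suc[OF step1(1)])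
  next
    case (step2 i)
    have "unitary_power (\<iota> (u g) * V) (i - 1) = vmono (c i g) i * star (vmono (u g) 1)"
      by (simp only: unitary_power_pred[OF U] step2(2) uV[symmetric])
    also have "\<dots> = vmono (c i g * aut_power \<alpha> (i - 1) (star (u g))) (i - 1)"
      by (simp add: vmono_star vmono_mult aut_power_add[OF \<alpha>, symmetric])
    finally show ?case
      by (simp only: cocycle_power_pred[OF step2(1)] bcontfun_mult_commute)
  qed
qed

lemma \<Phi>_vmono: "\<Phi> g (vmono a n) = vmono (\<theta> g a * c n g) n"
  unfolding star_hom_vmono[OF \<Phi>_hom] \<Phi>_\<iota> \<Phi>_V skew_power
  using vmono_mult[of "\<theta> g a" 0 "c n g" n] by (simp add: \<iota>_eq_vmono[symmetric] aut_power_0[OF \<alpha>])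

text \<open>Read off from the unitarity of the powers of \<open>\<iota> (u g) * V\<close>, so that
  no product has to be expanded.\<close>

lemma c_unitary: "star (c n g) * c n g = 1"
proof -
  have "unitary (vmono (c n g) n)"
    using unitary_unitary_power covariant_skew unfolding skew_power[symmetric] covariant_def by blast
  then have "vmono (aut_power \<alpha> (- n) (star (c n g) * c n g)) 0 = vmono 1 0"
    by (simp add: unitary_def vmono_star vmono_mult one_eq_vmono[symmetric]
        star_hom_mult[OF star_automorphism_star_hom[OF star_automorphism_aut_power[OF \<alpha>]]])
  then have "aut_power \<alpha> (- n) (star (c n g) * c n g) = 1"
    by (metis coeff_vmono)
  then have "aut_power \<alpha> n 1 = star (c n g) * c n g"
    by (metis aut_power_inverse(1)[OF \<alpha>])
  then show ?thesis
    by (simp add: star_hom_one[OF star_automorphism_star_hom[OF star_automorphism_aut_power[OF \<alpha>]]])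
qed

lemma cmod_c: "cmod (apply_bcontfun (c n g) x) = 1"
  using c_unitary[of n g] by (simp add: star_mult_self_eq_one_iff)

lemma coeff_\<Phi>: "coeff n (\<Phi> g x) = \<theta> g (coeff n x) * c n g"
proof (rule bounded_linear_eqI[of "\<lambda>x. coeff n (\<Phi> g x)" "\<lambda>x. \<theta> g (coeff n x) * c n g"])
  show "bounded_linear (\<lambda>x. coeff n (\<Phi> g x))"
    by (rule bounded_linear_compose[OF bounded_linear_coeff bounded_linear_star_hom[OF \<Phi>_hom]])
  show "bounded_linear (\<lambda>x. \<theta> g (coeff n x) * c n g)"
    by (rule bounded_linear_compose[OF bounded_linear_mult_left
          bounded_linear_compose[OF bounded_linear_star_hom[OF \<theta>_hom] bounded_linear_coeff]])
qed (simp add: \<Phi>_vmono coeff_vmono \<theta>_simps)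

lemma vmono_fixed_iff: "vmono a n \<in> Fix \<longleftrightarrow> (\<forall>g. \<theta> g a * c n g = a)"
proof -
  have "vmono a n = vmono b n \<longleftrightarrow> a = b" for a b by (metis coeff_vmono)
  then show ?thesis by (simp add: fixed_points_def \<Phi>_vmono)
qed

text \<open>Taking the \<open>n\<close>-th coefficient intertwines the action with its form on
  degree \<open>n\<close>. This reduces the fixed algebra to fixed monomials.\<close>

lemma vmono_coeff_fixed: "b \<in> Fix \<Longrightarrow> vmono (coeff n b) n \<in> Fix"
  unfolding vmono_fixed_iff coeff_\<Phi>[symmetric] by (simp add: fixed_points_def)

lemma cstar_subalgebra_fixed_points: "cstar_subalgebra (Fix)"
proof -
  have "closed (\<Inter>g. {b. \<Phi> g b = b})"
    by (intro closed_INT ballI closed_Collect_eq linear_continuous_on bounded_linear_star_hom \<Phi>_hom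
        bounded_linear_ident)
  moreover have "Fix = (\<Inter>g. {b. \<Phi> g b = b})" by (auto simp: fixed_points_def)
  ultimately show ?thesis
    by (simp add: cstar_subalgebra_def)
      (simp add: star_hom_add[OF \<Phi>_hom] star_hom_mult[OF \<Phi>_hom] star_hom_one[OF \<Phi>_hom]
        star_hom_star[OF \<Phi>_hom] star_hom_scaleC[OF \<Phi>_hom])
qed

subsection \<open>Invariant states on the coefficient algebra\<close>

lemma \<omega>\<^sub>0_state: "state_on UNIV \<omega>\<^sub>0" and \<omega>\<^sub>0_\<theta>: "\<omega>\<^sub>0 (\<theta> g a) = \<omega>\<^sub>0 a"
  using \<omega>\<^sub>0 unfolding invariant_state_def by (simp_all, metis comp_apply)

lemma unique_state: "invariant_state \<theta> \<phi> \<Longrightarrow> \<phi> a = \<omega>\<^sub>0 a"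
  using unique \<omega>\<^sub>0 unfolding uniquely_ergodic_def by metis

lemma state_on_compose: "state_on UNIV \<phi> \<Longrightarrow> star_hom f \<Longrightarrow> state_on UNIV (\<lambda>x. \<phi> (f x))"
  by (auto simp: state_on_def star_hom_def)

text \<open>As \<alpha> commutes with \<theta>, \<open>\<omega>\<^sub>0 \<circ> \<alpha>\<close> is
  again an invariant state, and there is only one.\<close>

lemma \<omega>\<^sub>0_\<alpha>: "\<omega>\<^sub>0 (\<alpha> a) = \<omega>\<^sub>0 a"
proof -
  have "invariant_state \<theta> (\<lambda>a. \<omega>\<^sub>0 (\<alpha> a))"
    unfolding invariant_state_def
    using state_on_compose[OF \<omega>\<^sub>0_state star_automorphism_star_hom[OF \<alpha>]] by (auto simp: \<alpha>_\<theta> \<omega>\<^sub>0_\<theta>)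
  then show ?thesis by (rule unique_state)
qed

lemma \<omega>\<^sub>0_aut_power: "\<omega>\<^sub>0 (aut_power \<alpha> n a) = \<omega>\<^sub>0 a"
proof (induction n rule: int_induct[where k = 0])
  case base
  then show ?case by (simp add: aut_power_0[OF \<alpha>])
next
  case (step1 i)
  then show ?case by (simp add: aut_power_Suc[OF \<alpha>] \<omega>\<^sub>0_\<alpha>)
next
  case (step2 i)
  then show ?case using \<omega>\<^sub>0_\<alpha>[of "aut_power \<alpha> (i - 1) a"] aut_power_Suc[OF \<alpha>, of "i - 1" a] by simp
qed

lemma invariant_state_\<iota>:
  assumes "invariant_state \<Phi> \<psi>" shows "\<psi> (\<iota> a) = \<omega>\<^sub>0 a"
proof -
  have s: "state_on UNIV \<psi>" and i: "\<psi> (\<Phi> g x) = \<psi> x" for g x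
    using assms unfolding invariant_state_def by (simp_all, metis comp_apply)
  have "invariant_state \<theta> (\<lambda>a. \<psi> (\<iota> a))"
    unfolding invariant_state_def using state_on_compose[OF s \<iota>_hom]
    by (auto simp: \<Phi>_\<iota>[symmetric] i)
  then show ?thesis by (rule unique_state)
qed

text \<open>Averaging a point evaluation over the group yields an invariant state, hence \<open>\<omega>\<^sub>0\<close>. This makes
  fixed functions constant everywhere and not only \<open>\<mu>\<close>-almost everywhere.\<close>

lemma fixed_function_constant:
  assumes a: "\<And>g. \<theta> g a = a"
  shows "apply_bcontfun a x = \<omega>\<^sub>0 a"
proof -
  obtain M :: "'g measure" and m where M: "left_haar_measure M" and m: "left_invariant_mean M m"
    using amenable unfolding amenable_def by blast
  \<comment> \<open>The inverse turns \<open>\<theta> h\<close> on \<open>b\<close> into the left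
    translation \<open>g \<mapsto> - h + g\<close>, under which the mean is invariant.\<close>
  define f where "f b g = apply_bcontfun (\<theta> (- g) b) x" for b g
  have cont: "continuous_on UNIV (f b)" for b
  proof -
    have "continuous_on UNIV (\<lambda>g. \<theta> g b)" using dynamical by (simp add: cstar_dynamical_system_def)
    then have "continuous_on UNIV (\<lambda>g. \<theta> (- g) b)"
      by (rule continuous_on_compose2) (auto intro: continuous_intros)
    then show ?thesis unfolding f_def
      by (rule bounded_linear.continuous_on[OF bounded_linear_apply_bcontfun])
  qed
  have bd: "cmod (f b g) \<le> norm b" for b g
    unfolding f_def using norm_bcontfun_le[of "\<theta> (- g) b" x] star_hom_norm_le[OF \<theta>_hom, of "- g" b] by linarith
  have sM: "sets M = sets borel" using M by (simp add: left_haar_measure_def)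
  have fm: "f b \<in> borel_measurable M" for b
    using borel_measurable_continuous_onI[OF cont] by (simp add: measurable_cong_sets[OF sM refl])
  have Re: "(\<lambda>g. Re (f b g)) \<in> ess_bounded M" and Im: "(\<lambda>g. Im (f b g)) \<in> ess_bounded M" for b
    using fm[of b] bd[of b] order_trans[OF abs_Re_le_cmod] order_trans[OF abs_Im_le_cmod]
    by (auto simp: ess_bounded_def intro!: exI[of _ "norm b"])
  have add: "m (\<lambda>x. p x + q x) = m p + m q" and sc: "m (\<lambda>x. r * p x) = r * m p"
    and pos: "(AE x in M. 0 \<le> p x) \<Longrightarrow> 0 \<le> m p" and one: "m (\<lambda>_. 1) = 1"
    and inv: "m (\<lambda>x. p (g + x)) = m p"
    if "p \<in> ess_bounded M" "q \<in> ess_bounded M" for p q r g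
    using m that unfolding left_invariant_mean_def by blast+
  have scb: "(\<lambda>g. r * p g) \<in> ess_bounded M" if p: "p \<in> ess_bounded M" for r p
  proof -
    obtain C where "p \<in> borel_measurable M" "AE x in M. \<bar>p x\<bar> \<le> C" using p by (auto simp: ess_bounded_def)
    moreover from this(2) have "AE x in M. \<bar>r * p x\<bar> \<le> \<bar>r\<bar> * C"
      by eventually_elim (simp add: abs_mult mult_left_mono)
    ultimately show ?thesis by (auto simp: ess_bounded_def)
  qed
  have const: "m (\<lambda>_. r) = r" for r
  proof -
    have "(\<lambda>_. 1) \<in> ess_bounded M" by (auto simp: ess_bounded_def)
    then show ?thesis using sc[of "\<lambda>_. 1" "\<lambda>_. 1" r] one[of "\<lambda>_. 1" "\<lambda>_. 1"] by simp
  qed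
  \<comment> \<open>The mean acts on real functions, so real and imaginary parts are averaged
    separately.\<close>
  define \<rho> where "\<rho> b = Complex (m (\<lambda>g. Re (f b g))) (m (\<lambda>g. Im (f b g)))" for b
  have f_add: "f (b + d) g = f b g + f d g" and f_scale: "f (s *\<^sub>C b) g = s * f b g"
    and f_one: "f 1 g = 1" and f_star: "f (star b * b) g = of_real ((cmod (f b g))\<^sup>2)" for b d g s
    by (simp_all add: f_def \<theta>_simps apply_star_mult_self) (simp_all add: bcontfun_apply_simps)
  have lin: "m (\<lambda>g. r * p g + s * q g) = r * m p + s * m q"
    if "p \<in> ess_bounded M" "q \<in> ess_bounded M" for p q r s
    using add[OF scb[OF that(1), of r] scb[OF that(2), of s]] sc[OF that(1) that(1)] sc[OF that(2) that(2)] by simp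
  have "state_on UNIV \<rho>"
    unfolding state_on_def
  proof (intro conjI ballI allI)
    fix b d s
    show "\<rho> (b + d) = \<rho> b + \<rho> d"
      by (simp add: \<rho>_def f_add add Re Im complex_eq_iff)
    have "m (\<lambda>g. Re s * Re (f b g) + (- Im s) * Im (f b g)) = Re s * m (\<lambda>g. Re (f b g)) + (- Im s) * m (\<lambda>g. Im (f b g))"
      "m (\<lambda>g. Re s * Im (f b g) + Im s * Re (f b g)) = Re s * m (\<lambda>g. Im (f b g)) + Im s * m (\<lambda>g. Re (f b g))"
      by (intro lin Re Im)+
    then show "\<rho> (s *\<^sub>C b) = s * \<rho> b"
      by (simp add: \<rho>_def f_scale complex_eq_iff)
    show "Im (\<rho> (star b * b)) = 0"
      by (simp add: \<rho>_def f_star const del: of_real_power)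
    show "0 \<le> Re (\<rho> (star b * b))"
      using pos[OF Re[of "star b * b"] Re[of "star b * b"]] by (simp add: \<rho>_def f_star del: of_real_power)
    show "\<rho> 1 = 1" by (simp add: \<rho>_def f_one const complex_eq_iff)
  qed
  moreover have "\<rho> (\<theta> h b) = \<rho> b" for h b
  proof -
    have "f (\<theta> h b) g = f b (- h + g)" for g
      by (simp add: f_def \<theta>_add[symmetric] minus_add)
    then show ?thesis
      using inv[OF Re[of b] Re[of b], of "- h"] inv[OF Im[of b] Im[of b], of "- h"] by (simp add: \<rho>_def)
  qed
  ultimately have "invariant_state \<theta> \<rho>" by (auto simp: invariant_state_def)
  then have "\<rho> a = \<omega>\<^sub>0 a" by (rule unique_state)
  moreover have "\<rho> a = apply_bcontfun a x"
    by (simp add: \<rho>_def f_def a const)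
  ultimately show ?thesis by simp
qed

lemma fixed_function_eq: "(\<And>g. \<theta> g a = a) \<Longrightarrow> a = \<omega>\<^sub>0 a *\<^sub>C 1"
  by (rule bcontfun_eqI) (simp add: fixed_function_constant bcontfun_apply_simps)

text \<open>Multiplying the coboundary equation by the unimodular \<open>\<theta> g w\<close> turns
  it into invariance of \<open>w V^n\<close>.\<close>

lemma continuous_coboundary_iff:
  "continuous_coboundary \<theta> (c n) \<longleftrightarrow> (\<exists>w. star w * w = 1 \<and> vmono w n \<in> Fix)"
proof
  assume "continuous_coboundary \<theta> (c n)"
  then obtain w where w: "\<forall>x. cmod (apply_bcontfun w x) = 1" "\<And>g. c n g = \<theta> g (star w) * w"
    by (auto simp: continuous_coboundary_def)
  have ww: "star w * w = 1" using w(1) by (simp add: star_mult_self_eq_one_iff)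
  have "\<theta> g w * c n g = w" for g
  proof -
    have "\<theta> g w * c n g = \<theta> g (star w * w) * w"
      unfolding w(2) \<theta>_simps by (simp only: mult.assoc bcontfun_mult_left_commute)
    then show ?thesis by (simp add: ww \<theta>_simps)
  qed
  then show "\<exists>w. star w * w = 1 \<and> vmono w n \<in> Fix"
    using ww by (auto simp: vmono_fixed_iff)
next
  assume "\<exists>w. star w * w = 1 \<and> vmono w n \<in> Fix"
  then obtain w where w: "star w * w = 1" "\<And>g. \<theta> g w * c n g = w" by (auto simp: vmono_fixed_iff)
  have "c n g = \<theta> g (star w) * w" for g
  proof -
    have "\<theta> g (star w) * w = \<theta> g (star w) * (\<theta> g w * c n g)" by (simp only: w(2))
    also have "\<dots> = \<theta> g (star w * w) * c n g" by (simp only: \<theta>_simps mult.assoc)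
    finally show ?thesis by (simp add: w(1) \<theta>_simps)
  qed
  then show "continuous_coboundary \<theta> (c n)"
    using w(1) unfolding continuous_coboundary_def star_mult_self_eq_one_iff by blast
qed

text \<open>\<open>star a * a\<close> is \<theta>-fixed because \<open>c n g\<close> has modulus 1,
  hence it is constant at every point. A nonzero \<open>a\<close> can therefore be rescaled to a
  unimodular function.\<close>

lemma fixed_vmono_nonzero:
  assumes fixd: "vmono a n \<in> Fix" and "a \<noteq> 0"
  shows "continuous_coboundary \<theta> (c n)"
proof -
  have a: "\<theta> g a * c n g = a" for g using fixd by (simp add: vmono_fixed_iff)
  have "\<theta> g (star a * a) = star a * a" for g
  proof -
    have "star a * a = star (\<theta> g a * c n g) * (\<theta> g a * c n g)" by (simp only: a)
    also have "\<dots> = (star (c n g) * c n g) * (star (\<theta> g a) * \<theta> g a)"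
      unfolding star_mult by (simp only: mult.assoc bcontfun_mult_left_commute bcontfun_mult_commute)
    finally have "star a * a = star (\<theta> g a) * \<theta> g a" by (simp only: c_unitary mult_1_left)
    then show ?thesis unfolding \<theta>_simps by (rule sym)
  qed
  from fixed_function_constant[OF this]
  have r: "complex_of_real ((cmod (apply_bcontfun a x))\<^sup>2) = \<omega>\<^sub>0 (star a * a)" for x
    by (simp only: apply_star_mult_self)
  obtain x0 where x0: "apply_bcontfun a x0 \<noteq> 0"
    using \<open>a \<noteq> 0\<close> bcontfun_eqI[of a 0] by (auto simp: zero_bcontfun.rep_eq)
  define s where "s = cmod (apply_bcontfun a x0)"
  have s: "s > 0" using x0 by (simp add: s_def)
  have as: "cmod (apply_bcontfun a x) = s" for x
  proof -
    have "(cmod (apply_bcontfun a x))\<^sup>2 = s\<^sup>2"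
      using r[of x] r[of x0] unfolding s_def by (metis of_real_eq_iff)
    then show ?thesis using s by simp
  qed
  define w where "w = complex_of_real (1 / s) *\<^sub>C a"
  have "star w * w = 1"
    unfolding star_mult_self_eq_one_iff using s as by (simp add: w_def bcontfun_apply_simps norm_mult norm_divide)
  moreover have "vmono w n \<in> Fix"
    unfolding w_def vmono_scaleC by (rule subalgebra_scaleC[OF cstar_subalgebra_fixed_points fixd])
  ultimately show ?thesis unfolding continuous_coboundary_iff by blast
qed

subsection \<open>The invariant measure\<close>

abbreviation T :: "'g \<Rightarrow> 'x \<Rightarrow> 'x" where
  "T g \<equiv> induced_homeo (\<theta> g)"

lemma \<theta>_apply: "apply_bcontfun (\<theta> g a) x = apply_bcontfun a (T g x)"
  by (rule induced_homeo_apply[OF compact_X \<theta>_aut])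

lemma T_measurable: "T g \<in> measurable \<mu> borel"
  using borel_measurable_continuous_onI[OF continuous_induced_homeo[OF compact_X \<theta>_aut]]
  by (simp add: measurable_cong_sets[OF sets_\<mu> refl])

text \<open>Invariance of \<open>\<omega>\<^sub>0\<close> is equality of the integrals of continuous
  functions, which determine a finite Borel measure.\<close>

lemma distr_T: "distr \<mu> borel (T g) = \<mu>"
proof (rule finite_measure_eqI_continuous)
  interpret prob_space \<mu> by (rule \<mu>)
  show "finite_measure \<mu>" by (rule finite_measure_axioms)
  show "finite_measure (distr \<mu> borel (T g))"
    using prob_space_distr[OF T_measurable] by (simp add: prob_space_def)
  fix f :: "'x \<Rightarrow> real" assume f: "continuous_on UNIV f"
  define F where "F = Bcontfun (\<lambda>x. complex_of_real (f x))"
  have F: "apply_bcontfun F x = complex_of_real (f x)" for x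
    unfolding F_def by (intro apply_Bcontfun_compact'[OF compact_X] continuous_intros f)
  have "(\<integral>x. f x \<partial>distr \<mu> borel (T g)) = (\<integral>x. f (T g x) \<partial>\<mu>)"
    by (rule integral_distr[OF T_measurable borel_measurable_continuous_onI[OF f]])
  moreover have "complex_of_real (\<integral>x. f (T g x) \<partial>\<mu>) = complex_of_real (\<integral>x. f x \<partial>\<mu>)"
    using \<omega>\<^sub>0_\<theta>[of g F] by (simp add: \<omega>\<^sub>0_eq \<theta>_apply F)
  ultimately show "(\<integral>x. f x \<partial>distr \<mu> borel (T g)) = (\<integral>x. f x \<partial>\<mu>)"
    by (simp only: of_real_eq_iff)
qed (simp_all add: sets_\<mu>)

lemma measurable_\<mu>_iff: "h \<in> borel_measurable \<mu> \<longleftrightarrow> h \<in> borel_measurable borel"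
  by (simp add: measurable_cong_sets[OF sets_\<mu> refl])

lemma integral_T:
  fixes h :: "'x \<Rightarrow> complex"
  assumes "h \<in> borel_measurable \<mu>"
  shows "(\<integral>x. h (T g x) \<partial>\<mu>) = (\<integral>x. h x \<partial>\<mu>)"
  using integral_distr[OF T_measurable, of h g] assms by (simp add: measurable_\<mu>_iff distr_T)

lemma integrable_T:
  fixes h :: "'x \<Rightarrow> complex"
  assumes "integrable \<mu> h"
  shows "integrable \<mu> (\<lambda>x. h (T g x))"
  using integrable_distr[OF T_measurable, of g h] assms by (simp add: distr_T)

lemmas integrable_mult_\<mu> = integrable_mult_bcontfun[OF \<mu> sets_\<mu>]

subsection \<open>The canonical invariant state\<close>

definition \<omega> :: "'b \<Rightarrow> complex" where
  "\<omega> x = \<omega>\<^sub>0 (coeff0 x)"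

lemma aut_power_hom: "star_hom (aut_power \<alpha> n)"
  by (rule star_automorphism_star_hom[OF star_automorphism_aut_power[OF \<alpha>]])

lemma coeff_0: "coeff 0 x = coeff0 x"
  by (simp add: coeff_def unitary_power_0[OF V_unitary])

lemma bounded_linear_\<omega>: "bounded_linear \<omega>"
  unfolding \<omega>_def
  by (rule bounded_linear_compose[OF bounded_linear_state[OF \<omega>\<^sub>0_state] bounded_linear_coeff0])

lemma \<omega>_vmono: "\<omega> (vmono a n) = (if n = 0 then \<omega>\<^sub>0 a else 0)"
  by (simp add: \<omega>_def coeff0_vmono state_zero[OF cstar_subalgebra_UNIV \<omega>\<^sub>0_state])

lemma star_vmono_mult:
  "star (vmono a m) * vmono b n = vmono (aut_power \<alpha> (- m) (star a * b)) (n - m)"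
  by (simp add: vmono_star vmono_mult star_hom_mult[OF aut_power_hom])

text \<open>Distinct degrees are orthogonal for \<omega>, and invariance of
  \<open>\<omega>\<^sub>0\<close> under \<alpha> removes the twist from the diagonal terms.
  Positivity of \<omega> follows from this by density.\<close>

lemma \<omega>_star_mult_psum:
  assumes "f \<in> finite_sums"
  shows "\<omega> (star (psum \<iota> V f) * psum \<iota> V f) = (\<Sum>n | f n \<noteq> 0. \<omega>\<^sub>0 (star (f n) * f n))"
proof -
  define F where "F = {n. f n \<noteq> 0}"
  have F: "finite F" using assms by (simp add: F_def finite_sums_def)
  have lin: "\<omega> (sum g A) = (\<Sum>i\<in>A. \<omega> (g i))" for g and A :: "int set"
    by (rule linear_sum[OF bounded_linear.linear[OF bounded_linear_\<omega>]])
  have "\<omega> (star (psum \<iota> V f) * psum \<iota> V f) = (\<Sum>m\<in>F. \<Sum>n\<in>F. \<omega> (star (vmono (f m) m) * vmono (f n) n))"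
    by (simp add: psum_eq_sum_vmono F_def star_sum sum_product lin)
  also have "\<dots> = (\<Sum>m\<in>F. \<Sum>n\<in>F. if n = m then \<omega>\<^sub>0 (star (f m) * f m) else 0)"
    by (intro sum.cong refl) (auto simp: star_vmono_mult \<omega>_vmono \<omega>\<^sub>0_aut_power)
  finally show ?thesis using F by (simp add: F_def)
qed

lemma \<omega>_state: "state_on UNIV \<omega>"
  unfolding state_on_def
proof (intro conjI ballI allI)
  fix x y k
  show "\<omega> (x + y) = \<omega> x + \<omega> y"
    by (simp add: \<omega>_def coeff0 state_add[OF cstar_subalgebra_UNIV \<omega>\<^sub>0_state])
  show "\<omega> (k *\<^sub>C x) = k * \<omega> x"
    by (simp add: \<omega>_def coeff0 state_scaleC[OF cstar_subalgebra_UNIV \<omega>\<^sub>0_state])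
  show "\<omega> 1 = 1"
    by (subst one_eq_vmono) (simp add: \<omega>_vmono state_one[OF cstar_subalgebra_UNIV \<omega>\<^sub>0_state])
  obtain f where f: "\<And>k::nat. f k \<in> finite_sums" "(\<lambda>k. psum \<iota> V (f k)) \<longlonglongrightarrow> x"
    using approx_finite_sums by metis
  have lim: "(\<lambda>k. \<omega> (star (psum \<iota> V (f k)) * psum \<iota> V (f k))) \<longlonglongrightarrow> \<omega> (star x * x)"
    by (intro bounded_linear.tendsto[OF bounded_linear_\<omega>] tendsto_mult f
        bounded_linear.tendsto[OF bounded_linear_star])
  have Im: "Im (\<omega> (star (psum \<iota> V (f k)) * psum \<iota> V (f k))) = 0"
    and Re: "0 \<le> Re (\<omega> (star (psum \<iota> V (f k)) * psum \<iota> V (f k)))" for k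
    unfolding \<omega>_star_mult_psum[OF f(1)]
    by (simp_all add: Im_sum Re_sum state_Im[OF cstar_subalgebra_UNIV \<omega>\<^sub>0_state]
        state_Re[OF cstar_subalgebra_UNIV \<omega>\<^sub>0_state] sum_nonneg)
  show "Im (\<omega> (star x * x)) = 0"
    using LIMSEQ_unique[OF tendsto_Im[OF lim]] by (simp add: Im)
  show "0 \<le> Re (\<omega> (star x * x))"
    by (rule LIMSEQ_le_const[OF tendsto_Re[OF lim]]) (use Re in auto)
qed

lemma \<omega>_\<Phi>: "\<omega> (\<Phi> g x) = \<omega> x"
  using coeff_\<Phi>[of 0 g x] by (simp add: \<omega>_def coeff_0 cocycle_power_0 \<omega>\<^sub>0_\<theta>)

lemma invariant_state_\<omega>: "invariant_state \<Phi> \<omega>"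
  using \<omega>_state \<omega>_\<Phi> by (auto simp: invariant_state_def)

lemma coeff0_\<iota>_mult: "coeff0 (\<iota> a * x) = a * coeff0 x"
proof (rule bounded_linear_eqI[of "\<lambda>x. coeff0 (\<iota> a * x)" "\<lambda>x. a * coeff0 x"])
  show "coeff0 (\<iota> a * vmono b n) = a * coeff0 (vmono b n)" for b n
    by (simp add: \<iota>_eq_vmono vmono_mult coeff0_vmono aut_power_0[OF \<alpha>])
qed (intro bounded_linear_compose[OF bounded_linear_coeff0 bounded_linear_mult_right]
    bounded_linear_compose[OF bounded_linear_mult_right bounded_linear_coeff0])+

lemma coeff0_mult_\<iota>: "coeff0 (x * \<iota> a) = coeff0 x * a"
proof (rule bounded_linear_eqI[of "\<lambda>x. coeff0 (x * \<iota> a)" "\<lambda>x. coeff0 x * a"])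
  show "coeff0 (vmono b n * \<iota> a) = coeff0 (vmono b n) * a" for b n
    by (simp add: \<iota>_eq_vmono vmono_mult coeff0_vmono aut_power_0[OF \<alpha>])
qed (intro bounded_linear_compose[OF bounded_linear_coeff0 bounded_linear_mult_left]
    bounded_linear_compose[OF bounded_linear_mult_left bounded_linear_coeff0])+

text \<open>Conjugation by \<open>V^n\<close> acts on the zeroth coefficient as
  \<open>\<alpha>^n\<close>, under which \<open>\<omega>\<^sub>0\<close> is invariant.\<close>

lemma \<omega>_conjugate: "\<omega> (unitary_power V n * x * unitary_power V (- n)) = \<omega> x"
proof -
  have "coeff0 (unitary_power V n * x * unitary_power V (- n)) = aut_power \<alpha> n (coeff0 x)"
  proof (rule bounded_linear_eqI[of "\<lambda>x. coeff0 (unitary_power V n * x * unitary_power V (- n))"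
        "\<lambda>x. aut_power \<alpha> n (coeff0 x)"])
    show "bounded_linear (\<lambda>x. coeff0 (unitary_power V n * x * unitary_power V (- n)))"
      by (rule bounded_linear_compose[OF bounded_linear_coeff0
            bounded_linear_compose[OF bounded_linear_mult_left bounded_linear_mult_right]])
    show "bounded_linear (\<lambda>x. aut_power \<alpha> n (coeff0 x))"
      by (rule bounded_linear_compose[OF bounded_linear_star_hom[OF aut_power_hom] bounded_linear_coeff0])
    show "coeff0 (unitary_power V n * vmono a m * unitary_power V (- n)) = aut_power \<alpha> n (coeff0 (vmono a m))"
      for a m
      by (simp add: power_eq_vmono vmono_mult coeff0_vmono star_hom_one[OF aut_power_hom]
          star_hom_zero[OF aut_power_hom])
  qed
  then show ?thesis by (simp add: \<omega>_def \<omega>\<^sub>0_aut_power)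
qed

subsection \<open>Unique ergodicity makes measurable coboundaries continuous\<close>

text \<open>Cauchy--Schwarz for \<open>\<omega>\<close> applied to \<open>y v\<^sup>*\<close> and \<open>y V\<^sup>-\<^sup>n\<close>.\<close>

lemma \<omega>\<^sub>0_coeff_le:
  assumes v: "\<And>x. cmod (apply_bcontfun v x) \<le> 1"
  shows "cmod (\<omega>\<^sub>0 (v * coeff n (star y * y))) \<le> Re (\<omega> (star y * y))"
proof -
  note st = cstar_subalgebra_UNIV \<omega>_state
  note st0 = cstar_subalgebra_UNIV \<omega>\<^sub>0_state
  define P where "P = Re (\<omega> (star y * y))"
  have P0: "0 \<le> P" unfolding P_def by (rule state_Re[OF st]) simp
  \<comment> \<open>The complement of \<open>v\<close>: positivity at
    \<open>y * \<iota> (star d)\<close> bounds the value at \<open>y * \<iota> (star v)\<close> by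
    the one at \<open>y\<close>.\<close>
  define d where "d = Bcontfun (\<lambda>x. complex_of_real (sqrt (1 - (cmod (apply_bcontfun v x))\<^sup>2)))"
  have d: "apply_bcontfun d x = complex_of_real (sqrt (1 - (cmod (apply_bcontfun v x))\<^sup>2))" for x
    unfolding d_def by (intro apply_Bcontfun_compact'[OF compact_X] continuous_intros)
  have dd: "d * star d = 1 - v * star v"
  proof (rule bcontfun_eqI)
    fix x
    have "(cmod (apply_bcontfun v x))\<^sup>2 \<le> 1" using v[of x] by (simp add: power_le_one)
    moreover have "apply_bcontfun v x * cnj (apply_bcontfun v x) = of_real ((cmod (apply_bcontfun v x))\<^sup>2)"
      by (simp add: complex_norm_square del: of_real_power)
    ultimately show "apply_bcontfun (d * star d) x = apply_bcontfun (1 - v * star v) x"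
      by (simp add: bcontfun_apply_simps d of_real_mult[symmetric] del: of_real_mult of_real_power)
  qed
  have conj: "\<omega> (star (y * \<iota> (star a)) * (y * \<iota> (star a))) = \<omega>\<^sub>0 (a * star a * coeff0 (star y * y))" for a
  proof -
    have e: "star (y * \<iota> (star a)) * (y * \<iota> (star a)) = \<iota> a * (star y * y) * \<iota> (star a)"
      by (simp add: star_mult \<iota>_simps(4)[symmetric] star_star mult.assoc)
    have "a * z * star a = a * star a * z" for z
      using bcontfun_mult_commute[of z "star a"] by (simp add: mult.assoc)
    then show ?thesis unfolding \<omega>_def e coeff0_mult_\<iota> coeff0_\<iota>_mult by simp
  qed
  have "0 \<le> Re (\<omega> (star (y * \<iota> (star d)) * (y * \<iota> (star d))))" by (rule state_Re[OF st]) simp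
  also have "\<dots> = P - Re (\<omega> (star (y * \<iota> (star v)) * (y * \<iota> (star v))))"
    by (simp only: conj dd left_diff_distrib mult_1_left state_diff[OF st0 UNIV_I UNIV_I] minus_complex.sel)
      (simp only: P_def \<omega>_def)
  finally have le: "Re (\<omega> (star (y * \<iota> (star v)) * (y * \<iota> (star v)))) \<le> P" by simp
  have yV: "\<omega> (star (y * unitary_power V (- n)) * (y * unitary_power V (- n))) = \<omega> (star y * y)"
    using \<omega>_conjugate[of n "star y * y"]
    by (simp add: star_mult star_unitary_power[OF V_unitary] mult.assoc)
  have "star (y * \<iota> (star v)) * (y * unitary_power V (- n)) = \<iota> v * (star y * y * unitary_power V (- n))"
    by (simp add: star_mult \<iota>_simps star_star mult.assoc)
  then have "\<omega>\<^sub>0 (v * coeff n (star y * y)) = \<omega> (star (y * \<iota> (star v)) * (y * unitary_power V (- n)))"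
    by (simp add: \<omega>_def coeff0_\<iota>_mult coeff_def)
  then have "(cmod (\<omega>\<^sub>0 (v * coeff n (star y * y))))\<^sup>2 \<le>
      P * Re (\<omega> (star (y * \<iota> (star v)) * (y * \<iota> (star v))))"
    using state_Cauchy_Schwarz[OF st UNIV_I UNIV_I, of "y * \<iota> (star v)" "y * unitary_power V (- n)"]
    by (simp add: yV P_def)
  also have "\<dots> \<le> P * P" by (intro mult_left_mono le P0)
  finally show ?thesis using P0 power2_le_imp_le[of _ P] by (simp add: P_def power2_eq_square)
qed

text \<open>L1 duality: the coefficient \<open>F\<close> is tested against
  \<open>cnj F / (cmod F + e)\<close>. The \<open>e\<close> keeps this approximate phase continuous
  at the zeros of \<open>F\<close> and costs at most \<open>e\<close> in the integral.\<close>

lemma integral_norm_coeff_le: "(\<integral>x. cmod (apply_bcontfun (coeff n (star y * y)) x) \<partial>\<mu>) \<le> Re (\<omega> (star y * y))"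
proof (rule field_le_epsilon)
  interpret prob_space \<mu> by (rule \<mu>)
  fix e :: real assume e: "e > 0"
  define F where "F = coeff n (star y * y)"
  define r where "r x = cmod (apply_bcontfun F x)" for x
  have rn: "r x \<ge> 0" for x by (simp add: r_def)
  have r0: "r x \<ge> 0" "r x + e \<noteq> 0" "r x + e > 0" for x using rn[of x] e by linarith+
  define v where "v = Bcontfun (\<lambda>x. cnj (apply_bcontfun F x) / complex_of_real (r x + e))"
  have v: "apply_bcontfun v x = cnj (apply_bcontfun F x) / complex_of_real (r x + e)" for x
    unfolding v_def
  proof (rule apply_Bcontfun_compact'[OF compact_X])
    show "continuous_on UNIV (\<lambda>x. cnj (apply_bcontfun F x) / complex_of_real (r x + e))"
      using r0 unfolding r_def of_real_eq_0_iff[symmetric, where 'a = complex]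
      by (intro continuous_intros continuous_on_apply_bcontfun) (auto simp del: of_real_add)
  qed
  have v1: "cmod (apply_bcontfun v x) \<le> 1" for x
    unfolding v norm_divide norm_of_real using r0[of x] e by (simp add: r_def)
  have vF: "apply_bcontfun (v * F) x = complex_of_real ((r x)\<^sup>2 / (r x + e))" for x
    by (simp add: times_bcontfun.rep_eq v r_def complex_norm_square mult.commute del: of_real_power)
  have i: "integrable \<mu> r" unfolding r_def by (intro integrable_norm integrable_bcontfun[OF \<mu> sets_\<mu>])
  have i2: "integrable \<mu> (\<lambda>x. (r x)\<^sup>2 / (r x + e))"
    using integrable_Re[OF integrable_bcontfun[OF \<mu> sets_\<mu>, of "v * F"]] by (simp only: vF Re_complex_of_real)
  have "(\<integral>x. r x \<partial>\<mu>) \<le> (\<integral>x. (r x)\<^sup>2 / (r x + e) + e \<partial>\<mu>)"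
  proof (rule integral_mono[OF i])
    show "r x \<le> (r x)\<^sup>2 / (r x + e) + e" for x
      using r0[of x] e by (simp add: field_simps power2_eq_square)
  qed (use i2 in simp)
  also have "\<dots> = (\<integral>x. (r x)\<^sup>2 / (r x + e) \<partial>\<mu>) + e"
    using i2 by (simp add: prob_space)
  also have "(\<integral>x. (r x)\<^sup>2 / (r x + e) \<partial>\<mu>) = Re (\<omega>\<^sub>0 (v * F))"
    by (simp only: \<omega>\<^sub>0_eq vF integral_complex_of_real Re_complex_of_real)
  also have "\<dots> \<le> Re (\<omega> (star y * y))"
    using complex_Re_le_cmod[of "\<omega>\<^sub>0 (v * F)"] \<omega>\<^sub>0_coeff_le[OF v1, of n y] by (simp add: F_def)
  finally show "(\<integral>x. cmod (apply_bcontfun (coeff n (star y * y)) x) \<partial>\<mu>) \<le> Re (\<omega> (star y * y)) + e"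
    by (simp add: r_def F_def)
qed

text \<open>\<open>\<psi>\<close> below is the vector state of \<open>(1 + w V\<^sup>n) / sqrt 2\<close> in the representation of \<open>\<omega>\<close>, where
  \<open>w V\<^sup>n\<close> lies only in the generated von Neumann algebra.\<close>

lemma measurable_coboundary_continuous:
  assumes ue: "uniquely_ergodic_wrt_fixed_points \<Phi>"
    and mc: "measurable_coboundary \<theta> \<mu> (c n)"
  shows "continuous_coboundary \<theta> (c n)"
proof (cases "n = 0")
  \<comment> \<open>Degree 0 is separate because the perturbation of \<omega> used below is
    normalised only if the \<open>n\<close>-th coefficient of 1 vanishes.\<close>
  case True
  have "vmono 1 0 \<in> Fix" by (simp add: vmono_fixed_iff \<theta>_simps cocycle_power_0)
  then show ?thesis unfolding continuous_coboundary_iff True by (intro exI[of _ 1]) simp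
next
  case n: False
  interpret prob_space \<mu> by (rule \<mu>)
  note st = cstar_subalgebra_UNIV \<omega>_state
  obtain w :: "'x \<Rightarrow> complex" where w: "w \<in> borel_measurable \<mu>" "AE x in \<mu>. cmod (w x) = 1"
    "\<And>g. AE x in \<mu>. apply_bcontfun (c n g) x = cnj (w (T g x)) * w x"
    using mc unfolding measurable_coboundary_def by blast
  \<comment> \<open>After conjugation the coboundary equation reads
    \<open>h (T g x) = c n g x * h x\<close>, the relation that makes \<open>L\<close>
    invariant.\<close>
  define h where "h x = cnj (w x)" for x
  have hm: "h \<in> borel_measurable \<mu>" unfolding h_def
    by (rule measurable_compose[OF w(1) borel_measurable_continuous_onI[OF linear_continuous_on[OF bounded_linear_cnj]]])
  have h1: "AE x in \<mu>. cmod (h x) = 1" using w(2) by eventually_elim (simp add: h_def)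
  have hi: "integrable \<mu> h"
    by (rule Bochner_Integration.integrable_bound[of _ "\<lambda>_. 1 :: real"]) (use hm h1 in auto)
  define L where "L x = (\<integral>t. apply_bcontfun (coeff n x) t * h t \<partial>\<mu>)" for x
  have Ladd: "L (x + y) = L x + L y" for x y
    unfolding L_def linear_add[OF bounded_linear.linear[OF bounded_linear_coeff]] plus_bcontfun.rep_eq
      distrib_right by (intro Bochner_Integration.integral_add integrable_mult_\<mu> hi)
  have Lscale: "L (k *\<^sub>C x) = k * L x" for k x
    by (simp add: L_def coeff_def mult_scaleC_left coeff0 bcontfun_apply_simps mult.assoc)
  have LP: "cmod (L (star y * y)) \<le> Re (\<omega> (star y * y))" for y
  proof -
    define F where "F = coeff n (star y * y)"
    have "cmod (L (star y * y)) \<le> (\<integral>t. cmod (apply_bcontfun F t * h t) \<partial>\<mu>)"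
      unfolding L_def F_def by (rule integral_norm_bound)
    also have "\<dots> = (\<integral>t. cmod (apply_bcontfun F t) \<partial>\<mu>)"
    proof (rule integral_cong_AE)
      show "AE t in \<mu>. cmod (apply_bcontfun F t * h t) = cmod (apply_bcontfun F t)"
        using h1 by eventually_elim (simp add: norm_mult)
    qed (use integrable_mult_\<mu>[OF hi, of F] integrable_bcontfun[OF \<mu> sets_\<mu>, of F] in auto)
    also have "\<dots> \<le> Re (\<omega> (star y * y))" unfolding F_def by (rule integral_norm_coeff_le)
    finally show ?thesis .
  qed
  have L\<Phi>: "L (\<Phi> g x) = L x" for g x
  proof -
    define F where "F = coeff n x"
    have "L (\<Phi> g x) = (\<integral>t. apply_bcontfun F (T g t) * h (T g t) \<partial>\<mu>)"
      unfolding L_def coeff_\<Phi> F_def[symmetric]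
    proof (rule integral_cong_AE)
      show "AE t in \<mu>. apply_bcontfun (\<theta> g F * c n g) t * h t = apply_bcontfun F (T g t) * h (T g t)"
        using w(2) w(3)[of g]
      proof eventually_elim
        case (elim t)
        have "w t * cnj (w t) = 1" using elim(1) by (simp add: complex_norm_square[symmetric])
        then show ?case unfolding times_bcontfun.rep_eq elim(2) \<theta>_apply h_def by (simp add: mult.assoc)
      qed
      show "(\<lambda>t. apply_bcontfun F (T g t) * h (T g t)) \<in> borel_measurable \<mu>"
        using integrable_T[OF integrable_mult_\<mu>[OF hi, of F], of g] by simp
    qed (use integrable_mult_\<mu>[OF hi] in simp)
    also have "\<dots> = (\<integral>t. apply_bcontfun F t * h t \<partial>\<mu>)"
      by (rule integral_T) (use integrable_mult_\<mu>[OF hi] in simp)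
    finally show ?thesis by (simp add: L_def F_def)
  qed
  \<comment> \<open>Adding the adjoint of \<open>L\<close> makes the perturbation real on
    \<open>star x * x\<close>; with the factor one half it equals the real part of
    \<open>L (star x * x)\<close>, which \<open>LP\<close> bounds by \<omega>.\<close>
  define \<psi> where "\<psi> x = \<omega> x + (L x + cnj (L (star x))) / 2" for x
  have "state_on UNIV \<psi>"
    unfolding state_on_def
  proof (intro conjI ballI allI)
    fix x y k
    show "\<psi> (x + y) = \<psi> x + \<psi> y"
      by (simp add: \<psi>_def state_add[OF st] Ladd star_add add_divide_distrib)
    show "\<psi> (k *\<^sub>C x) = k * \<psi> x"
      by (simp add: \<psi>_def state_scaleC[OF st] Lscale star_scaleC algebra_simps)
    have s: "\<psi> (star x * x) = \<omega> (star x * x) + complex_of_real (Re (L (star x * x)))"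
      by (simp add: \<psi>_def star_mult star_star complex_eq_iff)
    show "Im (\<psi> (star x * x)) = 0" by (simp add: s state_Im[OF st])
    show "0 \<le> Re (\<psi> (star x * x))"
      using LP[of x] abs_Re_le_cmod[of "L (star x * x)"] by (simp add: s)
    have "coeff n 1 = 0" using coeff_vmono[of n 1 0] n by (simp add: one_eq_vmono[symmetric])
    then have "L 1 = 0" by (simp add: L_def zero_bcontfun.rep_eq)
    then show "\<psi> 1 = 1" by (simp add: \<psi>_def state_one[OF st])
  qed
  then have inv: "invariant_state \<Phi> \<psi>"
    by (auto simp: invariant_state_def \<psi>_def \<omega>_\<Phi> L\<Phi> star_hom_star[OF \<Phi>_hom, symmetric])
  have "\<exists>b\<in>Fix. \<psi> b \<noteq> \<omega> b"
  proof (rule ccontr)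
    assume "\<not> ?thesis"
    then have agree: "\<forall>b\<in>Fix. \<psi> b = \<omega> b" by blast
    have "state_on Fix \<omega>" by (rule state_on_subset[OF \<omega>_state])
    then have "\<exists>!\<psi>. invariant_state \<Phi> \<psi> \<and> (\<forall>b\<in>Fix. \<psi> b = \<omega> b)"
      using ue unfolding uniquely_ergodic_wrt_fixed_points_def by blast
    then have "\<psi> = \<omega>" using inv agree invariant_state_\<omega> by blast
    moreover have "\<psi> (vmono a n) = \<omega> (vmono a n) + (\<integral>t. apply_bcontfun a t * h t \<partial>\<mu>) / 2" for a
    proof -
      have "n \<noteq> - n" using n by simp
      then have "coeff n (star (vmono a n)) = 0" by (simp add: vmono_star coeff_vmono)
      then show ?thesis by (simp add: \<psi>_def L_def coeff_vmono zero_bcontfun.rep_eq)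
    qed
    ultimately have "(\<integral>t. apply_bcontfun a t * h t \<partial>\<mu>) = 0" for a by simp
    then have "AE t in \<mu>. h t = 0" by (rule AE_zero_if_integral_zero[OF \<mu> sets_\<mu> hi])
    with h1 have "AE t in \<mu>. False" by eventually_elim simp
    then show False by simp
  qed
  then obtain b where b: "b \<in> Fix" "\<psi> b \<noteq> \<omega> b" by blast
  have L0: "L x = 0" if "coeff n x = 0" for x using that by (simp add: L_def zero_bcontfun.rep_eq)
  have sb: "star b \<in> Fix"
    by (rule subalgebra_star[OF cstar_subalgebra_fixed_points b(1)])
  \<comment> \<open>The difference of \<psi> and \<omega> at \<open>b\<close> depends only on these
    two coefficients, and both \<open>b\<close> and its adjoint are fixed.\<close>
  have "coeff n b \<noteq> 0 \<or> coeff n (star b) \<noteq> 0"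
    using b(2) L0[of b] L0[of "star b"] by (auto simp: \<psi>_def)
  then show ?thesis
    using fixed_vmono_nonzero[OF vmono_coeff_fixed[OF b(1)]] fixed_vmono_nonzero[OF vmono_coeff_fixed[OF sb]]
    by blast
qed

subsection \<open>Invariant states and measurable coboundaries\<close>

lemma invariant_state_nonzero_coboundary:
  assumes inv: "invariant_state \<Phi> \<psi>" and nz: "\<psi> (vmono a0 n) \<noteq> 0"
  shows "measurable_coboundary \<theta> \<mu> (c n)"
proof -
  interpret prob_space \<mu> by (rule \<mu>)
  note st0 = cstar_subalgebra_UNIV \<omega>\<^sub>0_state
  have s: "state_on UNIV \<psi>" and i: "\<psi> (\<Phi> g x) = \<psi> x" for g x
    using inv unfolding invariant_state_def by (simp_all, metis comp_apply)
  note st = cstar_subalgebra_UNIV s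
  define l where "l b = \<psi> (vmono b n)" for b
  have ladd: "l (b + d) = l b + l d" for b d
    by (simp add: l_def vmono_def \<iota>_simps distrib_right state_add[OF st])
  have lscale: "l (k *\<^sub>C b) = k * l b" for k b
    by (simp add: l_def vmono_scaleC state_scaleC[OF st])
  \<comment> \<open>Cauchy-Schwarz pairs \<open>\<iota> (star b)\<close> with the unitary
    \<open>V^n\<close>, for which the second factor is 1; the first is computed by
    \<open>\<omega>\<^sub>0\<close> since \<psi> is invariant.\<close>
  have lbound: "(cmod (l b))\<^sup>2 \<le> Re (\<omega>\<^sub>0 (star b * b))" for b
  proof -
    have V: "star (unitary_power V n) * unitary_power V n = 1"
      using unitary_unitary_power[OF V_unitary] by (simp add: unitary_def)
    have b: "\<psi> (star (\<iota> (star b)) * \<iota> (star b)) = \<omega>\<^sub>0 (star b * b)"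
    proof -
      have "star (\<iota> (star b)) * \<iota> (star b) = \<iota> (star b * b)"
        by (simp only: \<iota>_simps(3,4)[symmetric] star_star bcontfun_mult_commute)
      then show ?thesis by (simp only: invariant_state_\<iota>[OF inv])
    qed
    have "l b = \<psi> (star (\<iota> (star b)) * unitary_power V n)"
      by (simp only: l_def vmono_def \<iota>_simps(4)[symmetric] star_star)
    then show ?thesis
      using state_Cauchy_Schwarz[OF st UNIV_I UNIV_I, of "\<iota> (star b)" "unitary_power V n"]
      by (simp only: V b state_one[OF st]) simp
  qed
  obtain h where h: "integrable \<mu> h" "\<And>b. l b = (\<integral>x. apply_bcontfun b x * h x \<partial>\<mu>)"
    using L2_bounded_functional_density[OF \<mu> sets_\<mu> \<omega>\<^sub>0_state \<omega>\<^sub>0_eq ladd lscale lbound] by blast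
  have hT: "AE x in \<mu>. h (T g x) = apply_bcontfun (c n g) x * h x" for g
  proof -
    define k where "k x = apply_bcontfun (c n g) x * h x - h (T g x)" for x
    have ki: "integrable \<mu> k"
      unfolding k_def by (intro Bochner_Integration.integrable_diff integrable_mult_\<mu> integrable_T h)
    have "(\<integral>x. apply_bcontfun b x * k x \<partial>\<mu>) = 0" for b
    proof -
      \<comment> \<open>Every test function is \<open>\<theta> g d\<close>, so invariance of \<psi>
        at the monomials \<open>d V^n\<close> tests the relation for \<open>h\<close> against all of
        C(X).\<close>
      define d where "d = \<theta> (- g) b"
      have b: "b = \<theta> g d" by (simp add: d_def \<theta>_inverse)
      have i1: "integrable \<mu> (\<lambda>x. apply_bcontfun (b * c n g) x * h x)"
        by (rule integrable_mult_\<mu>[OF h(1)])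
      have i2: "integrable \<mu> (\<lambda>x. apply_bcontfun d (T g x) * h (T g x))"
        by (rule integrable_T[OF integrable_mult_\<mu>[OF h(1)]])
      have "(\<integral>x. apply_bcontfun (b * c n g) x * h x \<partial>\<mu>) = l d"
        using i[of g "vmono d n"] by (simp add: h(2)[symmetric] l_def \<Phi>_vmono b)
      also have "\<dots> = (\<integral>x. apply_bcontfun d (T g x) * h (T g x) \<partial>\<mu>)"
        unfolding h(2) by (rule integral_T[symmetric]) (use integrable_mult_\<mu>[OF h(1)] in simp)
      finally have "(\<integral>x. apply_bcontfun (b * c n g) x * h x - apply_bcontfun d (T g x) * h (T g x) \<partial>\<mu>) = 0"
        using i1 i2 by simp
      moreover have "apply_bcontfun b x * k x =
          apply_bcontfun (b * c n g) x * h x - apply_bcontfun d (T g x) * h (T g x)" for x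
        by (simp add: k_def b \<theta>_apply times_bcontfun.rep_eq algebra_simps)
      ultimately show ?thesis by simp
    qed
    then have "AE x in \<mu>. k x = 0" by (rule AE_zero_if_integral_zero[OF \<mu> sets_\<mu> ki])
    then show ?thesis by eventually_elim (simp add: k_def)
  qed
  define I where "I = (\<integral>x. cmod (h x) \<partial>\<mu>)"
  have I0: "I > 0"
  proof (rule ccontr)
    assume "\<not> ?thesis"
    moreover have "I \<ge> 0" unfolding I_def by simp
    ultimately have "I = 0" by simp
    then have "AE x in \<mu>. cmod (h x) = 0"
      unfolding I_def using h(1) by (subst (asm) integral_nonneg_eq_0_iff_AE) auto
    then have ae: "AE x in \<mu>. apply_bcontfun a0 x * h x = 0" by eventually_elim simp
    have "l a0 = 0" unfolding h(2)
      using integral_cong_AE[of "\<lambda>x. apply_bcontfun a0 x * h x" \<mu> "\<lambda>_. 0"] ae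
        integrable_mult_\<mu>[OF h(1), of a0] by simp
    then show False using nz by (simp add: l_def)
  qed
  \<comment> \<open>The density of a probability measure that is invariant because
    \<open>c n g\<close> has modulus 1. Unique ergodicity identifies it with the density 1.\<close>
  define p where "p x = complex_of_real (cmod (h x) / I)" for x
  have pi: "integrable \<mu> p" unfolding p_def using h(1) by simp
  define \<phi> where "\<phi> b = (\<integral>x. apply_bcontfun b x * p x \<partial>\<mu>)" for b
  have "state_on UNIV \<phi>"
    unfolding state_on_def
  proof (intro conjI ballI allI)
    fix b d k
    show "\<phi> (b + d) = \<phi> b + \<phi> d"
      unfolding \<phi>_def plus_bcontfun.rep_eq distrib_right
      by (intro Bochner_Integration.integral_add integrable_mult_\<mu> pi)
    show "\<phi> (k *\<^sub>C b) = k * \<phi> b"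
      by (simp add: \<phi>_def bcontfun_apply_simps mult.assoc)
    have "\<phi> (star b * b) = complex_of_real (\<integral>x. (cmod (apply_bcontfun b x))\<^sup>2 * (cmod (h x) / I) \<partial>\<mu>)"
      unfolding \<phi>_def apply_star_mult_self p_def of_real_mult[symmetric] by (rule integral_complex_of_real)
    moreover have "0 \<le> (\<integral>x. (cmod (apply_bcontfun b x))\<^sup>2 * (cmod (h x) / I) \<partial>\<mu>)"
      using I0 by (intro integral_nonneg_AE) simp
    ultimately show "Im (\<phi> (star b * b)) = 0" "0 \<le> Re (\<phi> (star b * b))" by simp_all
    have "\<phi> 1 = complex_of_real (I / I)"
      unfolding \<phi>_def p_def by (simp add: one_bcontfun.rep_eq I_def)
    then show "\<phi> 1 = 1" using I0 by simp
  qed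
  moreover have "\<phi> (\<theta> g b) = \<phi> b" for g b
  proof -
    have "\<phi> (\<theta> g b) = (\<integral>x. apply_bcontfun b (T g x) * p (T g x) \<partial>\<mu>)"
      unfolding \<phi>_def
    proof (rule integral_cong_AE)
      show "AE x in \<mu>. apply_bcontfun (\<theta> g b) x * p x = apply_bcontfun b (T g x) * p (T g x)"
        using hT[of g] by eventually_elim (simp add: p_def \<theta>_apply norm_mult cmod_c)
      show "(\<lambda>x. apply_bcontfun b (T g x) * p (T g x)) \<in> borel_measurable \<mu>"
        using integrable_T[OF integrable_mult_\<mu>[OF pi]] by simp
    qed (use integrable_mult_\<mu>[OF pi] in simp)
    also have "\<dots> = \<phi> b"
      unfolding \<phi>_def by (rule integral_T) (use integrable_mult_\<mu>[OF pi] in simp)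
    finally show ?thesis .
  qed
  ultimately have "invariant_state \<theta> \<phi>" by (auto simp: invariant_state_def)
  then have \<phi>: "\<phi> b = \<omega>\<^sub>0 b" for b by (rule unique_state)
  have pi1: "integrable \<mu> (\<lambda>x. p x - 1)" using pi by simp
  have "(\<integral>x. apply_bcontfun b x * (p x - 1) \<partial>\<mu>) = 0" for b
  proof -
    have "(\<integral>x. apply_bcontfun b x * (p x - 1) \<partial>\<mu>) = \<phi> b - \<omega>\<^sub>0 b"
      unfolding \<phi>_def \<omega>\<^sub>0_eq right_diff_distrib mult_1_right
      by (intro Bochner_Integration.integral_diff integrable_mult_\<mu> pi integrable_bcontfun[OF \<mu> sets_\<mu>])
    then show ?thesis by (simp add: \<phi>)
  qed
  then have "AE x in \<mu>. p x - 1 = 0" by (rule AE_zero_if_integral_zero[OF \<mu> sets_\<mu> pi1])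
  then have hI: "AE x in \<mu>. cmod (h x) = I"
  proof eventually_elim
    case (elim x)
    then have "complex_of_real (cmod (h x) / I) = 1" by (simp add: p_def)
    then have "cmod (h x) / I = 1" by (metis of_real_eq_1_iff)
    then show ?case using I0 by simp
  qed
  \<comment> \<open>Under \<open>T g\<close> the function \<open>h\<close> is multiplied by
    \<open>c n g\<close>, while a coboundary carries the conjugate at \<open>T g x\<close>; hence
    the conjugate here. Division by \<open>I\<close> gives modulus 1.\<close>
  define w where "w x = cnj (h x) / complex_of_real I" for x
  have "w \<in> borel_measurable \<mu>"
  proof -
    have "h \<in> borel_measurable \<mu>" using h(1) by simp
    then have "(\<lambda>x. cnj (h x)) \<in> borel_measurable \<mu>"
      by (rule measurable_compose[OF _ borel_measurable_continuous_onI[OF linear_continuous_on[OF bounded_linear_cnj]]])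
    then show ?thesis unfolding w_def by (rule borel_measurable_divide) simp
  qed
  moreover have "AE x in \<mu>. cmod (w x) = 1"
    using hI by eventually_elim (use I0 in \<open>simp add: w_def norm_divide\<close>)
  moreover have "AE x in \<mu>. apply_bcontfun (c n g) x = cnj (w (T g x)) * w x" for g
    using hT[of g] hI
  proof eventually_elim
    case (elim x)
    have "h x * cnj (h x) = complex_of_real I * complex_of_real I"
      by (simp add: complex_norm_square[symmetric] elim(2) power2_eq_square)
    then show ?case using I0 by (simp add: w_def elim(1) mult.assoc)
  qed
  ultimately show ?thesis unfolding measurable_coboundary_def by blast
qed

subsection \<open>States determined by the fixed-point algebra\<close>

text \<open>For fixed \<open>x\<close> the normalised functional
  \<open>d \<mapsto> \<psi> (star x * \<iota> d * x)\<close> is an invariant state of C(X), hence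
  \<open>\<omega>\<^sub>0\<close>. If the normalising value is 0, Cauchy-Schwarz makes both sides
  0.\<close>

lemma invariant_state_\<iota>_sandwich:
  assumes inv: "invariant_state \<Phi> \<psi>" and x: "x \<in> Fix"
  shows "\<psi> (star x * (\<iota> b * x)) = \<omega>\<^sub>0 b * \<psi> (star x * x)"
proof -
  have s: "state_on UNIV \<psi>" and i: "\<psi> (\<Phi> g z) = \<psi> z" for g z
    using inv unfolding invariant_state_def by (simp_all, metis comp_apply)
  note st = cstar_subalgebra_UNIV s
  have \<Phi>x: "\<Phi> g x = x" for g using x by (simp add: fixed_points_def)
  define p where "p = Re (\<psi> (star x * x))"
  have pe: "\<psi> (star x * x) = complex_of_real p" by (simp add: p_def complex_eq_iff state_Im[OF st])
  show ?thesis
  proof (cases "p = 0")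
    case True
    have "(cmod (\<psi> (star x * (\<iota> b * x))))\<^sup>2 \<le> Re (\<psi> (star (\<iota> b * x) * (\<iota> b * x))) * p"
      unfolding p_def by (rule state_Cauchy_Schwarz[OF st]) simp_all
    then show ?thesis using True pe by simp
  next
    case False
    then have p: "p > 0" using state_Re[OF st, of x] by (simp add: p_def)
    define \<phi> where "\<phi> d = \<psi> (star x * (\<iota> d * x)) / complex_of_real p" for d
    have "state_on UNIV \<phi>"
      unfolding state_on_def
    proof (intro conjI ballI allI)
      fix d e k
      show "\<phi> (d + e) = \<phi> d + \<phi> e"
        by (simp add: \<phi>_def \<iota>_simps distrib_left distrib_right state_add[OF st] add_divide_distrib)
      show "\<phi> (k *\<^sub>C d) = k * \<phi> d"
        by (simp add: \<phi>_def \<iota>_simps mult_scaleC_left mult_scaleC_right state_scaleC[OF st])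
      have "star x * (\<iota> (star d * d) * x) = star (\<iota> d * x) * (\<iota> d * x)"
        by (simp add: \<iota>_simps star_mult mult.assoc)
      then show "Im (\<phi> (star d * d)) = 0" "0 \<le> Re (\<phi> (star d * d))"
        using p by (simp_all add: \<phi>_def state_Im[OF st] state_Re[OF st])
      show "\<phi> 1 = 1" using p by (simp add: \<phi>_def \<iota>_simps pe)
    qed
    moreover have "\<phi> (\<theta> g d) = \<phi> d" for g d
      using i[of g "star x * (\<iota> d * x)"]
      by (simp add: \<phi>_def star_hom_mult[OF \<Phi>_hom] star_hom_star[OF \<Phi>_hom] \<Phi>x \<Phi>_\<iota>)
    ultimately have "invariant_state \<theta> \<phi>" by (auto simp: invariant_state_def)
    then have "\<phi> b = \<omega>\<^sub>0 b" by (rule unique_state)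
    then show ?thesis using p by (simp add: \<phi>_def pe field_simps)
  qed
qed

text \<open>Polarisation of the sandwich identity between the fixed elements 1 and \<open>y\<close>,
  with the scalars 1 and \<open>\<i>\<close>.\<close>

lemma invariant_state_\<iota>_mult_fixed:
  assumes inv: "invariant_state \<Phi> \<psi>" and y: "y \<in> Fix"
  shows "\<psi> (\<iota> b * y) = \<omega>\<^sub>0 b * \<psi> y"
proof -
  have s: "state_on UNIV \<psi>" using inv by (simp add: invariant_state_def)
  note st = cstar_subalgebra_UNIV s
  note F = cstar_subalgebra_fixed_points
  define E where "E x y = \<psi> (star x * (\<iota> b * y)) - \<omega>\<^sub>0 b * \<psi> (star x * y)" for x y
  have E0: "E x x = 0" if "x \<in> Fix" for x
    using invariant_state_\<iota>_sandwich[OF inv that] by (simp add: E_def)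
  have expand: "E (1 + k *\<^sub>C y) (1 + k *\<^sub>C y) = E 1 1 + k * E 1 y + cnj k * E y 1 + cnj k * k * E y y" for k
    by (simp add: E_def star_add star_scaleC distrib_left distrib_right mult_scaleC_left mult_scaleC_right
        state_add[OF st] state_scaleC[OF st] right_diff_distrib)
  have "k * E 1 y + cnj k * E y 1 = 0" for k
  proof -
    have "E (1 + k *\<^sub>C y) (1 + k *\<^sub>C y) = 0"
      by (intro E0 subalgebra_intros[OF F] y)
    then show ?thesis using E0[OF subalgebra_one[OF F]] E0[OF y] by (simp add: expand)
  qed
  from this[of 1] this[of \<i>] have "E 1 y + E y 1 = 0" "E 1 y - E y 1 = 0"
    by (simp_all add: right_diff_distrib[symmetric])
  then have "E 1 y = 0" by (simp add: add_eq_0_iff)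
  then show ?thesis by (simp add: E_def)
qed

text \<open>The Cesaro means of a fixed element are combinations of fixed monomials and stay in the
  fixed algebra, where \<phi> is norm continuous.\<close>

lemma fixed_agree:
  assumes \<phi>: "state_on Fix \<phi>" and \<psi>: "bounded_linear \<psi>"
    and eq: "\<And>a n. vmono a n \<in> Fix \<Longrightarrow> \<psi> (vmono a n) = \<phi> (vmono a n)"
    and b: "b \<in> Fix"
  shows "\<psi> b = \<phi> b"
proof -
  note F = cstar_subalgebra_fixed_points
  have m: "vmono (coeff n b) n \<in> Fix" for n by (rule vmono_coeff_fixed[OF b])
  have fc: "cesaro N b \<in> Fix" for N
    unfolding cesaro_def by (intro subalgebra_intros[OF F] m)
  have "\<phi> (cesaro N b) = \<psi> (cesaro N b)" for N
  proof -
    have "\<psi> (cesaro N b) = (1 / real N) *\<^sub>R (\<Sum>i<N. \<Sum>j<N. \<psi> (vmono (coeff (int i - int j) b) (int i - int j)))"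
      by (simp only: cesaro_def linear_scale[OF bounded_linear.linear[OF \<psi>]]
          linear_sum[OF bounded_linear.linear[OF \<psi>]])
    moreover have "\<phi> (cesaro N b) = (1 / real N) *\<^sub>R (\<Sum>i<N. \<Sum>j<N. \<phi> (vmono (coeff (int i - int j) b) (int i - int j)))"
      unfolding cesaro_def scaleR_scaleC
      by (simp only: state_scaleC[OF F \<phi>] state_sum[OF F \<phi>] subalgebra_sum[OF F] m scaleC_complex_def)
    ultimately show ?thesis by (simp add: eq[OF m])
  qed
  then have lim: "(\<lambda>N. \<phi> (cesaro N b)) \<longlonglongrightarrow> \<psi> b"
    using bounded_linear.tendsto[OF \<psi> cesaro_tendsto[of b]] by simp
  have "norm (\<phi> (cesaro N b) - \<phi> b) \<le> norm (cesaro N b - b)" for N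
    using state_norm_le[OF F \<phi> subalgebra_diff[OF F fc b], of N] by (simp add: state_diff[OF F \<phi> fc b])
  moreover have "(\<lambda>N. norm (cesaro N b - b)) \<longlonglongrightarrow> 0"
    using tendsto_norm[OF tendsto_diff[OF cesaro_tendsto[of b] tendsto_const[of b]]] by simp
  ultimately have "(\<lambda>N. \<phi> (cesaro N b) - \<phi> b) \<longlonglongrightarrow> 0"
    by (rule Lim_null_comparison[OF always_eventually[OF allI]])
  from LIM_zero_cancel[OF this] show ?thesis using lim LIMSEQ_unique by blast
qed

lemma fixed_function_scalar:
  assumes "vmono a 0 \<in> Fix" shows "a = \<omega>\<^sub>0 a *\<^sub>C 1"
  by (rule fixed_function_eq) (use assms in \<open>simp add: vmono_fixed_iff cocycle_power_0\<close>)

lemma invariant_extension_unique: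
  assumes H: "\<And>n. measurable_coboundary \<theta> \<mu> (c n) \<Longrightarrow> continuous_coboundary \<theta> (c n)"
    and 1: "invariant_state \<Phi> \<psi>\<^sub>1" and 2: "invariant_state \<Phi> \<psi>\<^sub>2"
    and agree: "\<And>b. b \<in> Fix \<Longrightarrow> \<psi>\<^sub>1 b = \<psi>\<^sub>2 b"
  shows "\<psi>\<^sub>1 = \<psi>\<^sub>2"
proof
  fix x
  have s: "state_on UNIV \<psi>\<^sub>1" "state_on UNIV \<psi>\<^sub>2" using 1 2 by (simp_all add: invariant_state_def)
  show "\<psi>\<^sub>1 x = \<psi>\<^sub>2 x"
  proof (rule bounded_linear_eqI[OF bounded_linear_state[OF s(1)] bounded_linear_state[OF s(2)]])
    fix a n
    show "\<psi>\<^sub>1 (vmono a n) = \<psi>\<^sub>2 (vmono a n)"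
    proof (cases "continuous_coboundary \<theta> (c n)")
      case True
      then obtain w where w: "star w * w = 1" "vmono w n \<in> Fix"
        unfolding continuous_coboundary_iff by blast
      have "vmono a n = \<iota> (a * star w) * vmono w n"
        using w(1) by (simp add: \<iota>_eq_vmono vmono_mult aut_power_0[OF \<alpha>] mult.assoc)
      then show ?thesis
        by (simp add: invariant_state_\<iota>_mult_fixed[OF 1 w(2)] invariant_state_\<iota>_mult_fixed[OF 2 w(2)]
            agree[OF w(2)])
    next
      case False
      then have "\<psi>\<^sub>1 (vmono a n) = 0" "\<psi>\<^sub>2 (vmono a n) = 0"
        using H invariant_state_nonzero_coboundary[OF 1] invariant_state_nonzero_coboundary[OF 2] by blast+
      then show ?thesis by simp
    qed
  qed
qed

end

lemma subgroup_int_generator: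
  fixes D :: "int set"
  assumes 0: "0 \<in> D" and add: "\<And>m n. m \<in> D \<Longrightarrow> n \<in> D \<Longrightarrow> m + n \<in> D"
    and neg: "\<And>m. m \<in> D \<Longrightarrow> - m \<in> D"
  obtains "D = {0}" | d where "d > 0" "d \<in> D" "\<And>n. n \<in> D \<Longrightarrow> d dvd n"
proof (cases "D = {0}")
  case False
  then obtain m where m: "m \<in> D" "m \<noteq> 0" using 0 by blast
  define Q where "Q k \<longleftrightarrow> k > 0 \<and> int k \<in> D" for k :: nat
  have "Q (nat \<bar>m\<bar>)" using m neg[of m] by (auto simp: Q_def abs_if)
  then have Q: "Q (LEAST k. Q k)" by (rule LeastI)
  define d where "d = int (LEAST k. Q k)"
  have d: "d > 0" "d \<in> D" using Q by (simp_all add: d_def Q_def)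
  have mult: "k * d \<in> D" for k
  proof (induction k rule: int_induct[where k = 0])
    case (step1 i)
    then show ?case using add[OF step1(2) d(2)] by (simp add: algebra_simps)
  next
    case (step2 i)
    then show ?case using add[OF step2(2) neg[OF d(2)]] by (simp add: algebra_simps)
  qed (simp add: 0)
  have "d dvd n" if n: "n \<in> D" for n
  proof (rule ccontr)
    assume "\<not> d dvd n"
    then have "n mod d > 0" using d(1) by (simp add: dvd_eq_mod_eq_0 order_less_le)
    moreover have "n mod d = n + - ((n div d) * d)" by (simp add: minus_div_mult_eq_mod[symmetric])
    then have "n mod d \<in> D" using add[OF n neg[OF mult]] by simp
    ultimately have "Q (nat (n mod d))" by (simp add: Q_def)
    then have "(LEAST k. Q k) \<le> nat (n mod d)" by (rule Least_le)
    then have "nat d \<le> nat (n mod d)" by (simp add: d_def)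
    then have "d \<le> n mod d" using d(1) by (simp add: nat_le_eq_zle)
    then show False using pos_mod_bound[OF d(1), of n] by linarith
  qed
  then show ?thesis using that(2) d by blast
qed (use that in blast)

context skew_setting
begin

subsection \<open>Extending states of the fixed-point algebra\<close>

text \<open>Products and adjoints of fixed monomials with unimodular coefficients are of the same
  kind, so their degrees form a subgroup of the integers.\<close>

lemma fixed_coboundary_subgroup:
  obtains "\<And>n. n \<noteq> 0 \<Longrightarrow> \<not> continuous_coboundary \<theta> (c n)"
  | d w where "d > 0" "star w * w = 1" "vmono w d \<in> Fix"
    "\<And>n. continuous_coboundary \<theta> (c n) \<Longrightarrow> d dvd n"
proof -
  note F = cstar_subalgebra_fixed_points
  define D where "D = {n. continuous_coboundary \<theta> (c n)}"
  have D: "n \<in> D \<longleftrightarrow> (\<exists>w. star w * w = 1 \<and> vmono w n \<in> Fix)" for n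
    by (simp add: D_def continuous_coboundary_iff)
  have ap: "star (aut_power \<alpha> k w) * aut_power \<alpha> k w = 1" if "star w * w = 1" for k w
    using that by (simp add: star_hom_star[OF aut_power_hom, symmetric] star_hom_mult[OF aut_power_hom, symmetric]
        star_hom_one[OF aut_power_hom])
  have "1 = vmono 1 0" by (rule one_eq_vmono)
  then have "vmono 1 0 \<in> Fix" using subalgebra_one[OF F] by simp
  then have 0: "0 \<in> D" unfolding D by (intro exI[of _ 1]) simp
  have add: "m + n \<in> D" if mn: "m \<in> D" "n \<in> D" for m n
  proof -
    obtain v w where v: "star v * v = 1" "vmono v m \<in> Fix"
      and w: "star w * w = 1" "vmono w n \<in> Fix" using mn unfolding D by blast
    define z where "z = aut_power \<alpha> m w"
    have "star (v * z) * (v * z) = star z * (star v * v) * z" by (simp only: star_mult mult.assoc)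
    then have "star (v * z) * (v * z) = 1" using ap[OF w(1), of m] by (simp add: v z_def)
    moreover have "vmono (v * z) (m + n) \<in> Fix"
      using subalgebra_mult[OF F v(2) w(2)] by (simp add: vmono_mult z_def)
    ultimately show ?thesis unfolding D by blast
  qed
  have neg: "- m \<in> D" if m: "m \<in> D" for m
  proof -
    obtain v where v: "star v * v = 1" "vmono v m \<in> Fix" using m unfolding D by blast
    have "star (star v) * star v = 1" using v(1) by (simp add: star_star bcontfun_mult_commute)
    from ap[OF this] show ?thesis
      unfolding D using subalgebra_star[OF F v(2)] by (auto simp: vmono_star)
  qed
  from subgroup_int_generator[OF 0 add neg] consider "D = {0}" | d where "d > 0" "d \<in> D" "\<And>n. n \<in> D \<Longrightarrow> d dvd n"
    by blast
  then show ?thesis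
  proof cases
    case 1
    then show ?thesis using that(1) unfolding D_def by blast
  next
    case (2 d)
    then obtain w where "star w * w = 1" "vmono w d \<in> Fix" unfolding D by blast
    then show ?thesis using that(2)[of d w] 2 by (simp add: D_def)
  qed
qed

context
  fixes \<phi> :: "'b \<Rightarrow> complex"
  assumes \<phi>: "state_on Fix \<phi>"
begin

text \<open>Here every fixed monomial is a scalar in degree 0 and zero in any other degree, so the
  fixed algebra has just one state.\<close>

lemma \<omega>_extends_if_no_coboundary:
  assumes none: "\<And>n. n \<noteq> 0 \<Longrightarrow> \<not> continuous_coboundary \<theta> (c n)"
    and b: "b \<in> Fix"
  shows "\<omega> b = \<phi> b"
proof (rule fixed_agree[OF \<phi> bounded_linear_\<omega> _ b])
  note F = cstar_subalgebra_fixed_points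
  fix a n assume a: "vmono a n \<in> Fix"
  show "\<omega> (vmono a n) = \<phi> (vmono a n)"
  proof (cases "n = 0")
    case True
    have "a = \<omega>\<^sub>0 a *\<^sub>C 1" using a True by (intro fixed_function_scalar) simp
    then have "vmono a 0 = \<omega>\<^sub>0 a *\<^sub>C 1" by (metis vmono_scaleC one_eq_vmono)
    then have "\<phi> (vmono a 0) = \<omega>\<^sub>0 a"
      by (simp add: state_scaleC[OF F \<phi>] subalgebra_one[OF F] state_one[OF F \<phi>])
    then show ?thesis by (simp add: True \<omega>_vmono)
  next
    case False
    then have "a = 0" using fixed_vmono_nonzero[OF a] none by blast
    then show ?thesis using False by (simp add: vmono_zero \<omega>_vmono state_zero[OF F \<phi>] linear_0[OF bounded_linear.linear[OF bounded_linear_\<omega>]])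
  qed
qed

text \<open>With \<open>W = w V\<^sup>d\<close> and \<open>K\<^sub>z = \<Sum>j<N. z\<^sup>j W\<^sup>j\<close>, averaging the positive functionals
  \<open>\<phi> (K\<^sub>z\<^sup>* K\<^sub>z) \<omega> (K\<^sub>z\<^sup>* x K\<^sub>z)\<close> over the \<open>2N\<close>-th roots of unity \<open>z\<close> gives states that map \<open>b W\<^sup>m\<close> to
  \<open>((N - \<bar>m\<bar>) / N)\<^sup>2 \<omega>\<^sub>0 b \<phi> (W\<^sup>m)\<close>; their limit is the required extension.\<close>

lemma extension_if_coboundary:
  assumes d: "d > 0" and w: "star w * w = 1" and Wfix: "vmono w d \<in> Fix"
    and dvd: "\<And>n. continuous_coboundary \<theta> (c n) \<Longrightarrow> d dvd n"
  shows "\<exists>\<psi>. invariant_state \<Phi> \<psi> \<and> (\<forall>b\<in>Fix. \<psi> b = \<phi> b)"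
proof -
  note F = cstar_subalgebra_fixed_points
  note st = cstar_subalgebra_UNIV \<omega>_state
  note st0 = cstar_subalgebra_UNIV \<omega>\<^sub>0_state
  define W where "W = vmono w d"
  have "w * star w = 1" using w by (simp add: bcontfun_mult_commute)
  then have W: "unitary W"
    using w unfolding unitary_def W_def
    by (simp add: vmono_star vmono_mult star_hom_mult[OF aut_power_hom, symmetric] star_hom_one[OF aut_power_hom]
        aut_power_inverse[OF \<alpha>] one_eq_vmono[symmetric])
  define P where "P = unitary_power W"
  have P_fixed: "P k \<in> Fix" for k
    unfolding P_def unitary_power_def using Wfix by (simp add: W_def subalgebra_intros[OF F])
  have P_add: "P (m + n) = P m * P n" for m n unfolding P_def by (rule unitary_power_add[OF W])
  have P_star: "star (P m) = P (- m)" for m unfolding P_def by (rule star_unitary_power[OF W])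
  have P_0: "P 0 = 1" unfolding P_def by (rule unitary_power_0[OF W])
  \<comment> \<open>The unimodular coefficients of the powers of \<open>W\<close> allow any monomial
    of degree \<open>m * d\<close> to be rewritten as a function times \<open>W^m\<close>.\<close>
  have "\<exists>e. star e * e = 1 \<and> P k = vmono e (k * d)" for k
  proof (induction k rule: int_induct[where k = 0])
    case base
    have "1 = vmono 1 0" by (rule one_eq_vmono)
    then show ?case by (intro exI[of _ 1]) (simp add: P_0)
  next
    case (step1 i)
    then obtain e where e: "star e * e = 1" "P i = vmono e (i * d)" by blast
    define z where "z = aut_power \<alpha> (i * d) w"
    have z: "star z * z = 1"
      unfolding z_def by (simp add: star_hom_star[OF aut_power_hom, symmetric]
          star_hom_mult[OF aut_power_hom, symmetric] w star_hom_one[OF aut_power_hom])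
    have "star (e * z) * (e * z) = star z * (star e * e) * z" by (simp only: star_mult mult.assoc)
    then have "star (e * z) * (e * z) = 1" by (simp add: e z)
    moreover have "P (i + 1) = vmono (e * z) ((i + 1) * d)"
      unfolding P_add e(2) using unitary_power_1[OF W]
      by (simp add: P_def W_def vmono_mult z_def distrib_right)
    ultimately show ?case by blast
  next
    case (step2 i)
    then obtain e where e: "star e * e = 1" "P i = vmono e (i * d)" by blast
    define z where "z = aut_power \<alpha> (i * d) (aut_power \<alpha> (- d) (star w))"
    have z: "star z * z = 1"
      unfolding z_def by (simp add: star_hom_star[OF aut_power_hom, symmetric]
          star_hom_mult[OF aut_power_hom, symmetric] star_star \<open>w * star w = 1\<close> star_hom_one[OF aut_power_hom])
    have "star (e * z) * (e * z) = star z * (star e * e) * z" by (simp only: star_mult mult.assoc)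
    then have "star (e * z) * (e * z) = 1" by (simp add: e z)
    moreover have "P (i - 1) = P i * star W"
      unfolding P_def by (rule unitary_power_pred[OF W])
    then have "P (i - 1) = vmono (e * z) ((i - 1) * d)"
      unfolding e(2) by (simp add: W_def vmono_mult vmono_star z_def left_diff_distrib)
    ultimately show ?case by blast
  qed
  then obtain e where e: "\<And>k. star (e k) * e k = 1" "\<And>k. P k = vmono (e k) (k * d)" by metis
  have vmono_W: "\<iota> b * P m = vmono (b * e m) (m * d)" for b m
    by (simp add: e(2) \<iota>_eq_vmono vmono_mult aut_power_0[OF \<alpha>])
  have vmono_eq: "vmono a (m * d) = \<iota> (a * star (e m)) * P m" for a m
    unfolding vmono_W using e(1)[of m] by (simp add: mult.assoc)
  have \<omega>_W: "\<omega> (star (P i) * (\<iota> b * P m) * P j) = (if i - j = m then \<omega>\<^sub>0 b else 0)" for i j m b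
  proof -
    have "star (P i) * (\<iota> b * P m) * P j = star (P i) * (\<iota> b * P (m + j))"
      by (simp only: P_add mult.assoc)
    also have "\<dots> = vmono (aut_power \<alpha> (- (i * d)) (star (e i) * (b * e (m + j)))) ((m + j) * d - i * d)"
      unfolding vmono_W e(2)[of i] star_vmono_mult ..
    finally have eq: "star (P i) * (\<iota> b * P m) * P j = \<dots>" .
    have "(m + j) * d - i * d = 0 \<longleftrightarrow> i - j = m" using d by auto
    moreover have "star (e i) * (b * e i) = b"
      using e(1)[of i] bcontfun_mult_left_commute[of "star (e i)" b "e i"] by simp
    ultimately show ?thesis unfolding eq \<omega>_vmono \<omega>\<^sub>0_aut_power by auto
  qed
  \<comment> \<open>Sandwiching by powers of \<open>W\<close> shifts degrees by multiples of
    \<open>d\<close>, so a degree not divisible by \<open>d\<close> never reaches 0.\<close>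
  have \<omega>_W0: "\<omega> (star (P i) * vmono a n * P j) = 0" if n: "\<not> d dvd n" for i j a n
  proof -
    have "star (P i) * vmono a n * P j = star (vmono (e i) (i * d)) * vmono (a * aut_power \<alpha> n (e j)) (n + j * d)"
      by (simp only: e(2) vmono_mult mult.assoc)
    moreover have "n + j * d - i * d \<noteq> 0"
    proof
      assume "n + j * d - i * d = 0"
      then have "n = (i - j) * d" by (simp add: algebra_simps)
      then show False using n by simp
    qed
    ultimately show ?thesis by (simp add: star_vmono_mult \<omega>_vmono)
  qed
  define K where "K N t = (\<Sum>i<N. cis (t * real i) *\<^sub>C P (int i))" for N :: nat and t
  have K_fixed: "K N t \<in> Fix" for N t
    unfolding K_def by (intro subalgebra_intros[OF F] P_fixed)
  have sandwich: "star (K N t) * x * K N t =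
      (\<Sum>i<N. \<Sum>j<N. cis (t * of_int (int j - int i)) *\<^sub>C (star (P (int i)) * x * P (int j)))" for N t x
  proof -
    have "star (K N t) * x = (\<Sum>i<N. cis (- (t * real i)) *\<^sub>C (star (P (int i)) * x))"
      by (simp add: K_def star_sum star_scaleC sum_distrib_right mult_scaleC_left cis_cnj)
    then have "star (K N t) * x * K N t =
        (\<Sum>i<N. \<Sum>j<N. (cis (- (t * real i)) *\<^sub>C (star (P (int i)) * x)) * (cis (t * real j) *\<^sub>C P (int j)))"
      by (simp add: K_def sum_product)
    then show ?thesis
      by (simp add: mult_scaleC_left mult_scaleC_right scaleC_scaleC cis_mult right_diff_distrib)
  qed
  define r where "r N t = Re (\<phi> (star (K N t) * K N t))" for N t
  have r0: "r N t \<ge> 0" for N t unfolding r_def by (rule state_Re[OF F \<phi> K_fixed])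
  have r: "complex_of_real (r N t) = (\<Sum>i<N. \<Sum>j<N. cis (t * of_int (int j - int i)) * \<phi> (P (int j - int i)))" for N t
  proof -
    have "complex_of_real (r N t) = \<phi> (star (K N t) * 1 * K N t)"
      by (simp add: r_def complex_eq_iff state_Im[OF F \<phi> K_fixed])
    also have "\<dots> = (\<Sum>i<N. \<Sum>j<N. cis (t * of_int (int j - int i)) * \<phi> (star (P (int i)) * 1 * P (int j)))"
      unfolding sandwich
      by (simp only: state_sum[OF F \<phi>] state_scaleC[OF F \<phi>] subalgebra_intros[OF F] P_fixed)
    finally show ?thesis by (simp add: P_star P_add[symmetric])
  qed
  \<comment> \<open>For \<open>\<bar>m\<bar> \<le> N\<close> the frequencies
    \<open>j - i - m\<close> have modulus below \<open>2 * N\<close>, so this many nodes give exact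
    orthogonality.\<close>
  define t where "t N k = 2 * pi * real k / real (2 * N)" for N k :: nat
  \<comment> \<open>The divisor is the value of the sum at 1: \<open>2 * N\<close> nodes, one factor
    \<open>N\<close> from the diagonal of \<open>r\<close> and another from the diagonal of the
    \<omega>-sandwich.\<close>
  define G where "G N x = (\<Sum>k<2 * N. complex_of_real (r N (t N k)) * \<omega> (star (K N (t N k)) * x * K N (t N k))) /
      of_nat (2 * N * (N * N))" for N x
  have Gsum: "(\<Sum>k<2 * N. complex_of_real (r N (t N k)) * cis (- (t N k * of_int m))) =
      of_nat (2 * N * (N - nat \<bar>m\<bar>)) * \<phi> (P m)" if N: "N > 0" and m: "\<bar>m\<bar> \<le> int N" for N m
  proof -
    have cm: "cis (s * of_int k) * z * cis (- (s * of_int m)) = cis (s * of_int (k - m)) * z" for s k z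
    proof -
      have "cis (s * of_int k) * z * cis (- (s * of_int m)) = cis (s * of_int k) * cis (- (s * of_int m)) * z"
        by (simp only: mult_ac)
      then show ?thesis by (simp add: cis_mult right_diff_distrib)
    qed
    have "(\<Sum>k<2 * N. complex_of_real (r N (t N k)) * cis (- (t N k * of_int m))) =
        (\<Sum>k<2 * N. \<Sum>i<N. \<Sum>j<N. cis (t N k * of_int (int j - int i - m)) * \<phi> (P (int j - int i)))"
      unfolding r sum_distrib_right cm ..
    also have "\<dots> = (\<Sum>i<N. \<Sum>j<N. \<Sum>k<2 * N. cis (t N k * of_int (int j - int i - m)) * \<phi> (P (int j - int i)))"
      by (rule trans[OF sum.swap sum.cong[OF refl sum.swap]])
    also have "\<dots> = (\<Sum>i<N. \<Sum>j<N. if int i - int j = - m then of_nat (2 * N) * \<phi> (P m) else 0)"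
    proof (intro sum.cong refl)
      fix i j assume ij: "i \<in> {..<N}" "j \<in> {..<N}"
      have "\<bar>int j - int i - m\<bar> < int (2 * N)" using ij m by auto
      from sum_roots_of_unity[OF _ this] N
      have "(\<Sum>k<2 * N. cis (t N k * of_int (int j - int i - m))) = (if int j - int i - m = 0 then of_nat (2 * N) else 0)"
        by (simp add: t_def)
      moreover have "int j - int i - m = 0 \<longleftrightarrow> int i - int j = - m" by auto
      moreover have "int i - int j = - m \<Longrightarrow> int j - int i = m" by auto
      ultimately show "(\<Sum>k<2 * N. cis (t N k * of_int (int j - int i - m)) * \<phi> (P (int j - int i))) =
          (if int i - int j = - m then of_nat (2 * N) * \<phi> (P m) else 0)"
        unfolding sum_distrib_right[symmetric] by auto
    qed
    finally show ?thesis unfolding sum_diff_eq_indicator by (simp add: mult_ac)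
  qed
  have G_W: "G N (\<iota> b * P m) = (complex_of_real (real (N - nat \<bar>m\<bar>) / real N))\<^sup>2 * (\<omega>\<^sub>0 b * \<phi> (P m))"
    if N: "N > 0" for N m b
  proof -
    have "\<omega> (star (K N s) * (\<iota> b * P m) * K N s) = of_nat (N - nat \<bar>m\<bar>) * (cis (- (s * of_int m)) * \<omega>\<^sub>0 b)" for s
    proof -
      have "\<omega> (star (K N s) * (\<iota> b * P m) * K N s) =
          (\<Sum>i<N. \<Sum>j<N. cis (s * of_int (int j - int i)) * \<omega> (star (P (int i)) * (\<iota> b * P m) * P (int j)))"
        unfolding sandwich by (simp only: state_sum[OF st] state_scaleC[OF st] UNIV_I)
      also have "\<dots> = (\<Sum>i<N. \<Sum>j<N. if int i - int j = m then cis (- (s * of_int m)) * \<omega>\<^sub>0 b else 0)"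
        unfolding \<omega>_W
      proof (intro sum.cong refl)
        fix i j :: nat
        have "int i - int j = m \<Longrightarrow> int j - int i = - m" by simp
        then show "cis (s * of_int (int j - int i)) * (if int i - int j = m then \<omega>\<^sub>0 b else 0) =
            (if int i - int j = m then cis (- (s * of_int m)) * \<omega>\<^sub>0 b else 0)"
          by (cases "int i - int j = m") (simp_all only: simp_thms if_True if_False of_int_minus mult_minus_right mult_zero_right)
      qed
      finally show ?thesis unfolding sum_diff_eq_indicator .
    qed
    then have "G N (\<iota> b * P m) = (\<Sum>k<2 * N. complex_of_real (r N (t N k)) * cis (- (t N k * of_int m))) *
        (of_nat (N - nat \<bar>m\<bar>) * \<omega>\<^sub>0 b) / of_nat (2 * N * (N * N))"
      unfolding G_def sum_distrib_right by (simp add: mult_ac)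
    also have "\<dots> = (complex_of_real (real (N - nat \<bar>m\<bar>) / real N))\<^sup>2 * (\<omega>\<^sub>0 b * \<phi> (P m))"
    proof (cases "\<bar>m\<bar> \<le> int N")
      case True
      show ?thesis unfolding Gsum[OF N True] using N by (simp add: field_simps power2_eq_square)
    next
      case False
      then have "N - nat \<bar>m\<bar> = 0" by linarith
      then show ?thesis by simp
    qed
    finally show ?thesis .
  qed
  have G_state: "state_on UNIV (G N)" if N: "N > 0" for N
    unfolding state_on_def
  proof (intro conjI ballI allI)
    fix x y k
    show "G N (x + y) = G N x + G N y"
      by (simp add: G_def distrib_left distrib_right state_add[OF st] sum.distrib add_divide_distrib)
    show "G N (k *\<^sub>C x) = k * G N x"
      by (simp add: G_def mult_scaleC_left mult_scaleC_right state_scaleC[OF st] sum_distrib_left mult_ac)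
    have "star (K N s) * (star x * x) * K N s = star (x * K N s) * (x * K N s)" for s
      by (simp add: star_mult mult.assoc)
    then have pos: "Im (\<omega> (star (K N s) * (star x * x) * K N s)) = 0"
      "0 \<le> Re (\<omega> (star (K N s) * (star x * x) * K N s))" for s
      by (simp_all add: state_Im[OF st] state_Re[OF st])
    define R where "R = (\<Sum>k<2 * N. r N (t N k) * Re (\<omega> (star (K N (t N k)) * (star x * x) * K N (t N k))))"
    have "G N (star x * x) = complex_of_real (R / real (2 * N * (N * N)))"
    proof -
      have "\<omega> (star (K N s) * (star x * x) * K N s) = complex_of_real (Re (\<omega> (star (K N s) * (star x * x) * K N s)))" for s
        using pos(1)[of s] by (simp add: complex_eq_iff)
      then have "(\<Sum>k<2 * N. complex_of_real (r N (t N k)) * \<omega> (star (K N (t N k)) * (star x * x) * K N (t N k))) = complex_of_real R"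
        unfolding R_def of_real_sum of_real_mult by (intro sum.cong refl) simp
      then show ?thesis unfolding G_def by simp
    qed
    moreover have "R \<ge> 0" unfolding R_def by (intro sum_nonneg mult_nonneg_nonneg r0 pos)
    ultimately show "Im (G N (star x * x)) = 0" "0 \<le> Re (G N (star x * x))"
      using N by simp_all
    have "G N (\<iota> 1 * P 0) = 1"
      unfolding G_W[OF N] using N by (simp add: P_0 state_one[OF F \<phi>] state_one[OF st0])
    then show "G N 1 = 1" by (simp add: P_0 \<iota>_simps)
  qed
  \<comment> \<open>\<open>G 0\<close> is 0 because of division by zero; the shift makes every term
    of the sequence a state.\<close>
  have G_lim: "(\<lambda>N. G (Suc N) (\<iota> b * P m)) \<longlonglongrightarrow> \<omega>\<^sub>0 b * \<phi> (P m)" for b m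
  proof -
    have "(\<lambda>N. complex_of_real (real (Suc N - nat \<bar>m\<bar>) / real (Suc N))) \<longlonglongrightarrow> complex_of_real 1"
      by (intro tendsto_of_real LIMSEQ_Suc[OF cesaro_weight_tendsto])
    from tendsto_mult[OF tendsto_power[OF this, of 2] tendsto_const[of "\<omega>\<^sub>0 b * \<phi> (P m)"]]
    show ?thesis unfolding G_W[OF zero_less_Suc] by simp
  qed
  have G_0: "G N (vmono a n) = 0" if "\<not> d dvd n" for N a n
    unfolding G_def sandwich by (simp add: state_sum[OF st] state_scaleC[OF st] \<omega>_W0[OF that])
  have conv: "convergent (\<lambda>N. G (Suc N) (vmono a n))" for a n
  proof (cases "d dvd n")
    case True
    then obtain m where "n = m * d" by (metis dvd_def mult.commute)
    then show ?thesis using convergentI[OF G_lim] by (simp add: vmono_eq)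
  qed (simp add: G_0 convergent_const)
  obtain \<psi> where bl: "bounded_linear \<psi>" and lim: "\<And>x. (\<lambda>N. G (Suc N) x) \<longlonglongrightarrow> \<psi> x"
    using operator_limit[of "\<lambda>N. G (Suc N)", OF bounded_linear_state[OF G_state] _ conv]
      state_norm_le[OF cstar_subalgebra_UNIV G_state] by blast
  have "state_on UNIV \<psi>"
    unfolding state_on_def
  proof (intro conjI ballI allI)
    fix x y k
    note Gs = cstar_subalgebra_UNIV G_state[OF zero_less_Suc]
    show "\<psi> (x + y) = \<psi> x + \<psi> y"
      by (rule linear_add[OF bounded_linear.linear[OF bl]])
    show "\<psi> (k *\<^sub>C x) = k * \<psi> x"
      using LIMSEQ_unique[OF lim[of "k *\<^sub>C x"]] tendsto_mult[OF tendsto_const[of k] lim[of x]]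
      by (simp add: state_scaleC[OF Gs])
    show "Im (\<psi> (star x * x)) = 0"
      using LIMSEQ_unique[OF tendsto_Im[OF lim[of "star x * x"]]] by (simp add: state_Im[OF Gs])
    show "0 \<le> Re (\<psi> (star x * x))"
      by (rule LIMSEQ_le_const[OF tendsto_Re[OF lim[of "star x * x"]]]) (simp add: state_Re[OF Gs])
    show "\<psi> 1 = 1"
      using LIMSEQ_unique[OF lim[of 1]] by (simp add: state_one[OF Gs])
  qed
  moreover have "\<psi> (\<Phi> g x) = \<psi> x" for g x
  proof -
    have "G N (\<Phi> g x) = G N x" for N
    proof -
      \<comment> \<open>The sums \<open>K\<close> consist of powers of the fixed unitary
        \<open>W\<close>, so the action passes through the sandwich to the invariant
        \<omega>.\<close>
      have "star (K N s) * \<Phi> g x * K N s = \<Phi> g (star (K N s) * x * K N s)" for s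
        using K_fixed[of N s] by (simp add: fixed_points_def star_hom_mult[OF \<Phi>_hom] star_hom_star[OF \<Phi>_hom])
      then show ?thesis by (simp add: G_def \<omega>_\<Phi>)
    qed
    then show ?thesis using LIMSEQ_unique[OF lim[of "\<Phi> g x"]] lim[of x] by simp
  qed
  ultimately have inv: "invariant_state \<Phi> \<psi>" by (auto simp: invariant_state_def)
  have "\<psi> b = \<phi> b" if b: "b \<in> Fix" for b
  proof (rule fixed_agree[OF \<phi> bl _ b])
    fix a n assume a: "vmono a n \<in> Fix"
    show "\<psi> (vmono a n) = \<phi> (vmono a n)"
    proof (cases "a = 0")
      case True
      then show ?thesis by (simp add: vmono_zero state_zero[OF F \<phi>] linear_0[OF bounded_linear.linear[OF bl]])
    next
      case False
      then have "d dvd n" by (intro dvd fixed_vmono_nonzero[OF a])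
      then obtain m where n: "n = m * d" by (metis dvd_def mult.commute)
      define b' where "b' = a * star (e m)"
      have eq: "vmono a n = \<iota> b' * P m" unfolding n b'_def by (rule vmono_eq)
      \<comment> \<open>Cancelling \<open>W^m\<close> from a fixed monomial leaves a fixed function,
        hence the scalar \<open>\<omega>\<^sub>0 b'\<close>; on such monomials the limit formula
        reproduces \<phi>.\<close>
      have "vmono b' 0 = vmono a n * P (- m)"
        unfolding eq using P_add[of m "- m"] by (simp add: P_0 mult.assoc \<iota>_eq_vmono)
      then have "vmono b' 0 \<in> Fix" using subalgebra_mult[OF F a P_fixed] by simp
      then have "b' = \<omega>\<^sub>0 b' *\<^sub>C 1" by (rule fixed_function_scalar)
      then have "\<iota> b' = \<omega>\<^sub>0 b' *\<^sub>C 1" by (metis \<iota>_simps(2,5))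
      then have "\<phi> (vmono a n) = \<omega>\<^sub>0 b' * \<phi> (P m)"
        unfolding eq by (simp add: mult_scaleC_left state_scaleC[OF F \<phi> P_fixed])
      moreover have "\<psi> (vmono a n) = \<omega>\<^sub>0 b' * \<phi> (P m)"
        unfolding eq using LIMSEQ_unique[OF lim G_lim] .
      ultimately show ?thesis by simp
    qed
  qed
  then show ?thesis using inv by blast
qed

lemma invariant_extension_exists:
  "\<exists>\<psi>. invariant_state \<Phi> \<psi> \<and> (\<forall>b\<in>Fix. \<psi> b = \<phi> b)"
proof (rule fixed_coboundary_subgroup)
  assume "\<And>n. n \<noteq> 0 \<Longrightarrow> \<not> continuous_coboundary \<theta> (c n)"
  then show ?thesis using \<omega>_extends_if_no_coboundary invariant_state_\<omega> by blast
next
  fix d w assume "d > 0" "star w * w = 1" "vmono w d \<in> Fix"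
    "\<And>n. continuous_coboundary \<theta> (c n) \<Longrightarrow> d dvd n"
  then show ?thesis by (rule extension_if_coboundary)
qed

end

theorem uniquely_ergodic_iff:
  "uniquely_ergodic_wrt_fixed_points \<Phi> \<longleftrightarrow>
    (\<forall>n. measurable_coboundary \<theta> \<mu> (c n) \<longrightarrow> continuous_coboundary \<theta> (c n))"
proof
  assume "uniquely_ergodic_wrt_fixed_points \<Phi>"
  then show "\<forall>n. measurable_coboundary \<theta> \<mu> (c n) \<longrightarrow> continuous_coboundary \<theta> (c n)"
    using measurable_coboundary_continuous by blast
next
  assume H: "\<forall>n. measurable_coboundary \<theta> \<mu> (c n) \<longrightarrow> continuous_coboundary \<theta> (c n)"
  show "uniquely_ergodic_wrt_fixed_points \<Phi>"
    unfolding uniquely_ergodic_wrt_fixed_points_def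
  proof (intro allI impI)
    fix \<phi> assume "state_on Fix \<phi>"
    from invariant_extension_exists[OF this]
    show "\<exists>!\<psi>. invariant_state \<Phi> \<psi> \<and> (\<forall>b\<in>Fix. \<psi> b = \<phi> b)"
      using invariant_extension_unique H by (metis (no_types, lifting))
  qed
qed

end

theorem theorem3p8:
  fixes \<theta> :: "'g::{topological_group_add, t2_space, second_countable_topology} \<Rightarrow>
      ('x::metric_space \<Rightarrow>\<^sub>C complex) \<Rightarrow> ('x \<Rightarrow>\<^sub>C complex)"
    and \<omega>\<^sub>0 :: "('x \<Rightarrow>\<^sub>C complex) \<Rightarrow> complex"
    and \<mu>\<^sub>0 :: "'x measure"
    and \<alpha> :: "('x \<Rightarrow>\<^sub>C complex) \<Rightarrow> ('x \<Rightarrow>\<^sub>C complex)"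
    and u :: "'g \<Rightarrow> ('x \<Rightarrow>\<^sub>C complex)"
    and \<iota> :: "('x \<Rightarrow>\<^sub>C complex) \<Rightarrow> 'b::cstar_algebra"
    and V :: 'b
  assumes "compact (UNIV :: 'x set)"
    and "locally_compact_space (euclidean :: 'g topology)"
    and "unimodular TYPE('g)"
    and "amenable TYPE('g)"
    and "cstar_dynamical_system \<theta>"
    and "uniquely_ergodic \<theta>"
    and "invariant_state \<theta> \<omega>\<^sub>0"
    and "prob_space \<mu>\<^sub>0"
    and "sets \<mu>\<^sub>0 = sets borel"
    and "\<And>f. \<omega>\<^sub>0 f = (\<integral>x. apply_bcontfun f x \<partial>\<mu>\<^sub>0)"
    and "star_automorphism \<alpha>"
    and "\<And>g. \<alpha> \<circ> \<theta> g = \<theta> g \<circ> \<alpha>"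
    and "continuous_cocycle \<theta> u"
    and "crossed_product \<alpha> \<iota> V"
  shows "uniquely_ergodic_wrt_fixed_points (skew_product \<iota> V \<theta> u) \<longleftrightarrow>
    (\<forall>n::int. measurable_coboundary \<theta> \<mu>\<^sub>0 (cocycle_power \<alpha> u n) \<longrightarrow>
       continuous_coboundary \<theta> (cocycle_power \<alpha> u n))"
proof -
  interpret skew_setting \<alpha> \<iota> V \<theta> \<omega>\<^sub>0 \<mu>\<^sub>0 u
    by (rule skew_setting.intro[OF crossed_product_CX.intro skew_setting_axioms.intro]) (fact assms)+
  show ?thesis using uniquely_ergodic_iff unfolding \<Phi>_def .
qed

end
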